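(* Let $G$ be a locally compact group and let $\mu$ be a probability measure on $G$. Then $\lambda_1(\mu)$ is mean ergodic if and only if $H_\mu$ is compact.
   Context: For a locally compact group $G$, $m_G$ is a left Haar measure, $L^1(G)=L^1(G,m_G)$, and $M(G)=C_0(G)^*$ is the space of bounded regular measures on $G$ (probability measures are the positive elements of norm $1$). $H_\mu$ denotes the closed subgroup of $G$ generated by the support of $\mu$. The convolution operator $\lambda_1(\mu)\colon L^1(G)\to L^1(G)$ is $(\lambda_1(\mu)f)(s)=\int f(x^{-1}s)\,d\mu(x)$. A bounded linear operator $T$ on a Banach space $X$ is mean ergodic if its Cesàro means $T_{[n]}=\frac1n\sum_{k=1}^n T^k$ converge in the strong operator topology to some bounded operator $P$ on $X$. *)

theory Defs
  imports "HOL-Analysis.Analysis"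
begin

text \<open>
  Groups are written additively because the library class of (not necessarily commutative)
  topological groups is \<^class>\<open>topological_group_add\<close>: the product \<open>x y\<close> reads \<open>x + y\<close>, the inverse
  of \<open>x\<close> reads \<open>- x\<close>, the unit reads \<open>0\<close>.  A locally compact group is a type of this class that is
  Hausdorff (\<^class>\<open>t2_space\<close>) and satisfies \<open>locally compact UNIV\<close>.
\<close>

section \<open>Measures on locally compact groups\<close>

text \<open>
  A nonzero left-invariant Radon measure: finite on compact sets, outer regular on Borel sets and
  inner regular on open sets.  (Inner regularity on all Borel sets would fail for some groups that
  are not sigma-compact.)
\<close>

definition left_haar_measure :: "'g::{t2_space, topological_group_add} measure \<Rightarrow> bool" where
  "left_haar_measure m \<longleftrightarrow>
     sets m = sets borel \<and>
     emeasure m UNIV \<noteq> 0 \<and>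
     (\<forall>K. compact K \<longrightarrow> emeasure m K < \<infinity>) \<and>
     (\<forall>A\<in>sets borel. emeasure m A = (INF U\<in>{U. open U \<and> A \<subseteq> U}. emeasure m U)) \<and>
     (\<forall>U. open U \<longrightarrow> emeasure m U = (SUP K\<in>{K. compact K \<and> K \<subseteq> U}. emeasure m K)) \<and>
     (\<forall>x. \<forall>A\<in>sets borel. emeasure m ((+) x ` A) = emeasure m A)"

text \<open>
  For a finite Borel measure on a Hausdorff space, inner regularity on all Borel sets implies
  outer regularity, by passing to complements.
\<close>

definition regular_probability :: "'g::t2_space measure \<Rightarrow> bool" where
  "regular_probability \<mu> \<longleftrightarrow>
     sets \<mu> = sets borel \<and>
     emeasure \<mu> UNIV = 1 \<and>
     (\<forall>A\<in>sets borel. emeasure \<mu> A = (SUP K\<in>{K. compact K \<and> K \<subseteq> A}. emeasure \<mu> K))"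

definition msupport :: "'g::topological_space measure \<Rightarrow> 'g set" where
  "msupport \<mu> = {x. \<forall>U. open U \<and> x \<in> U \<longrightarrow> emeasure \<mu> U > 0}"

definition is_subgroup :: "'g::group_add set \<Rightarrow> bool" where
  "is_subgroup H \<longleftrightarrow> 0 \<in> H \<and> (\<forall>x\<in>H. \<forall>y\<in>H. x + y \<in> H) \<and> (\<forall>x\<in>H. - x \<in> H)"

definition closed_subgroup_generated :: "'g::topological_group_add set \<Rightarrow> 'g set" where
  "closed_subgroup_generated S = \<Inter>{H. closed H \<and> is_subgroup H \<and> S \<subseteq> H}"

definition H_of :: "'g::topological_group_add measure \<Rightarrow> 'g set" where
  "H_of \<mu> = closed_subgroup_generated (msupport \<mu>)"

section \<open>Mean ergodic operators\<close>

text \<open>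
  A complex normed space of function classes is given by a vector space \<open>X\<close> of representatives and
  a seminorm \<open>p\<close> on \<open>X\<close>; the space itself is \<open>X\<close> modulo \<open>{f. p f = 0}\<close>, so equality of classes of
  \<open>f\<close> and \<open>g\<close> is \<open>p (f - g) = 0\<close>.  An operator is given by its action on representatives.
  Compatibility with equality of classes need not be required separately: it follows from
  linearity modulo \<open>p\<close> and boundedness.
\<close>

definition bounded_operator_on ::
    "('a \<Rightarrow> complex) set \<Rightarrow> (('a \<Rightarrow> complex) \<Rightarrow> real) \<Rightarrow> (('a \<Rightarrow> complex) \<Rightarrow> ('a \<Rightarrow> complex)) \<Rightarrow> bool"
  where
  "bounded_operator_on X p T \<longleftrightarrow>
     (\<forall>f\<in>X. T f \<in> X) \<and>
     (\<forall>f\<in>X. \<forall>g\<in>X. p (\<lambda>s. T (\<lambda>t. f t + g t) s - (T f s + T g s)) = 0) \<and>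
     (\<forall>c. \<forall>f\<in>X. p (\<lambda>s. T (\<lambda>t. c * f t) s - c * T f s) = 0) \<and>
     (\<exists>C. \<forall>f\<in>X. p (T f) \<le> C * p f)"

definition cesaro_mean ::
    "(('a \<Rightarrow> complex) \<Rightarrow> ('a \<Rightarrow> complex)) \<Rightarrow> nat \<Rightarrow> ('a \<Rightarrow> complex) \<Rightarrow> ('a \<Rightarrow> complex)" where
  "cesaro_mean T n f = (\<lambda>s. (1 / of_nat n) * (\<Sum>k=1..n. (T ^^ k) f s))"

definition mean_ergodic_on ::
    "('a \<Rightarrow> complex) set \<Rightarrow> (('a \<Rightarrow> complex) \<Rightarrow> real) \<Rightarrow> (('a \<Rightarrow> complex) \<Rightarrow> ('a \<Rightarrow> complex)) \<Rightarrow> bool"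
  where
  "mean_ergodic_on X p T \<longleftrightarrow>
     bounded_operator_on X p T \<and>
     (\<exists>P. bounded_operator_on X p P \<and>
          (\<forall>f\<in>X. (\<lambda>n. p (\<lambda>s. cesaro_mean T n f s - P f s)) \<longlonglongrightarrow> 0))"

section \<open>The space of integrable functions and the convolution operator\<close>

definition L1 :: "'a measure \<Rightarrow> ('a \<Rightarrow> complex) set" where
  "L1 m = {f. integrable m f}"

definition norm1 :: "'a measure \<Rightarrow> ('a \<Rightarrow> complex) \<Rightarrow> real" where
  "norm1 m f = (LINT s|m. norm (f s))"

lemma norm1_diff_eq_0_iff:
  assumes "f \<in> L1 m" "g \<in> L1 m"
  shows "norm1 m (\<lambda>s. f s - g s) = 0 \<longleftrightarrow> (AE s in m. f s = g s)"
  using assms integral_nonneg_eq_0_iff_AE[of m "\<lambda>s. norm (f s - g s)"]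
  by (simp add: L1_def norm1_def)

lemma bounded_operator_on_L1_cong:
  assumes T: "bounded_operator_on (L1 m) (norm1 m) T"
    and f: "f \<in> L1 m" and g: "g \<in> L1 m" and eq: "AE s in m. f s = g s"
  shows "AE s in m. T f s = T g s"
proof -
  define h where "h = (\<lambda>s. f s - g s)"
  have h: "h \<in> L1 m"
    using f g by (simp add: h_def L1_def)
  have TL: "T u \<in> L1 m" if "u \<in> L1 m" for u
    using T that by (simp add: bounded_operator_on_def)
  obtain C where "norm1 m (T h) \<le> C * norm1 m h"
    using T h by (auto simp: bounded_operator_on_def)
  moreover have "norm1 m h = 0"
    using norm1_diff_eq_0_iff[OF f g] eq by (simp add: h_def)
  ultimately have "norm1 m (\<lambda>s. T h s - 0) = 0"
    by (simp add: norm1_def order_antisym)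
  then have "AE s in m. T h s = 0"
    using norm1_diff_eq_0_iff[OF TL[OF h], of "\<lambda>_. 0"] by (simp add: L1_def)
  moreover have "AE s in m. T f s = T h s + T g s"
  proof -
    have "norm1 m (\<lambda>s. T (\<lambda>t. h t + g t) s - (T h s + T g s)) = 0"
      using T h g unfolding bounded_operator_on_def by blast
    moreover have "(\<lambda>t. h t + g t) = f"
      by (simp add: h_def)
    moreover have "(\<lambda>s. T h s + T g s) \<in> L1 m"
      using TL[OF h] TL[OF g] by (simp add: L1_def)
    ultimately show ?thesis
      using norm1_diff_eq_0_iff[OF TL[OF f]] by auto
  qed
  ultimately show ?thesis
    by eventually_elim simp
qed

text \<open>
  \<open>(\<lambda>\<^sub>1(\<mu>) f)(s)\<close> is the integral of \<open>f (x\<^sup>-\<^sup>1 s)\<close> with respect to \<open>\<mu>\<close>.  For integrable \<open>f\<close> this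
  integral exists for almost all \<open>s\<close>; at the remaining points the library integral is \<open>0\<close>.
\<close>

definition lambda1 ::
    "'g::topological_group_add measure \<Rightarrow> ('g \<Rightarrow> complex) \<Rightarrow> ('g \<Rightarrow> complex)" where
  "lambda1 \<mu> f = (\<lambda>s. LINT x|\<mu>. f (- x + s))"

end

theory Submission
  imports Defs
begin

text \<open>
  If \<open>H\<close> is compact, bounded functions supported in a compact \<open>H\<close>-invariant set are dense in
  \<open>L\<^sup>1\<close>, and on them the averages converge in \<open>L\<^sup>2\<close>, hence in \<open>L\<^sup>1\<close>.  Conversely, the limit of the
  averages of a bump function is a nonzero fixed vector.  It is represented by a continuous function
  vanishing at infinity that is harmonic for \<open>\<mu>\<close>.  By the maximum principle its maximum set \<open>M\<close>, which
  is compact, is mapped into itself by the inverses of the elements of the support of \<open>\<mu>\<close>;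
  by recurrence the stabilizer of \<open>M\<close> then contains \<open>H\<close>, and \<open>H\<close> embeds into a translate of \<open>M\<close>.
\<close>

section \<open>Topological groups\<close>

text \<open>The group is assumed neither sigma-compact nor second countable. So \<open>m\<close>
  need not be sigma-finite, and the map sending (x, s) to \<open>- x + s\<close> need not be
  measurable for the product sigma-algebra: Fubini's theorem is out of reach. What it would give
  (measurability of the convolution, contractivity, conservation of mass) is derived from the
  regularity of both measures instead. Conservation of mass holds for nonnegative functions of
  finite integral; it is what keeps the limit of the averages of a bump function from being zero.
  L^1 is in general not reflexive, so its unit ball offers no weak compactness. On a compact set,
  however, Haar measure is finite and convergence in L^2 is the stronger one; invariance of the set
  keeps the whole orbit there. In the converse direction a fixed class in L^1 has no values at
  points, whereas the maximum principle needs them. Convolution from the left commutes with right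
  translations, so uniform continuity with respect to right translations is inherited by all
  averages.\<close>

lemma compact_preimage_neighbourhood:
  fixes F :: "'a::topological_space \<Rightarrow> 'b::topological_space \<Rightarrow> 'c::topological_space"
  assumes "compact K" "open U" and F: "continuous_on UNIV (\<lambda>p. F (fst p) (snd p))"
    and "\<And>k. k \<in> K \<Longrightarrow> F x k \<in> U"
  obtains W where "open W" "x \<in> W" "\<And>y k. y \<in> W \<Longrightarrow> k \<in> K \<Longrightarrow> F y k \<in> U"
proof -
  have op: "open ((\<lambda>p. F (fst p) (snd p)) -` U)"
    using \<open>open U\<close> F by (simp add: open_vimage)
  have sub: "{x} \<times> K \<subseteq> (\<lambda>p. F (fst p) (snd p)) -` U"
    using assms(4) by auto
  obtain W where "x \<in> W \<and> open W \<and> W \<times> K \<subseteq> (\<lambda>p. F (fst p) (snd p)) -` U"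
    using Elementary_Topology.tube_lemma[OF \<open>compact K\<close> op sub] ..
  then show ?thesis
    by (intro that[of W]) auto
qed

lemma open_translate_vimage:
  fixes U :: "'g::topological_group_add set"
  assumes "open U"
  shows "open {x. a + x \<in> U}" "open {x. x + a \<in> U}" "open {x. - x + a \<in> U}" "open {x. - x \<in> U}"
  using open_vimage[OF assms, of "\<lambda>x. a + x"] open_vimage[OF assms, of "\<lambda>x. x + a"]
    open_vimage[OF assms, of "\<lambda>x. - x + a"] open_vimage[OF assms, of "\<lambda>x. - x"]
  by (simp_all add: vimage_def continuous_on_add continuous_on_minus)

lemma symmetric_neighbourhood:
  fixes V :: "'g::topological_group_add set"
  assumes "open V" "0 \<in> V"
  obtains W where "open W" "0 \<in> W" "W \<subseteq> V" "\<And>w. w \<in> W \<Longrightarrow> - w \<in> W"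
  by (rule that[of "V \<inter> {x. - x \<in> V}"]) (use assms in \<open>auto simp: open_translate_vimage open_Int\<close>)

lemma compact_sums_group:
  fixes A B :: "'g::topological_group_add set"
  assumes "compact A" "compact B"
  shows "compact {a + b |a b. a \<in> A \<and> b \<in> B}"
proof -
  have "compact ((\<lambda>p. fst p + snd p) ` (A \<times> B))"
    by (intro compact_continuous_image compact_Times assms continuous_intros)
  moreover have "(\<lambda>p. fst p + snd p) ` (A \<times> B) = {a + b |a b. a \<in> A \<and> b \<in> B}"
    by force
  ultimately show ?thesis by simp
qed

lemma locally_compact_between:
  fixes U :: "'a::topological_space set"
  assumes lc: "locally compact (UNIV :: 'a set)" and "compact Y" "open U" "Y \<subseteq> U"
  obtains W C where "open W" "compact C" "Y \<subseteq> W" "W \<subseteq> C" "C \<subseteq> U"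
proof -
  have "\<exists>W C. open W \<and> compact C \<and> y \<in> W \<and> W \<subseteq> C \<and> C \<subseteq> U" if "y \<in> Y" for y
  proof -
    have "openin (top_of_set UNIV) U" "y \<in> U"
      using assms that by auto
    then obtain W C where "openin (top_of_set UNIV) W" "compact C" "y \<in> W" "W \<subseteq> C" "C \<subseteq> U"
      using lc unfolding locally_def by meson
    then show ?thesis by auto
  qed
  then obtain W C where WC: "\<And>y. y \<in> Y \<Longrightarrow> open (W y) \<and> compact (C y) \<and> y \<in> W y \<and> W y \<subseteq> C y \<and> C y \<subseteq> U"
    by metis
  obtain F where F: "F \<subseteq> Y" "finite F" "Y \<subseteq> (\<Union>y\<in>F. W y)"
    using compactE_image[OF \<open>compact Y\<close>, of Y W] WC by blast
  show ?thesis
  proof (rule that[of "\<Union>y\<in>F. W y" "\<Union>y\<in>F. C y"])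
    show "open (\<Union>y\<in>F. W y)" using F WC by blast
    show "compact (\<Union>y\<in>F. C y)" using F WC by (intro compact_UN) auto
    show "(\<Union>y\<in>F. W y) \<subseteq> (\<Union>y\<in>F. C y)" using F(1) WC by blast
    show "(\<Union>y\<in>F. C y) \<subseteq> U" using F(1) WC by blast
  qed (use F in auto)
qed

text \<open>Supplies the Urysohn function of \<open>bump_function\<close>: a locally compact
  Hausdorff space is regular, and for locally compact spaces regularity amounts to complete
  regularity.\<close>

lemma completely_regular_locally_compact:
  assumes "locally compact (UNIV :: 'a::t2_space set)"
  shows "completely_regular_space (euclidean :: 'a topology)"
proof -
  have "locally_compact_space (euclidean :: 'a topology)"
    unfolding locally_compact_space_def
  proof
    fix x :: 'a
    obtain W C where "open W" "compact C" "{x} \<subseteq> W" "W \<subseteq> C"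
      using locally_compact_between[OF assms, of "{x}" UNIV] by auto
    then show "\<exists>U K. openin euclidean U \<and> compactin euclidean K \<and> x \<in> U \<and> U \<subseteq> K"
      by (intro exI[of _ W] exI[of _ C]) simp
  qed
  moreover have "Hausdorff_space (euclidean :: 'a topology)"
    unfolding Hausdorff_space_def disjnt_def using hausdorff by (metis open_openin)
  ultimately show ?thesis
    using completely_regular_eq_regular_space[of "euclidean :: 'a topology"]
      locally_compact_Hausdorff_imp_regular_space[of "euclidean :: 'a topology"] by simp
qed

text \<open>A discretisation device: on the piece \<open>E i\<close>, translating by
  \<open>x\<close> differs from translating by \<open>c i\<close> only by an element of
  \<open>V\<close>. A finite cover of \<open>K\<close> by sets \<open>y + V\<close> is made
  disjoint, so that the measures of the pieces add up exactly.\<close>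

lemma fine_partition:
  fixes K V :: "'g::{t2_space, topological_group_add} set"
  assumes "compact K" "open V" "0 \<in> V"
  obtains n :: nat and c :: "nat \<Rightarrow> 'g" and E :: "nat \<Rightarrow> 'g set" where
    "\<And>i. E i \<in> sets borel" "disjoint_family E" "K = (\<Union>i<n. E i)"
    "\<And>i x. x \<in> E i \<Longrightarrow> - c i + x \<in> V"
proof -
  obtain F where F: "finite F" "K \<subseteq> (\<Union>y\<in>F. {x. - y + x \<in> V})"
    by (rule compactE_image[OF \<open>compact K\<close>, of K "\<lambda>y. {x. - y + x \<in> V}"])
      (use assms in \<open>auto simp: add.assoc[symmetric] open_translate_vimage\<close>)
  obtain xs where xs: "set xs = F" using finite_list F by blast
  define A where "A i = (if i < length xs then K \<inter> {x. - xs ! i + x \<in> V} else {})" for i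
  have A: "A i \<in> sets borel" for i
    using assms by (auto simp: A_def intro!: sets.Int[OF borel_compact borel_open] open_translate_vimage)
  have un: "K = (\<Union>i<length xs. A i)"
    proof
    show "K \<subseteq> (\<Union>i<length xs. A i)"
    proof
      fix x assume "x \<in> K"
      then obtain y where "y \<in> set xs" "- y + x \<in> V" using F xs by auto
      then obtain i where "i < length xs" "xs ! i = y" by (auto simp: in_set_conv_nth)
      then show "x \<in> (\<Union>i<length xs. A i)"
        using \<open>x \<in> K\<close> \<open>- y + x \<in> V\<close> by (auto simp: A_def)
    qed
  qed (auto simp: A_def)
  show ?thesis
  proof (rule that[of "disjointed A" "length xs" "\<lambda>i. xs ! i"])
    show "disjointed A i \<in> sets borel" for i
      using sets.range_disjointed_sets[of A borel] A by auto
    show "disjoint_family (disjointed A)" by (rule disjoint_family_disjointed)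
    show "K = (\<Union>i<length xs. disjointed A i)"
      using un finite_UN_disjointed_eq[of A "length xs"] by (simp add: atLeast0LessThan)
    show "- xs ! i + x \<in> V" if "x \<in> disjointed A i" for i x
      using that disjointed_subset[of A i] by (auto simp: A_def split: if_splits)
  qed
qed

section \<open>Tonelli's theorem for the convolution\<close>

locale haar_probability =
  fixes m \<mu> :: "'g::{t2_space, topological_group_add} measure"
  assumes locally_compact: "locally compact (UNIV :: 'g set)"
    and haar: "left_haar_measure m"
    and regular: "regular_probability \<mu>"
begin

lemma sets_haar [measurable_cong, simp]: "sets m = sets borel"
  using haar by (simp add: left_haar_measure_def)

lemma sets_prob [measurable_cong, simp]: "sets \<mu> = sets borel"
  using regular by (simp add: regular_probability_def)

lemma space_haar [simp]: "space m = UNIV"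
  using sets_eq_imp_space_eq[OF sets_haar] by simp

lemma space_prob [simp]: "space \<mu> = UNIV"
  using sets_eq_imp_space_eq[OF sets_prob] by simp

lemma emeasure_prob_UNIV [simp]: "emeasure \<mu> UNIV = 1"
  using regular by (simp add: regular_probability_def)

sublocale finite_measure \<mu>
  by (rule finite_measureI) simp

lemma haar_compact_finite: "compact K \<Longrightarrow> emeasure m K < \<infinity>"
  using haar by (simp add: left_haar_measure_def)

lemma measurable_translate [measurable]:
  "(\<lambda>x. - x + s) \<in> borel_measurable (borel :: 'g measure)"
  "(\<lambda>x. a + x) \<in> borel_measurable (borel :: 'g measure)"
  by (intro borel_measurable_continuous_onI continuous_intros)+

lemma measurable_translate_compose:
  assumes "f \<in> measurable borel N"
  shows "(\<lambda>x. f (- x + s)) \<in> measurable \<mu> N"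
  using measurable_compose[OF measurable_translate(1) assms, of s] by simp

lemma emeasure_haar_translate:
  assumes "A \<in> sets borel"
  shows "emeasure m {s. - a + s \<in> A} = emeasure m A"
proof -
  have "{s. - a + s \<in> A} = (+) a ` A"
    by (auto simp: image_iff) (metis add_minus_cancel)
  then show ?thesis
    using haar assms by (simp add: left_haar_measure_def)
qed

lemma prob_inner:
  assumes "A \<in> sets borel" "t < emeasure \<mu> A"
  obtains K where "compact K" "K \<subseteq> A" "t < emeasure \<mu> K"
proof -
  have "emeasure \<mu> A = (SUP K\<in>{K. compact K \<and> K \<subseteq> A}. emeasure \<mu> K)"
    using assms regular by (simp add: regular_probability_def)
  then show ?thesis
    using assms(2) that by (auto simp: less_SUP_iff)
qed

lemma haar_outer:
  "A \<in> sets borel \<Longrightarrow> emeasure m A = (INF U\<in>{U. open U \<and> A \<subseteq> U}. emeasure m U)"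
  using haar unfolding left_haar_measure_def by blast

lemma haar_open_inner:
  "open U \<Longrightarrow> emeasure m U = (SUP K\<in>{K. compact K \<and> K \<subseteq> U}. emeasure m K)"
  using haar unfolding left_haar_measure_def by blast

text \<open>The convolution of \<open>\<mu>\<close> with the indicator of \<open>A\<close>, as
  \<open>conv_indicator\<close> confirms. Written as the measure of a set, it is directly accessible
  to the inner regularity of \<open>\<mu>\<close>.\<close>

definition hit :: "'g set \<Rightarrow> 'g \<Rightarrow> ennreal" where
  "hit A s = emeasure \<mu> {x. - x + s \<in> A}"

lemma vimage_translate_borel:
  assumes "A \<in> sets borel"
  shows "{x::'g. - x + s \<in> A} \<in> sets borel"
  using measurable_sets[OF measurable_translate(1) assms, of s] by (simp add: vimage_def)

lemma borel_Int_vimage_translate: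
  "compact K \<Longrightarrow> compact C \<Longrightarrow> K \<inter> {x::'g. - x + s \<in> C} \<in> sets borel"
  by (intro sets.Int borel_compact vimage_translate_borel)

lemma hit_le_1: "hit A s \<le> 1"
  unfolding hit_def using emeasure_space[of \<mu>] by simp

lemma hit_mono: "A \<subseteq> B \<Longrightarrow> B \<in> sets borel \<Longrightarrow> hit A s \<le> hit B s"
  unfolding hit_def by (intro emeasure_mono) (auto simp: vimage_translate_borel)

text \<open>Lower semicontinuity. Inner regularity puts more than \<open>t\<close> of the mass on a
  compact \<open>K\<close> with \<open>- x + s \<in> U\<close> for all \<open>x \<in> K\<close>; by
  compactness this survives a small change of \<open>s\<close>, with the same
  \<open>K\<close>.\<close>

lemma open_hit_greater:
  assumes "open U"
  shows "open {s. t < hit U s}"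
proof (subst open_subopen, intro ballI)
  fix s assume "s \<in> {s. t < hit U s}"
  then have "t < emeasure \<mu> {x. - x + s \<in> U}" by (simp add: hit_def)
  then obtain K where K: "compact K" "K \<subseteq> {x. - x + s \<in> U}" "t < emeasure \<mu> K"
    using prob_inner[of "{x. - x + s \<in> U}" t] vimage_translate_borel[of U s] assms by auto
  obtain W where W: "open W" "s \<in> W" "\<And>s' x. s' \<in> W \<Longrightarrow> x \<in> K \<Longrightarrow> - x + s' \<in> U"
    by (rule compact_preimage_neighbourhood[OF \<open>compact K\<close> \<open>open U\<close>, of "\<lambda>s x. - x + s" s])
      (use K in \<open>auto intro!: continuous_intros\<close>)
  have "t < hit U s'" if "s' \<in> W" for s'
    unfolding hit_def
    by (rule less_le_trans[OF K(3)], rule emeasure_mono)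
      (use that W assms in \<open>auto simp: vimage_translate_borel\<close>)
  then show "\<exists>T. open T \<and> s \<in> T \<and> T \<subseteq> {s. t < hit U s}"
    using W by (intro exI[of _ W]) auto
qed

text \<open>Open sets generate the Borel sets and are stable under intersection, so Dynkin's theorem
  reduces the claim to lower semicontinuity. Only sections in \<open>x\<close> are ever measured,
  never a set in the product space.\<close>

lemma hit_measurable:
  assumes "A \<in> sets borel"
  shows "hit A \<in> borel_measurable borel"
proof -
  have "Int_stable {S :: 'g set. open S}"
    by (auto simp: Int_stable_def)
  moreover have "{S :: 'g set. open S} \<subseteq> Pow UNIV"
    by simp
  moreover have "A \<in> sigma_sets UNIV {S. open S}"
    using assms by (simp add: borel_def)
  ultimately show ?thesis
  proof (induction A rule: sigma_sets_induct_disjoint)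
    case (basic U)
    then show ?case
      by (intro borel_measurableI_greater) (auto intro: borel_open open_hit_greater)
  next
    case empty
    then show ?case by (simp add: hit_def[abs_def])
  next
    case (compl A)
    then have A: "A \<in> sets borel" by (simp add: borel_def)
    have "hit (UNIV - A) = (\<lambda>s. 1 - hit A s)"
    proof
      fix s
      have "{x. - x + s \<in> UNIV - A} = space \<mu> - {x. - x + s \<in> A}" by auto
      then show "hit (UNIV - A) s = 1 - hit A s"
        using emeasure_compl[of "{x. - x + s \<in> A}" \<mu>] vimage_translate_borel[OF A, of s]
        by (simp add: hit_def)
    qed
    then show ?case using compl by simp
  next
    case (union A)
    then have A: "A i \<in> sets borel" for i by (auto simp: borel_def)
    have "hit (\<Union>i. A i) = (\<lambda>s. \<Sum>i. hit (A i) s)"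
    proof
      fix s
      have "{x. - x + s \<in> (\<Union>i. A i)} = (\<Union>i. {x. - x + s \<in> A i})" by auto
      moreover have "disjoint_family (\<lambda>i. {x. - x + s \<in> A i})"
        using union(1) by (auto simp: disjoint_family_on_def)
      ultimately show "hit (\<Union>i. A i) s = (\<Sum>i. hit (A i) s)"
        using suminf_emeasure[of "\<lambda>i. {x. - x + s \<in> A i}" \<mu>] vimage_translate_borel[OF A, of s]
        by (simp add: hit_def image_subset_iff)
    qed
    then show ?case using union by simp
  qed
qed

text \<open>Near each \<open>s\<close> some pair of compact sets witnesses the bound
  \<open>t\<close>; taking unions over a finite subcover of \<open>D\<close> only enlarges them, so
  one pair serves all of \<open>D\<close>. This brings a statement about the open set
  \<open>U\<close> within reach of \<open>nn_integral_hit_compact_le\<close>.\<close>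

lemma hit_compact_approximation:
  assumes D: "compact D" "open U" "\<And>s. s \<in> D \<Longrightarrow> t < hit U s"
  obtains K C where "compact K" "compact C" "C \<subseteq> U"
    "\<And>s. s \<in> D \<Longrightarrow> t < emeasure \<mu> (K \<inter> {x. - x + s \<in> C})"
proof -
  have "\<exists>K C W. compact K \<and> compact C \<and> C \<subseteq> U \<and> open W \<and> s \<in> W \<and> t < emeasure \<mu> K \<and>
      (\<forall>s'\<in>W. \<forall>x\<in>K. - x + s' \<in> C)" if "s \<in> D" for s
  proof -
    have "t < emeasure \<mu> {x. - x + s \<in> U}" using D that by (simp add: hit_def)
    then obtain K where K: "compact K" "K \<subseteq> {x. - x + s \<in> U}" "t < emeasure \<mu> K"
      using prob_inner[of "{x. - x + s \<in> U}" t] vimage_translate_borel[of U s] D by auto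
    have Y: "compact ((\<lambda>x. - x + s) ` K)"
      by (intro compact_continuous_image K continuous_intros)
    obtain O' C where C: "open O'" "compact C" "(\<lambda>x. - x + s) ` K \<subseteq> O'" "O' \<subseteq> C" "C \<subseteq> U"
      by (rule locally_compact_between[OF locally_compact Y \<open>open U\<close>]) (use K in auto)
    obtain W where W: "open W" "s \<in> W" "\<And>s' x. s' \<in> W \<Longrightarrow> x \<in> K \<Longrightarrow> - x + s' \<in> O'"
      by (rule compact_preimage_neighbourhood[OF \<open>compact K\<close> \<open>open O'\<close>, of "\<lambda>s x. - x + s" s])
        (use C in \<open>auto intro!: continuous_intros\<close>)
    show ?thesis
      by (intro exI[of _ K] exI[of _ C] exI[of _ W]) (use K C W in auto)
  qed
  then obtain K C W where KCW: "\<And>s. s \<in> D \<Longrightarrow> compact (K s) \<and> compact (C s) \<and> C s \<subseteq> U \<and>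
      open (W s) \<and> s \<in> W s \<and> t < emeasure \<mu> (K s) \<and> (\<forall>s'\<in>W s. \<forall>x\<in>K s. - x + s' \<in> C s)"
    by metis
  obtain F where F: "F \<subseteq> D" "finite F" "D \<subseteq> (\<Union>s\<in>F. W s)"
    by (rule compactE_image[OF \<open>compact D\<close>, of D W]) (use KCW in auto)
  have K: "compact (\<Union>s\<in>F. K s)" and C: "compact (\<Union>s\<in>F. C s)"
    using F KCW by (intro compact_UN; auto)+
  have "t < emeasure \<mu> ((\<Union>s\<in>F. K s) \<inter> {x. - x + s' \<in> (\<Union>s\<in>F. C s)})" if s': "s' \<in> D" for s'
  proof -
    obtain s where s: "s \<in> F" "s' \<in> W s" using subsetD[OF F(3) s'] by auto
    have "t < emeasure \<mu> (K s)" using s F KCW by auto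
    also have "\<dots> \<le> emeasure \<mu> ((\<Union>s\<in>F. K s) \<inter> {x. - x + s' \<in> (\<Union>s\<in>F. C s)})"
    proof (rule emeasure_mono)
      show "K s \<subseteq> (\<Union>s\<in>F. K s) \<inter> {x. - x + s' \<in> (\<Union>s\<in>F. C s)}"
        using s F(1) KCW[of s] by auto
      show "(\<Union>s\<in>F. K s) \<inter> {x. - x + s' \<in> (\<Union>s\<in>F. C s)} \<in> sets \<mu>"
        using borel_Int_vimage_translate[OF K C, of s'] by simp
    qed
    finally show ?thesis .
  qed
  moreover have "(\<Union>s\<in>F. C s) \<subseteq> U" using F(1) KCW by blast
  ultimately show ?thesis
    using that[OF K C] by blast
qed

text \<open>A step function has several level sets. A common pair for all of them permits comparing
  the whole step function with a single function of \<open>s\<close>.\<close>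

lemma hit_compact_family_approximation:
  fixes D :: "nat \<Rightarrow> 'g set"
  assumes I: "finite I" and D: "\<And>k. k \<in> I \<Longrightarrow> compact (D k)" "open U"
    "\<And>k s. k \<in> I \<Longrightarrow> s \<in> D k \<Longrightarrow> t k < hit U s"
  obtains K C where "compact K" "compact C" "C \<subseteq> U"
    "\<And>k s. k \<in> I \<Longrightarrow> s \<in> D k \<Longrightarrow> t k < emeasure \<mu> (K \<inter> {x. - x + s \<in> C})"
proof -
  have "\<exists>K C. compact K \<and> compact C \<and> C \<subseteq> U \<and>
      (\<forall>s\<in>D k. t k < emeasure \<mu> (K \<inter> {x. - x + s \<in> C}))" if "k \<in> I" for k
    using hit_compact_approximation[of "D k" U "t k"] D that by metis
  then obtain K C where KC: "\<And>k. k \<in> I \<Longrightarrow> compact (K k) \<and> compact (C k) \<and> C k \<subseteq> U \<and>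
      (\<forall>s\<in>D k. t k < emeasure \<mu> (K k \<inter> {x. - x + s \<in> C k}))"
    by metis
  have K: "compact (\<Union>k\<in>I. K k)" and C: "compact (\<Union>k\<in>I. C k)"
    using I KC by (intro compact_UN; auto)+
  have "t k < emeasure \<mu> ((\<Union>k\<in>I. K k) \<inter> {x. - x + s \<in> (\<Union>k\<in>I. C k)})"
    if "k \<in> I" "s \<in> D k" for k s
  proof -
    have "t k < emeasure \<mu> (K k \<inter> {x. - x + s \<in> C k})" using that KC by auto
    also have "\<dots> \<le> emeasure \<mu> ((\<Union>k\<in>I. K k) \<inter> {x. - x + s \<in> (\<Union>k\<in>I. C k)})"
      by (rule emeasure_mono)
        (use that borel_Int_vimage_translate[OF K C, of s] in auto)
    finally show ?thesis .
  qed
  then show ?thesis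
    using that[OF K C] KC by auto
qed

text \<open>Here \<open>\<mu>\<close> on \<open>K\<close> is replaced by point masses of size
  \<open>emeasure \<mu> (E i)\<close> at \<open>c i\<close>. For point masses the Tonelli identity
  is just left invariance of \<open>m\<close>.\<close>

lemma nn_integral_partition_translates:
  fixes E :: "nat \<Rightarrow> 'g set"
  assumes "A \<in> sets borel" "\<And>i. E i \<in> sets borel" "disjoint_family E" "K = (\<Union>i<n. E i)"
  shows "(\<integral>\<^sup>+s. (\<Sum>i<n. emeasure \<mu> (E i) * indicator {s. - c i + s \<in> A} s) \<partial>m) =
      emeasure \<mu> K * emeasure m A"
proof -
  have [measurable]: "{s. - c i + s \<in> A} \<in> sets borel" for i
    using measurable_sets[OF measurable_translate(2) assms(1), of "- c i"] by (simp add: vimage_def)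
  have "(\<integral>\<^sup>+s. (\<Sum>i<n. emeasure \<mu> (E i) * indicator {s. - c i + s \<in> A} s) \<partial>m) =
      (\<Sum>i<n. emeasure \<mu> (E i) * emeasure m {s. - c i + s \<in> A})"
    by (subst nn_integral_sum) (auto simp: nn_integral_cmult)
  also have "\<dots> = (\<Sum>i<n. emeasure \<mu> (E i)) * emeasure m A"
    using assms(1) by (simp add: emeasure_haar_translate sum_distrib_right)
  also have "(\<Sum>i<n. emeasure \<mu> (E i)) = emeasure \<mu> K"
    unfolding assms(4)
    by (rule sum_emeasure) (use assms in \<open>auto simp: disjoint_family_on_def\<close>)
  finally show ?thesis .
qed

text \<open>
  Neither half of the next two estimates needs joint measurability: on a piece of a sufficiently fine
  partition of \<open>K\<close> the translates of a compact set \<open>C\<close> stay inside one translate of \<open>U\<close>.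
\<close>

lemma nn_integral_hit_compact_le:
  assumes "compact K" "compact C" "open U" "C \<subseteq> U"
    and f: "\<And>s. f s \<le> emeasure \<mu> (K \<inter> {x. - x + s \<in> C})"
  shows "(\<integral>\<^sup>+s. f s \<partial>m) \<le> emeasure m U"
proof -
  \<comment> \<open>With \<open>V + C \<subseteq> U\<close>, a point \<open>x\<close> of
    \<open>E i\<close> such that \<open>- x + s \<in> C\<close> forces
    \<open>- c i + s = (- c i + x) + (- x + s)\<close> into \<open>U\<close>.\<close>
  obtain V where V: "open V" "0 \<in> V" "\<And>v y. v \<in> V \<Longrightarrow> y \<in> C \<Longrightarrow> v + y \<in> U"
    by (rule compact_preimage_neighbourhood[OF assms(2,3), of "\<lambda>v y. v + y" 0])
      (use assms in \<open>auto intro!: continuous_intros\<close>)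
  obtain n :: nat and c E where E: "\<And>i. E i \<in> sets borel" "disjoint_family E"
    "K = (\<Union>i<n. E i)" "\<And>i x. x \<in> E i \<Longrightarrow> - c i + x \<in> V"
    using fine_partition[OF assms(1) V(1,2)] by blast
  have "f s \<le> (\<Sum>i<n. emeasure \<mu> (E i) * indicator {s. - c i + s \<in> U} s)" for s
  proof -
    have Cb: "{x. - x + s \<in> C} \<in> sets borel"
      using assms by (intro vimage_translate_borel borel_compact)
    have "f s \<le> emeasure \<mu> (\<Union>i<n. E i \<inter> {x. - x + s \<in> C})"
      using f[of s] E(3) by simp
    also have "\<dots> \<le> (\<Sum>i<n. emeasure \<mu> (E i \<inter> {x. - x + s \<in> C}))"
      using E(1) Cb by (intro emeasure_subadditive_finite) auto
    also have "\<dots> \<le> (\<Sum>i<n. emeasure \<mu> (E i) * indicator {s. - c i + s \<in> U} s)"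
    proof (rule sum_mono)
      fix i assume "i \<in> {..<n}"
      show "emeasure \<mu> (E i \<inter> {x. - x + s \<in> C}) \<le> emeasure \<mu> (E i) * indicator {s. - c i + s \<in> U} s"
      proof (cases "E i \<inter> {x. - x + s \<in> C} = {}")
        case False
        then obtain x where x: "x \<in> E i" "- x + s \<in> C" by auto
        have "(- c i + x) + (- x + s) \<in> U"
          using V(3)[OF E(4)[OF x(1)] x(2)] .
        then have "- c i + s \<in> U" by (simp add: add.assoc)
        then show ?thesis
          using E(1)[of i] by (auto intro: emeasure_mono)
      qed simp
    qed
    finally show ?thesis .
  qed
  then have "(\<integral>\<^sup>+s. f s \<partial>m) \<le> (\<integral>\<^sup>+s. (\<Sum>i<n. emeasure \<mu> (E i) * indicator {s. - c i + s \<in> U} s) \<partial>m)"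
    by (intro nn_integral_mono)
  also have "\<dots> = emeasure \<mu> K * emeasure m U"
    using assms E by (intro nn_integral_partition_translates) auto
  also have "\<dots> \<le> 1 * emeasure m U"
    using emeasure_space[of \<mu> K] by (intro mult_right_mono) auto
  finally show ?thesis by simp
qed

lemma nn_integral_hit_compact_ge:
  assumes "compact K" "compact C" "open U" "C \<subseteq> U"
  shows "emeasure \<mu> K * emeasure m C \<le> (\<integral>\<^sup>+s. hit U s \<partial>m)"
proof -
  obtain V' where V': "open V'" "0 \<in> V'" "\<And>v y. v \<in> V' \<Longrightarrow> y \<in> C \<Longrightarrow> v + y \<in> U"
    by (rule compact_preimage_neighbourhood[OF assms(2,3), of "\<lambda>v y. v + y" 0])
      (use assms in \<open>auto intro!: continuous_intros\<close>)
  \<comment> \<open>The opposite estimate uses \<open>- x + s = - (- c i + x) + (- c i + s)\<close>,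
    which involves the inverse of an element of \<open>V\<close>; hence the symmetry.\<close>
  obtain V where V: "open V" "0 \<in> V" "V \<subseteq> V'" "\<And>v. v \<in> V \<Longrightarrow> - v \<in> V"
    using symmetric_neighbourhood[OF V'(1,2)] by blast
  obtain n :: nat and c E where E: "\<And>i. E i \<in> sets borel" "disjoint_family E"
    "K = (\<Union>i<n. E i)" "\<And>i x. x \<in> E i \<Longrightarrow> - c i + x \<in> V"
    using fine_partition[OF assms(1) V(1,2)] by blast
  have "(\<Sum>i<n. emeasure \<mu> (E i) * indicator {s. - c i + s \<in> C} s) \<le> hit U s" for s
  proof -
    have Ub: "{x. - x + s \<in> U} \<in> sets borel"
      using assms by (intro vimage_translate_borel) auto
    have "(\<Sum>i<n. emeasure \<mu> (E i) * indicator {s. - c i + s \<in> C} s) \<le>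
        (\<Sum>i<n. emeasure \<mu> (E i \<inter> {x. - x + s \<in> U}))"
    proof (rule sum_mono)
      fix i assume "i \<in> {..<n}"
      show "emeasure \<mu> (E i) * indicator {s. - c i + s \<in> C} s \<le> emeasure \<mu> (E i \<inter> {x. - x + s \<in> U})"
      proof (cases "- c i + s \<in> C")
        case True
        have "- x + s \<in> U" if "x \<in> E i" for x
        proof -
          have "- (- c i + x) \<in> V'"
            using V(3) V(4)[OF E(4)[OF that]] by auto
          then have "- (- c i + x) + (- c i + s) \<in> U"
            using V'(3) True by auto
          then show ?thesis by (simp add: minus_add add.assoc)
        qed
        then have "E i \<inter> {x. - x + s \<in> U} = E i" by auto
        then show ?thesis using True by simp
      qed simp
    qed
    also have "\<dots> = emeasure \<mu> (\<Union>i<n. E i \<inter> {x. - x + s \<in> U})"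
      by (rule sum_emeasure) (use E Ub in \<open>auto simp: disjoint_family_on_def\<close>)
    also have "\<dots> \<le> hit U s"
      unfolding hit_def using Ub by (intro emeasure_mono) auto
    finally show ?thesis .
  qed
  then have "(\<integral>\<^sup>+s. (\<Sum>i<n. emeasure \<mu> (E i) * indicator {s. - c i + s \<in> C} s) \<partial>m) \<le> (\<integral>\<^sup>+s. hit U s \<partial>m)"
    by (intro nn_integral_mono)
  then show ?thesis
    using nn_integral_partition_translates[of C E K n c] assms E by (simp add: borel_compact)
qed

text \<open>Inner regularity acts on both factors of \<open>emeasure \<mu> K * emeasure m C\<close>:
  the first has supremum 1 over compact \<open>K\<close>, the second has supremum
  \<open>emeasure m U\<close> over compact \<open>C \<subseteq> U\<close>.\<close>

lemma nn_integral_hit_open_ge: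
  assumes "open U"
  shows "emeasure m U \<le> (\<integral>\<^sup>+s. hit U s \<partial>m)"
proof -
  have "emeasure m C \<le> (\<integral>\<^sup>+s. hit U s \<partial>m)" if "compact C" "C \<subseteq> U" for C
  proof -
    have "(SUP K\<in>{K. compact K \<and> K \<subseteq> UNIV}. emeasure \<mu> K) = emeasure \<mu> UNIV"
      using regular unfolding regular_probability_def by (metis UNIV_I sets.top space_borel)
    then have "emeasure m C = (SUP K\<in>{K. compact K}. emeasure \<mu> K) * emeasure m C"
      by simp
    also have "\<dots> = (SUP K\<in>{K. compact K}. emeasure \<mu> K * emeasure m C)"
      by (rule SUP_mult_right_ennreal)
    also have "\<dots> \<le> (\<integral>\<^sup>+s. hit U s \<partial>m)"
      using that assms by (intro SUP_least nn_integral_hit_compact_ge) auto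
    finally show ?thesis .
  qed
  moreover have "emeasure m U = (SUP C\<in>{C. compact C \<and> C \<subseteq> U}. emeasure m C)"
    using assms by (rule haar_open_inner)
  ultimately show ?thesis
    by (auto intro: SUP_least)
qed

text \<open>A discrete layer-cake formula: up to \<open>1 / N\<close>, a number in [0, 1] is
  \<open>1 / N\<close> times the number of levels \<open>k / N\<close> strictly below it. Strict
  levels are chosen because they make the level sets of \<open>hit U\<close> open.\<close>

lemma ennreal_approximation_by_levels:
  fixes y :: ennreal and N :: nat
  assumes "y \<le> 1" "N > 0"
  shows "y \<le> ennreal (1 / N) + (\<Sum>k=1..N. ennreal (1 / N) * of_bool (ennreal (k / N) < y))"
proof -
  obtain r where r: "y = ennreal r" "0 \<le> r" "r \<le> 1"
    using assms by (cases y) (auto simp: top_unique)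
  \<comment> \<open>For \<open>r > 0\<close> this is the largest integer strictly below
    \<open>r * N\<close>; for \<open>r = 0\<close> truncated subtraction gives 0.\<close>
  define j where "j = nat \<lceil>r * N\<rceil> - 1"
  have jr: "r * N \<le> 1 + real j" and jl: "k \<le> j \<Longrightarrow> 1 \<le> k \<Longrightarrow> real k < r * N" for k
    using r unfolding j_def by linarith+
  have "r * N \<le> N" using r by (simp add: mult_left_le_one_le)
  then have jN: "j \<le> N" unfolding j_def by linarith
  have "{1..j} \<subseteq> {k\<in>{1..N}. real k / N < r}"
    using jl jN assms by (auto simp: field_simps)
  then have "j \<le> card {k\<in>{1..N}. real k / N < r}"
    using card_mono[of "{k\<in>{1..N}. real k / N < r}" "{1..j}"] by simp
  then have "r \<le> 1 / N + card {k\<in>{1..N}. real k / N < r} * (1 / N)"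
    using jr assms by (simp add: field_simps)
  then have "y \<le> ennreal (1 / N + card {k\<in>{1..N}. real k / N < r} * (1 / N))"
    by (subst r(1)) (rule ennreal_leI)
  also have "\<dots> = ennreal (1 / N) + of_nat (card {k\<in>{1..N}. real k / N < r}) * ennreal (1 / N)"
    by (subst ennreal_plus) (auto simp: ennreal_of_nat_eq_real_of_nat simp flip: ennreal_mult'')
  also have "of_nat (card {k\<in>{1..N}. real k / N < r}) * ennreal (1 / N) =
      (\<Sum>k\<in>{k\<in>{1..N}. real k / N < r}. ennreal (1 / N))"
    by simp
  also have "\<dots> = (\<Sum>k=1..N. if real k / N < r then ennreal (1 / N) else 0)"
    by (rule sum.inter_filter) simp
  also have "\<dots> = (\<Sum>k=1..N. ennreal (1 / N) * of_bool (ennreal (k / N) < y))"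
    using r by (intro sum.cong) (auto simp: ennreal_less_iff)
  finally show ?thesis .
qed

text \<open>The indices satisfying \<open>P\<close> lie between 1 and the largest of them, so there
  are at most as many as that largest index. Thus a lower bound for \<open>y\<close> at the top
  level alone controls the whole step function.\<close>

lemma sum_levels_le:
  fixes y :: ennreal and N :: nat
  assumes "N > 0" "\<And>k. k \<in> {1..N} \<Longrightarrow> P k \<Longrightarrow> ennreal (real k / real N) \<le> y"
  shows "(\<Sum>k=1..N. ennreal (1 / N) * of_bool (P k)) \<le> y"
proof (cases "{k\<in>{1..N}. P k} = {}")
  case True
  then have "(\<Sum>k=1..N. ennreal (1 / N) * of_bool (P k)) = 0" by (intro sum.neutral) auto
  then show ?thesis by (simp only: zero_le)
next
  case False
  let ?S = "{k\<in>{1..N}. P k}"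
  have fin: "finite ?S" by simp
  have Max: "Max ?S \<in> ?S" using Max_in[OF fin False] .
  have "?S \<subseteq> {1..Max ?S}" using Max_ge[OF fin] by auto
  then have "card ?S \<le> Max ?S"
    using card_mono[of "{1..Max ?S}" ?S] by simp
  have "(\<Sum>k=1..N. ennreal (1 / N) * of_bool (P k)) = (\<Sum>k=1..N. if P k then ennreal (1 / N) else 0)"
    by (intro sum.cong) auto
  also have "\<dots> = (\<Sum>k\<in>?S. ennreal (1 / N))"
    by (rule sum.inter_filter[symmetric]) simp
  also have "\<dots> = of_nat (card ?S) * ennreal (1 / N)"
    by simp
  also have "\<dots> \<le> of_nat (Max ?S) * ennreal (1 / N)"
    using \<open>card ?S \<le> Max ?S\<close> by (intro mult_right_mono) auto
  also have "\<dots> = ennreal (real (Max ?S) / real N)"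
    by (simp add: ennreal_of_nat_eq_real_of_nat flip: ennreal_mult'')
  also have "\<dots> \<le> y" using Max by (intro assms(2)) auto
  finally show ?thesis .
qed

lemma compact_sequence_SUP:
  assumes "open U"
  obtains D where "\<And>j::nat. compact (D j)" "\<And>j. D j \<subseteq> U" "(\<lambda>j. emeasure m (D j)) \<longlonglongrightarrow> emeasure m U"
proof -
  let ?A = "emeasure m ` {K. compact K \<and> K \<subseteq> U}"
  have ne: "?A \<noteq> {}" by (auto intro: exI[of _ "{}"])
  obtain f :: "nat \<Rightarrow> ennreal" where "incseq f \<and> range f \<subseteq> ?A \<and> Sup ?A = (SUP i. f i)"
    using ennreal_Sup_countable_SUP[OF ne] ..
  then have f: "incseq f" "range f \<subseteq> ?A" "Sup ?A = (SUP i. f i)"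
    by auto
  have "\<exists>K. compact K \<and> K \<subseteq> U \<and> f j = emeasure m K" for j
  proof -
    have "f j \<in> ?A" using f(2) by blast
    then show ?thesis by blast
  qed
  then obtain D where D: "\<And>j. compact (D j) \<and> D j \<subseteq> U \<and> f j = emeasure m (D j)" by metis
  have "f \<longlonglongrightarrow> emeasure m U"
    using LIMSEQ_SUP[OF f(1)] f(3) haar_open_inner[OF assms] by simp
  then show ?thesis
  proof (intro that[of D])
    have "f = (\<lambda>j. emeasure m (D j))" using D by auto
    then show "(\<lambda>j. emeasure m (D j)) \<longlonglongrightarrow> emeasure m U" using \<open>f \<longlonglongrightarrow> _\<close> by simp
  qed (use D in auto)
qed

text \<open>
  The measure \<open>\<mu> * m\<close> could a priori charge an open set without charging its compact subsets.
  Lower semicontinuity of \<^term>\<open>hit U\<close> rules this out: its level sets are open, hence exhausted by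
  compact sets, over which finitely many compact subsets of \<open>U\<close> suffice.
\<close>

lemma nn_integral_hit_open_le:
  assumes "open U"
  shows "(\<integral>\<^sup>+s. hit U s \<partial>m) \<le> emeasure m U"
proof -
  define L where "L N k = {s. ennreal (real k / real N) < hit U s}" for N k :: nat
  define h where "h N s = (\<Sum>k=1..N. ennreal (1 / N) * indicator (L N k) s)" for N :: nat and s
  have L: "open (L N k)" for N k
    unfolding L_def by (rule open_hit_greater[OF assms])
  have meas: "h N \<in> borel_measurable m" for N
  proof -
    have [measurable]: "L N k \<in> sets borel" for k using L by simp
    show ?thesis unfolding h_def by measurable
  qed
  have le: "(\<integral>\<^sup>+s. h N s \<partial>m) \<le> emeasure m U" if "N > 0" for N
  proof -
    have "\<exists>D. \<forall>j::nat. compact (D j) \<and> D j \<subseteq> L N k \<and> (\<lambda>j. emeasure m (D j)) \<longlonglongrightarrow> emeasure m (L N k)" for k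
      using compact_sequence_SUP[OF L[of N k]] by metis
    then obtain D where D: "\<And>k j::nat. compact (D k j)" "\<And>k j. D k j \<subseteq> L N k"
      "\<And>k. (\<lambda>j. emeasure m (D k j)) \<longlonglongrightarrow> emeasure m (L N k)"
      by metis
    have level: "ennreal (real k / real N) < hit U s" if "s \<in> D k j" for k s j
      using subsetD[OF D(2) that] by (simp add: L_def)
    have "(\<Sum>k=1..N. ennreal (1 / N) * emeasure m (D k j)) \<le> emeasure m U" for j
    proof -
      obtain K C where KC: "compact K" "compact C" "C \<subseteq> U"
        "\<And>k s. k \<in> {1..N} \<Longrightarrow> s \<in> D k j \<Longrightarrow> ennreal (real k / real N) < emeasure \<mu> (K \<inter> {x. - x + s \<in> C})"
        using hit_compact_family_approximation[of "{1..N}" "\<lambda>k. D k j" U "\<lambda>k. ennreal (real k / real N)",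
          OF _ D(1) assms level[of _ _ j]] by blast
      have "(\<Sum>k=1..N. ennreal (1 / N) * indicator (D k j) s) \<le> emeasure \<mu> (K \<inter> {x. - x + s \<in> C})" for s
        using sum_levels_le[OF \<open>N > 0\<close>, of "\<lambda>k. s \<in> D k j"] KC(4)[THEN less_imp_le]
        by (simp add: indicator_def)
      then have "(\<integral>\<^sup>+s. (\<Sum>k=1..N. ennreal (1 / N) * indicator (D k j) s) \<partial>m) \<le> emeasure m U"
        by (rule nn_integral_hit_compact_le[OF KC(1,2) assms KC(3)])
      moreover have "(\<integral>\<^sup>+s. (\<Sum>k=1..N. ennreal (1 / N) * indicator (D k j) s) \<partial>m) =
          (\<Sum>k=1..N. ennreal (1 / N) * emeasure m (D k j))"
      proof -
        have [measurable]: "D k j \<in> sets borel" for k using D(1) by (rule borel_compact)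
        show ?thesis by (subst nn_integral_sum) (auto intro!: sum.cong nn_integral_cmult_indicator)
      qed
      ultimately show ?thesis by simp
    qed
    moreover have "(\<lambda>j. \<Sum>k=1..N. ennreal (1 / N) * emeasure m (D k j)) \<longlonglongrightarrow>
        (\<Sum>k=1..N. ennreal (1 / N) * emeasure m (L N k))"
      using D(3) by (intro tendsto_sum ennreal_tendsto_cmult) auto
    ultimately have "(\<Sum>k=1..N. ennreal (1 / N) * emeasure m (L N k)) \<le> emeasure m U"
      by (intro LIMSEQ_le_const2) auto
    moreover have "(\<integral>\<^sup>+s. h N s \<partial>m) = (\<Sum>k=1..N. ennreal (1 / N) * emeasure m (L N k))"
    proof -
      have [measurable]: "L N k \<in> sets borel" for k using L by simp
      show ?thesis
        unfolding h_def by (subst nn_integral_sum) (auto intro!: sum.cong nn_integral_cmult_indicator)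
    qed
    ultimately show ?thesis by simp
  qed
  \<comment> \<open>The functions \<open>h N\<close> are not monotone in \<open>N\<close>, so
    Fatou's lemma takes the place of monotone convergence. The index \<open>Suc n\<close> avoids
    division by 0.\<close>
  have "hit U s \<le> liminf (\<lambda>n. h (Suc n) s)" for s
  proof -
    have "hit U s \<le> ennreal (1 / Suc n) + h (Suc n) s" for n
      using ennreal_approximation_by_levels[OF hit_le_1, of "Suc n" U s]
      unfolding h_def L_def indicator_def mem_Collect_eq by blast
    then have "hit U s - ennreal (1 / Suc n) \<le> h (Suc n) s" for n
      by (simp only: ennreal_minus_le_iff) simp
    then have "liminf (\<lambda>n. hit U s - ennreal (1 / Suc n)) \<le> liminf (\<lambda>n. h (Suc n) s)"
      by (intro Liminf_mono always_eventually) auto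
    moreover have "(\<lambda>n. hit U s - ennreal (1 / Suc n)) \<longlonglongrightarrow> hit U s - ennreal 0"
      using hit_le_1[of U s]
      by (intro tendsto_diff_ennreal tendsto_const tendsto_ennrealI LIMSEQ_Suc[OF lim_1_over_n])
        (auto simp: top_unique)
    ultimately show ?thesis
      by (simp add: lim_imp_Liminf)
  qed
  then have "(\<integral>\<^sup>+s. hit U s \<partial>m) \<le> (\<integral>\<^sup>+s. liminf (\<lambda>n. h (Suc n) s) \<partial>m)"
    by (intro nn_integral_mono)
  also have "\<dots> \<le> liminf (\<lambda>n. \<integral>\<^sup>+s. h (Suc n) s \<partial>m)"
    by (intro nn_integral_liminf meas)
  also have "\<dots> \<le> liminf (\<lambda>n. emeasure m U)"
    by (intro Liminf_mono always_eventually allI le) simp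
  finally show ?thesis by (simp add: Liminf_const)
qed

lemma nn_integral_hit_le:
  assumes "A \<in> sets borel"
  shows "(\<integral>\<^sup>+s. hit A s \<partial>m) \<le> emeasure m A"
  unfolding haar_outer[OF assms]
proof (rule INF_greatest)
  fix U assume "U \<in> {U. open U \<and> A \<subseteq> U}"
  then have "(\<integral>\<^sup>+s. hit A s \<partial>m) \<le> (\<integral>\<^sup>+s. hit U s \<partial>m)"
    by (intro nn_integral_mono hit_mono) auto
  also have "\<dots> \<le> emeasure m U"
    using \<open>U \<in> _\<close> by (intro nn_integral_hit_open_le) auto
  finally show "(\<integral>\<^sup>+s. hit A s \<partial>m) \<le> emeasure m U" .
qed

lemma finite_haar_outer:
  assumes "A \<in> sets borel" "emeasure m A < \<infinity>" "0 < e"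
  obtains U where "open U" "A \<subseteq> U" "emeasure m U < emeasure m A + e"
proof -
  have "emeasure m A < emeasure m A + e"
    using assms by (simp add: ennreal_less_iff)
  then have "(INF U\<in>{U. open U \<and> A \<subseteq> U}. emeasure m U) < emeasure m A + e"
    using haar_outer[OF assms(1)] by simp
  then show ?thesis using that by (auto simp: INF_less_iff)
qed

text \<open>Take an open \<open>U\<close> of finite measure around \<open>A\<close>. The integral
  for \<open>U\<close> is at least \<open>emeasure m U\<close>, while the parts from
  \<open>A\<close> and \<open>U - A\<close> are at most their own measures; so nothing can be lost
  on \<open>A\<close>. Finiteness matters: for a locally null set of infinite measure the left side
  can be 0.\<close>

lemma nn_integral_hit_eq:
  assumes A: "A \<in> sets borel" "emeasure m A < \<infinity>"
  shows "(\<integral>\<^sup>+s. hit A s \<partial>m) = emeasure m A"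
proof (rule antisym[OF nn_integral_hit_le[OF A(1)]])
  obtain U where U: "open U" "A \<subseteq> U" "emeasure m U < emeasure m A + 1"
    using finite_haar_outer[OF A] by (metis zero_less_one)
  then have fin: "emeasure m U < \<infinity>"
    using A(2) by (metis ennreal_add_less_top ennreal_one_less_top infinity_ennreal_def less_trans)
  have Ub: "U \<in> sets borel" using U by simp
  have "hit U s = hit A s + hit (U - A) s" for s
  proof -
    have "{x. - x + s \<in> U} = {x. - x + s \<in> A} \<union> {x. - x + s \<in> U - A}" using U by auto
    then show ?thesis
      unfolding hit_def using vimage_translate_borel[of A s] vimage_translate_borel[of "U - A" s] A Ub
      by (subst plus_emeasure) auto
  qed
  then have "(\<integral>\<^sup>+s. hit U s \<partial>m) = (\<integral>\<^sup>+s. hit A s \<partial>m) + (\<integral>\<^sup>+s. hit (U - A) s \<partial>m)"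
    using hit_measurable[OF A(1)] hit_measurable[of "U - A"] A Ub
    by (simp add: nn_integral_add cong: nn_integral_cong)
  then have "emeasure m A + emeasure m (U - A) \<le> (\<integral>\<^sup>+s. hit A s \<partial>m) + emeasure m (U - A)"
    using nn_integral_hit_open_ge[OF U(1)] nn_integral_hit_le[of "U - A"] A Ub U(2)
      emeasure_mono[of A U m]
    by (simp add: plus_emeasure Un_absorb1) (metis add_left_mono order_trans)
  moreover have "emeasure m (U - A) \<le> emeasure m U"
    using Ub by (intro emeasure_mono) auto
  then have "emeasure m (U - A) \<noteq> top"
    using fin by (auto simp: top_unique)
  ultimately show "emeasure m A \<le> (\<integral>\<^sup>+s. hit A s \<partial>m)"
    by (simp add: ennreal_add_left_cancel_le add.commute)
qed

section \<open>Convolution of nonnegative Borel functions\<close>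

definition conv :: "('g \<Rightarrow> ennreal) \<Rightarrow> 'g \<Rightarrow> ennreal" where
  "conv f s = (\<integral>\<^sup>+x. f (- x + s) \<partial>\<mu>)"

lemma conv_indicator:
  assumes "A \<in> sets borel"
  shows "conv (indicator A) = hit A"
proof
  fix s
  have "conv (indicator A) s = (\<integral>\<^sup>+x. indicator {x. - x + s \<in> A} x \<partial>\<mu>)"
    unfolding conv_def by (intro nn_integral_cong) (auto simp: indicator_def)
  then show "conv (indicator A) s = hit A s"
    using vimage_translate_borel[OF assms, of s] by (simp add: hit_def)
qed

lemma conv_cmult: "f \<in> borel_measurable borel \<Longrightarrow> conv (\<lambda>x. c * f x) = (\<lambda>s. c * conv f s)"
  unfolding conv_def by (intro ext nn_integral_cmult measurable_translate_compose)

lemma conv_add: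
  "f \<in> borel_measurable borel \<Longrightarrow> g \<in> borel_measurable borel \<Longrightarrow>
    conv (\<lambda>x. f x + g x) = (\<lambda>s. conv f s + conv g s)"
  unfolding conv_def by (intro ext nn_integral_add measurable_translate_compose)

lemma conv_SUP:
  assumes "\<And>i. U i \<in> borel_measurable borel" "incseq U"
  shows "conv (SUP i. U i) = (SUP i. conv (U i))"
proof
  fix s
  have "conv (SUP i. U i) s = (\<integral>\<^sup>+x. (SUP i. U i (- x + s)) \<partial>\<mu>)"
    by (simp add: conv_def image_comp)
  also have "\<dots> = (SUP i. \<integral>\<^sup>+x. U i (- x + s) \<partial>\<mu>)"
    using assms by (intro nn_integral_monotone_convergence_SUP measurable_translate_compose)
      (auto simp: incseq_def le_fun_def)
  finally show "conv (SUP i. U i) s = (SUP i. conv (U i)) s"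
    by (simp add: conv_def[abs_def] image_comp)
qed

lemma conv_mono: "(\<And>x. f x \<le> g x) \<Longrightarrow> conv f s \<le> conv g s"
  unfolding conv_def by (intro nn_integral_mono) auto

text \<open>The claims go through one induction because the integral estimates for sums and limits
  need the measurability of \<open>conv\<close>. Finiteness of the integral, required for equality,
  is inherited by summands and by the members of an increasing sequence.\<close>

lemma conv_measurable_integral:
  assumes "f \<in> borel_measurable borel"
  shows "conv f \<in> borel_measurable borel \<and> (\<integral>\<^sup>+s. conv f s \<partial>m) \<le> (\<integral>\<^sup>+s. f s \<partial>m) \<and>
    ((\<integral>\<^sup>+s. f s \<partial>m) < \<infinity> \<longrightarrow> (\<integral>\<^sup>+s. conv f s \<partial>m) = (\<integral>\<^sup>+s. f s \<partial>m))"
  using assms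
proof (induction f rule: borel_measurable_induct)
  case (cong f g)
  then have "f = g" by auto
  then show ?case using cong by simp
next
  case (set A)
  then show ?case
    by (simp add: conv_indicator hit_measurable nn_integral_hit_le nn_integral_hit_eq)
next
  case (mult u c)
  \<comment> \<open>In \<open>ennreal\<close> the product of 0 and \<infinity> is 0, so a finite
    product allows an infinite integral when \<open>c = 0\<close>; both sides are then 0.\<close>
  have "c = 0 \<or> (\<integral>\<^sup>+s. u s \<partial>m) < \<infinity>" if "c * (\<integral>\<^sup>+s. u s \<partial>m) < \<infinity>"
    using that by (auto simp: ennreal_mult_less_top)
  then show ?case
    using mult by (auto simp: conv_cmult nn_integral_cmult intro!: mult_left_mono)
next
  case (add u v)
  then show ?case
    by (auto simp: conv_add nn_integral_add intro: add_mono)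
next
  case (seq U)
  have U [measurable]: "U i \<in> borel_measurable m" "conv (U i) \<in> borel_measurable m" for i
    using seq(1) seq(5)[of i, THEN conjunct1] by (simp_all cong: measurable_cong_sets)
  have "incseq (\<lambda>i. conv (U i))"
    using seq(3) unfolding incseq_def le_fun_def by (intro allI impI conv_mono) blast
  then have 1: "(\<integral>\<^sup>+s. conv (SUP i. U i) s \<partial>m) = (SUP i. \<integral>\<^sup>+s. conv (U i) s \<partial>m)"
    unfolding conv_SUP[OF seq(1,3)] SUP_apply
    by (intro nn_integral_monotone_convergence_SUP) auto
  have 2: "(\<integral>\<^sup>+s. (SUP i. U i) s \<partial>m) = (SUP i. \<integral>\<^sup>+s. U i s \<partial>m)"
    unfolding SUP_apply using seq by (intro nn_integral_monotone_convergence_SUP) auto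
  have "conv (SUP i. U i) \<in> borel_measurable borel"
    unfolding conv_SUP[OF seq(1,3)] using borel_measurable_SUP[of UNIV "\<lambda>i. conv (U i)" borel] seq(5) by (simp add: image_comp SUP_apply[abs_def])
  moreover have "(SUP i. \<integral>\<^sup>+s. conv (U i) s \<partial>m) \<le> (SUP i. \<integral>\<^sup>+s. U i s \<partial>m)"
    using seq by (intro SUP_mono) auto
  moreover have "(SUP i. \<integral>\<^sup>+s. conv (U i) s \<partial>m) = (SUP i. \<integral>\<^sup>+s. U i s \<partial>m)"
    if "(SUP i. \<integral>\<^sup>+s. U i s \<partial>m) < \<infinity>"
  proof -
    have "(\<integral>\<^sup>+s. U i s \<partial>m) < \<infinity>" for i
      using that SUP_upper[of i UNIV "\<lambda>i. \<integral>\<^sup>+s. U i s \<partial>m"] by (auto intro: le_less_trans)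
    then show ?thesis using seq by simp
  qed
  ultimately show ?case unfolding 1 2 by blast
qed

lemmas conv_measurable [measurable] = conv_measurable_integral[THEN conjunct1]
lemmas nn_integral_conv_le = conv_measurable_integral[THEN conjunct2, THEN conjunct1]
lemmas nn_integral_conv_eq = conv_measurable_integral[THEN conjunct2, THEN conjunct2, rule_format]

end

section \<open>The convolution operator on integrable functions\<close>

lemma norm1_nonneg [simp]: "0 \<le> norm1 M f"
  by (simp add: norm1_def)

lemma ennreal_norm1: "f \<in> L1 M \<Longrightarrow> ennreal (norm1 M f) = (\<integral>\<^sup>+s. ennreal (norm (f s)) \<partial>M)"
  unfolding norm1_def L1_def by (intro nn_integral_eq_integral[symmetric]) auto

lemma norm1_cong_AE:
  assumes "f \<in> L1 M" "g \<in> L1 M" "AE s in M. f s = g s"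
  shows "norm1 M f = norm1 M g"
  unfolding norm1_def using assms by (intro integral_cong_AE) (auto simp: L1_def)

lemma norm1_triangle:
  assumes "f \<in> L1 M" "g \<in> L1 M"
  shows "norm1 M (\<lambda>s. f s + g s) \<le> norm1 M f + norm1 M g"
proof -
  have "norm1 M (\<lambda>s. f s + g s) \<le> (LINT s|M. norm (f s) + norm (g s))"
    unfolding norm1_def using assms by (intro integral_mono) (auto simp: L1_def norm_triangle_ineq)
  then show ?thesis
    using assms by (simp add: norm1_def L1_def)
qed

lemma norm1_triangle_diff:
  assumes "f \<in> L1 M" "g \<in> L1 M" "h \<in> L1 M"
  shows "norm1 M (\<lambda>s. f s - h s) \<le> norm1 M (\<lambda>s. f s - g s) + norm1 M (\<lambda>s. g s - h s)"
  using norm1_triangle[of "\<lambda>s. f s - g s" M "\<lambda>s. g s - h s"] assms by (simp add: L1_def)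

lemma norm1_minus_commute: "norm1 M (\<lambda>s. f s - g s) = norm1 M (\<lambda>s. g s - f s)"
  by (simp add: norm1_def norm_minus_commute)

lemma norm1_cmult_sum_le:
  assumes "\<And>k. k \<in> I \<Longrightarrow> u k \<in> L1 M"
  shows "norm1 M (\<lambda>s. c * (\<Sum>k\<in>I. u k s)) \<le> norm c * (\<Sum>k\<in>I. norm1 M (u k))"
proof -
  have "norm1 M (\<lambda>s. c * (\<Sum>k\<in>I. u k s)) \<le> (LINT s|M. norm c * (\<Sum>k\<in>I. norm (u k s)))"
    unfolding norm1_def
    by (intro integral_mono)
      (use assms in \<open>auto simp: L1_def norm_mult intro!: mult_left_mono norm_sum\<close>)
  also have "\<dots> = norm c * (\<Sum>k\<in>I. norm1 M (u k))"
    using assms by (simp add: norm1_def L1_def Bochner_Integration.integral_sum)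
  finally show ?thesis .
qed

text \<open>The Riesz-Fischer argument: a subsequence is Cauchy almost everywhere, and Fatou's lemma
  turns the Cauchy bound into a bound for the distance from \<open>u n\<close> to the pointwise
  limit.\<close>

lemma L1_complete:
  assumes u: "\<And>n. u n \<in> L1 M"
    and cauchy: "\<And>e. e > 0 \<Longrightarrow> \<exists>N. \<forall>i\<ge>N. \<forall>j\<ge>N. norm1 M (\<lambda>s. u i s - u j s) < e"
  obtains g where "g \<in> L1 M" "(\<lambda>n. norm1 M (\<lambda>s. u n s - g s)) \<longlonglongrightarrow> 0"
proof -
  have int: "integrable M (u n)" for n using u[of n] by (simp add: L1_def)
  have [measurable]: "u n \<in> borel_measurable M" for n using int by auto
  obtain r where r: "strict_mono r" "AE x in M. Cauchy (\<lambda>i. u (r i) x)"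
    using cauchy_L1_AE_cauchy_subseq[OF int cauchy[unfolded norm1_def]] by blast
  define g where "g x = lim (\<lambda>i. u (r i) x)" for x
  have [measurable]: "g \<in> borel_measurable M"
    unfolding g_def by (rule borel_measurable_lim_metric) simp
  have lim: "AE x in M. (\<lambda>i. u (r i) x) \<longlonglongrightarrow> g x"
    using r(2) by eventually_elim (simp add: g_def Cauchy_convergent_iff convergent_LIMSEQ_iff)
  have bound: "(\<integral>\<^sup>+x. ennreal (norm (u n x - g x)) \<partial>M) \<le> ennreal e"
    if N: "\<forall>i\<ge>N. \<forall>j\<ge>N. norm1 M (\<lambda>s. u i s - u j s) < e" and "n \<ge> N" for N n e
  proof -
    have "(\<integral>\<^sup>+x. ennreal (norm (u n x - g x)) \<partial>M) =
        (\<integral>\<^sup>+x. liminf (\<lambda>i. ennreal (norm (u n x - u (r i) x))) \<partial>M)"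
    proof (rule nn_integral_cong_AE, use lim in eventually_elim)
      fix x assume "(\<lambda>i. u (r i) x) \<longlonglongrightarrow> g x"
      then have "(\<lambda>i. ennreal (norm (u n x - u (r i) x))) \<longlonglongrightarrow> ennreal (norm (u n x - g x))"
        by (intro tendsto_ennrealI tendsto_norm tendsto_diff tendsto_const)
      then show "ennreal (norm (u n x - g x)) = liminf (\<lambda>i. ennreal (norm (u n x - u (r i) x)))"
        by (rule lim_imp_Liminf[OF trivial_limit_sequentially, symmetric])
    qed
    also have "\<dots> \<le> liminf (\<lambda>i. \<integral>\<^sup>+x. ennreal (norm (u n x - u (r i) x)) \<partial>M)"
      by (intro nn_integral_liminf) simp
    also have "\<dots> \<le> liminf (\<lambda>i. ennreal e)"
    proof (rule Liminf_mono, rule eventually_sequentiallyI[of N])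
      fix i assume "i \<ge> N"
      then have "r i \<ge> N" using seq_suble[OF r(1), of i] by simp
      then have "norm1 M (\<lambda>s. u n s - u (r i) s) \<le> e" using N \<open>n \<ge> N\<close> by (simp add: less_imp_le)
      moreover have L: "(\<lambda>s. u n s - u (r i) s) \<in> L1 M" using int by (simp add: L1_def)
      ultimately show "(\<integral>\<^sup>+x. ennreal (norm (u n x - u (r i) x)) \<partial>M) \<le> ennreal e"
        unfolding ennreal_norm1[OF L, symmetric] by (intro ennreal_leI)
    qed
    finally show ?thesis by (simp add: Liminf_const)
  qed
  have intd: "integrable M (\<lambda>x. u n x - g x)" if "\<forall>i\<ge>N. \<forall>j\<ge>N. norm1 M (\<lambda>s. u i s - u j s) < e" "n \<ge> N" for N n e
    using bound[OF that] by (auto simp: integrable_iff_bounded intro: le_less_trans)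
  have g: "g \<in> L1 M"
  proof -
    obtain N where N: "\<forall>i\<ge>N. \<forall>j\<ge>N. norm1 M (\<lambda>s. u i s - u j s) < 1" using cauchy[of 1] by auto
    have "integrable M (\<lambda>x. u N x - (u N x - g x))"
      by (rule Bochner_Integration.integrable_diff[OF int intd[OF N order_refl]])
    then show ?thesis by (simp add: L1_def)
  qed
  have "(\<lambda>n. norm1 M (\<lambda>s. u n s - g s)) \<longlonglongrightarrow> 0"
  proof (rule LIMSEQ_I)
    fix e :: real assume "e > 0"
    then obtain N where N: "\<forall>i\<ge>N. \<forall>j\<ge>N. norm1 M (\<lambda>s. u i s - u j s) < e / 2" using cauchy[of "e/2"] by auto
    have "norm1 M (\<lambda>s. u n s - g s) \<le> e / 2" if "n \<ge> N" for n
    proof -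
      have "ennreal (norm1 M (\<lambda>s. u n s - g s)) \<le> ennreal (e / 2)"
        using bound[OF N that] ennreal_norm1[of "\<lambda>s. u n s - g s" M] int g by (simp add: L1_def)
      then show ?thesis using \<open>e > 0\<close> by simp
    qed
    then show "\<exists>no. \<forall>n\<ge>no. norm (norm1 M (\<lambda>s. u n s - g s) - 0) < e"
      using \<open>e > 0\<close> by (intro exI[of _ N]) force
  qed
  then show ?thesis using that g by blast
qed

section \<open>Mean ergodicity of contractions\<close>

locale L1_contraction =
  fixes M :: "'a measure" and T :: "('a \<Rightarrow> complex) \<Rightarrow> 'a \<Rightarrow> complex"
  assumes bounded: "bounded_operator_on (L1 M) (norm1 M) T"
    and contraction: "\<And>f. f \<in> L1 M \<Longrightarrow> norm1 M (T f) \<le> norm1 M f"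
begin

lemma closed_L1: "f \<in> L1 M \<Longrightarrow> T f \<in> L1 M"
  using bounded by (simp add: bounded_operator_on_def)

lemma add_AE:
  assumes "f \<in> L1 M" "g \<in> L1 M"
  shows "AE s in M. T (\<lambda>t. f t + g t) s = T f s + T g s"
proof -
  have "norm1 M (\<lambda>s. T (\<lambda>t. f t + g t) s - (T f s + T g s)) = 0"
    using bounded assms by (simp add: bounded_operator_on_def)
  moreover have "(\<lambda>t. f t + g t) \<in> L1 M" "(\<lambda>s. T f s + T g s) \<in> L1 M"
    using assms closed_L1[OF assms(1)] closed_L1[OF assms(2)] by (auto simp: L1_def)
  ultimately show ?thesis
    using norm1_diff_eq_0_iff[OF closed_L1] by blast
qed

lemma cmult_AE:
  assumes "f \<in> L1 M"
  shows "AE s in M. T (\<lambda>t. c * f t) s = c * T f s"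
proof -
  have "norm1 M (\<lambda>s. T (\<lambda>t. c * f t) s - c * T f s) = 0"
    using bounded assms by (simp add: bounded_operator_on_def)
  moreover have "(\<lambda>t. c * f t) \<in> L1 M" "(\<lambda>s. c * T f s) \<in> L1 M"
    using assms closed_L1[OF assms(1)] by (auto simp: L1_def)
  ultimately show ?thesis
    using norm1_diff_eq_0_iff[OF closed_L1] by blast
qed

lemma contraction_diff:
  assumes "f \<in> L1 M" "g \<in> L1 M"
  shows "norm1 M (\<lambda>s. T f s - T g s) \<le> norm1 M (\<lambda>s. f s - g s)"
proof -
  have d: "(\<lambda>s. f s - g s) \<in> L1 M" "(\<lambda>s. T f s - T g s) \<in> L1 M"
    using assms closed_L1[OF assms(1)] closed_L1[OF assms(2)] by (auto simp: L1_def)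
  have "AE s in M. T f s - T g s = T (\<lambda>s. f s - g s) s"
    using add_AE[OF d(1) assms(2)] by eventually_elim simp
  then have "norm1 M (\<lambda>s. T f s - T g s) = norm1 M (T (\<lambda>s. f s - g s))"
    using d closed_L1 by (intro norm1_cong_AE) auto
  then show ?thesis using contraction[OF d(1)] by simp
qed

lemma funpow_L1: "f \<in> L1 M \<Longrightarrow> (T ^^ k) f \<in> L1 M"
  by (induction k) (auto intro: closed_L1)

lemma funpow_contraction: "f \<in> L1 M \<Longrightarrow> norm1 M ((T ^^ k) f) \<le> norm1 M f"
  by (induction k) (auto intro: order_trans[OF contraction[OF funpow_L1]])

lemma funpow_contraction_diff:
  assumes "f \<in> L1 M" "g \<in> L1 M"
  shows "norm1 M (\<lambda>s. (T ^^ k) f s - (T ^^ k) g s) \<le> norm1 M (\<lambda>s. f s - g s)"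
  by (induction k) (auto intro: order_trans[OF contraction_diff[OF funpow_L1 funpow_L1]] assms)

text \<open>The operator acts on representatives and is linear only up to null sets, so each
  iteration uses that \<open>T\<close> respects equality almost everywhere
  (\<open>bounded_operator_on_L1_cong\<close>).\<close>

lemma funpow_add_AE:
  assumes "f \<in> L1 M" "g \<in> L1 M"
  shows "AE s in M. (T ^^ k) (\<lambda>t. f t + g t) s = (T ^^ k) f s + (T ^^ k) g s"
proof (induction k)
  case (Suc k)
  have fg: "(\<lambda>t. f t + g t) \<in> L1 M" "(\<lambda>t. (T ^^ k) f t + (T ^^ k) g t) \<in> L1 M"
    using assms funpow_L1[OF assms(1), of k] funpow_L1[OF assms(2), of k] by (auto simp: L1_def)
  show ?case
    using bounded_operator_on_L1_cong[OF bounded funpow_L1[OF fg(1)] fg(2) Suc]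
      add_AE[OF funpow_L1[OF assms(1), of k] funpow_L1[OF assms(2), of k]]
    by eventually_elim simp
qed simp

lemma funpow_cmult_AE:
  assumes "f \<in> L1 M"
  shows "AE s in M. (T ^^ k) (\<lambda>t. c * f t) s = c * (T ^^ k) f s"
proof (induction k)
  case (Suc k)
  have cf: "(\<lambda>t. c * f t) \<in> L1 M" "(\<lambda>t. c * (T ^^ k) f t) \<in> L1 M"
    using assms funpow_L1[OF assms(1), of k] by (auto simp: L1_def)
  show ?case
    using bounded_operator_on_L1_cong[OF bounded funpow_L1[OF cf(1)] cf(2) Suc]
      cmult_AE[OF funpow_L1[OF assms(1), of k]]
    by eventually_elim simp
qed simp

abbreviation A where "A \<equiv> cesaro_mean T"

lemma cesaro_L1: "f \<in> L1 M \<Longrightarrow> A n f \<in> L1 M"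
  using funpow_L1[of f] by (auto simp: L1_def cesaro_mean_def)

text \<open>The factor has the form in which \<open>norm1_cmult_sum_le\<close> delivers it for
  \<open>cesaro_mean\<close>. For \<open>n = 0\<close> it is 0, whence the hypothesis
  \<open>0 \<le> b\<close>.\<close>

lemma mean_le:
  fixes x :: "nat \<Rightarrow> real"
  assumes "\<And>k. k \<in> {1..n} \<Longrightarrow> x k \<le> b" "0 \<le> b"
  shows "norm (1 / of_nat n :: complex) * (\<Sum>k=1..n. x k) \<le> b"
proof (cases "n = 0")
  case False
  have "(\<Sum>k=1..n. x k) \<le> n * b"
    using sum_bounded_above[of "{1..n}" x b] assms by simp
  then show ?thesis using False by (simp add: norm_divide field_simps)
qed (use assms in simp)

lemma cesaro_contraction:
  assumes "f \<in> L1 M"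
  shows "norm1 M (A n f) \<le> norm1 M f"
  unfolding cesaro_mean_def
  by (rule order_trans[OF norm1_cmult_sum_le mean_le])
    (use assms funpow_L1 funpow_contraction in auto)

lemma cesaro_contraction_diff:
  assumes "f \<in> L1 M" "g \<in> L1 M"
  shows "norm1 M (\<lambda>s. A n f s - A n g s) \<le> norm1 M (\<lambda>s. f s - g s)"
proof -
  have eq: "(\<lambda>s. A n f s - A n g s) = (\<lambda>s. (1 / of_nat n) * (\<Sum>k=1..n. (T ^^ k) f s - (T ^^ k) g s))"
    by (simp add: cesaro_mean_def sum_subtractf diff_divide_distrib)
  have "(\<lambda>s. (T ^^ k) f s - (T ^^ k) g s) \<in> L1 M" for k
    using funpow_L1[OF assms(1), of k] funpow_L1[OF assms(2), of k] by (auto simp: L1_def)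
  then show ?thesis
    unfolding eq
    by (intro order_trans[OF norm1_cmult_sum_le mean_le] funpow_contraction_diff assms) auto
qed

lemma cesaro_add_AE:
  assumes "f \<in> L1 M" "g \<in> L1 M"
  shows "AE s in M. A n (\<lambda>t. f t + g t) s = A n f s + A n g s"
proof -
  have "AE s in M. \<forall>k\<in>{1..n}. (T ^^ k) (\<lambda>t. f t + g t) s = (T ^^ k) f s + (T ^^ k) g s"
    by (intro AE_finite_allI funpow_add_AE assms) auto
  then show ?thesis
    by eventually_elim (simp add: cesaro_mean_def sum.distrib add_divide_distrib)
qed

lemma cesaro_cmult_AE:
  assumes "f \<in> L1 M"
  shows "AE s in M. A n (\<lambda>t. c * f t) s = c * A n f s"
proof -
  have "AE s in M. \<forall>k\<in>{1..n}. (T ^^ k) (\<lambda>t. c * f t) s = c * (T ^^ k) f s"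
    by (intro AE_finite_allI funpow_cmult_AE assms) auto
  then show ?thesis
    by eventually_elim (simp add: cesaro_mean_def sum_distrib_left mult.left_commute)
qed

text \<open>The Cauchy form names no limit, so it passes by approximation from a dense set to all of
  L^1 before any limit has been constructed.\<close>

definition cesaro_cauchy where
  "cesaro_cauchy f \<longleftrightarrow> (\<forall>e>0. \<exists>N. \<forall>i\<ge>N. \<forall>j\<ge>N. norm1 M (\<lambda>s. A i f s - A j f s) < e)"

lemma norm1_limit_unique:
  assumes "\<And>n. u n \<in> L1 M" "a \<in> L1 M" "b \<in> L1 M"
    and "(\<lambda>n. norm1 M (\<lambda>s. u n s - a s)) \<longlonglongrightarrow> 0" "(\<lambda>n. norm1 M (\<lambda>s. u n s - b s)) \<longlonglongrightarrow> 0"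
  shows "norm1 M (\<lambda>s. a s - b s) = 0"
proof -
  have "(\<lambda>n. norm1 M (\<lambda>s. u n s - a s) + norm1 M (\<lambda>s. u n s - b s)) \<longlonglongrightarrow> 0 + 0"
    by (intro tendsto_add assms)
  moreover have "norm1 M (\<lambda>s. a s - b s) \<le> norm1 M (\<lambda>s. u n s - a s) + norm1 M (\<lambda>s. u n s - b s)" for n
    using norm1_triangle_diff[OF assms(2,1,3)] by (simp add: norm1_minus_commute[of _ a])
  ultimately have "norm1 M (\<lambda>s. a s - b s) \<le> 0 + 0"
    by (intro LIMSEQ_le_const) auto
  then show ?thesis by (simp add: order_antisym)
qed

text \<open>All averages are contractions, so the Cauchy property spreads from a dense set by a
  three-term estimate; completeness then supplies the limits.\<close>

lemma mean_ergodicI: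
  assumes dense: "\<And>f e. f \<in> L1 M \<Longrightarrow> e > 0 \<Longrightarrow> \<exists>g\<in>L1 M. norm1 M (\<lambda>s. f s - g s) < e \<and> cesaro_cauchy g"
  shows "mean_ergodic_on (L1 M) (norm1 M) T"
proof -
  have cauchy: "cesaro_cauchy f" if f: "f \<in> L1 M" for f
    unfolding cesaro_cauchy_def
  proof (intro allI impI)
    fix e :: real assume e: "e > 0"
    obtain g where g: "g \<in> L1 M" "norm1 M (\<lambda>s. f s - g s) < e / 3" "cesaro_cauchy g"
      using dense[OF f, of "e / 3"] e by auto
    obtain N where N: "\<forall>i\<ge>N. \<forall>j\<ge>N. norm1 M (\<lambda>s. A i g s - A j g s) < e / 3"
      using g(3) e unfolding cesaro_cauchy_def by (meson divide_pos_pos zero_less_numeral)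
    have "norm1 M (\<lambda>s. A i f s - A j f s) < e" if "i \<ge> N" "j \<ge> N" for i j
    proof -
      have "norm1 M (\<lambda>s. A i f s - A j f s) \<le> norm1 M (\<lambda>s. A i f s - A i g s) + norm1 M (\<lambda>s. A i g s - A j f s)"
        "norm1 M (\<lambda>s. A i g s - A j f s) \<le> norm1 M (\<lambda>s. A i g s - A j g s) + norm1 M (\<lambda>s. A j g s - A j f s)"
        using f g(1) by (intro norm1_triangle_diff cesaro_L1; simp)+
      moreover have "norm1 M (\<lambda>s. A i g s - A j g s) < e / 3" using N that by auto
      moreover have "norm1 M (\<lambda>s. A i f s - A i g s) < e / 3" "norm1 M (\<lambda>s. A j g s - A j f s) < e / 3"
        using cesaro_contraction_diff[OF f g(1), of i] cesaro_contraction_diff[OF g(1) f, of j] g(2)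
        by (simp_all add: norm1_minus_commute[of _ g])
      ultimately show ?thesis by linarith
    qed
    then show "\<exists>N. \<forall>i\<ge>N. \<forall>j\<ge>N. norm1 M (\<lambda>s. A i f s - A j f s) < e" by blast
  qed
  have "\<exists>g. g \<in> L1 M \<and> (\<lambda>n. norm1 M (\<lambda>s. A n f s - g s)) \<longlonglongrightarrow> 0" if "f \<in> L1 M" for f
  proof -
    have "cesaro_cauchy f" using \<open>f \<in> L1 M\<close> by (rule cauchy)
    then obtain g where "g \<in> L1 M" "(\<lambda>n. norm1 M (\<lambda>s. A n f s - g s)) \<longlonglongrightarrow> 0"
      by (rule_tac L1_complete[of "\<lambda>n. A n f" M, OF cesaro_L1[OF \<open>f \<in> L1 M\<close>]])
        (auto simp: cesaro_cauchy_def)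
    then show ?thesis by blast
  qed
  \<comment> \<open>\<open>P\<close> selects representatives of the limits by choice, so it is
    linear only modulo null functions; this much follows from
    \<open>norm1_limit_unique\<close>.\<close>
  then obtain P where P: "\<And>f. f \<in> L1 M \<Longrightarrow> P f \<in> L1 M"
    "\<And>f. f \<in> L1 M \<Longrightarrow> (\<lambda>n. norm1 M (\<lambda>s. A n f s - P f s)) \<longlonglongrightarrow> 0"
    by metis
  have "norm1 M (\<lambda>s. P (\<lambda>t. f t + g t) s - (P f s + P g s)) = 0" if fg: "f \<in> L1 M" "g \<in> L1 M" for f g
  proof (rule norm1_limit_unique[where u = "\<lambda>n. A n (\<lambda>t. f t + g t)"])
    have sum: "(\<lambda>t. f t + g t) \<in> L1 M" using fg by (simp add: L1_def)
    then show "A n (\<lambda>t. f t + g t) \<in> L1 M" for n by (rule cesaro_L1)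
    show "P (\<lambda>t. f t + g t) \<in> L1 M" using P(1)[OF sum] .
    show PP: "(\<lambda>s. P f s + P g s) \<in> L1 M" using P(1)[OF fg(1)] P(1)[OF fg(2)] by (simp add: L1_def)
    show "(\<lambda>n. norm1 M (\<lambda>s. A n (\<lambda>t. f t + g t) s - P (\<lambda>t. f t + g t) s)) \<longlonglongrightarrow> 0" using P(2)[OF sum] .
    show "(\<lambda>n. norm1 M (\<lambda>s. A n (\<lambda>t. f t + g t) s - (P f s + P g s))) \<longlonglongrightarrow> 0"
    proof (rule tendsto_sandwich[OF _ _ tendsto_const])
      show "(\<lambda>n. norm1 M (\<lambda>s. A n f s - P f s) + norm1 M (\<lambda>s. A n g s - P g s)) \<longlonglongrightarrow> 0"
        using tendsto_add[OF P(2)[OF fg(1)] P(2)[OF fg(2)]] by simp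
      have "norm1 M (\<lambda>s. A n (\<lambda>t. f t + g t) s - (P f s + P g s)) \<le>
          norm1 M (\<lambda>s. A n f s - P f s) + norm1 M (\<lambda>s. A n g s - P g s)" for n
      proof -
        have d: "(\<lambda>s. A n f s - P f s) \<in> L1 M" "(\<lambda>s. A n g s - P g s) \<in> L1 M"
          using cesaro_L1[OF fg(1), of n] cesaro_L1[OF fg(2), of n] P(1)[OF fg(1)] P(1)[OF fg(2)]
          by (auto simp: L1_def)
        have "norm1 M (\<lambda>s. A n (\<lambda>t. f t + g t) s - (P f s + P g s)) =
            norm1 M (\<lambda>s. (A n f s - P f s) + (A n g s - P g s))"
        proof (rule norm1_cong_AE)
          show "AE s in M. A n (\<lambda>t. f t + g t) s - (P f s + P g s) = (A n f s - P f s) + (A n g s - P g s)"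
            using cesaro_add_AE[OF fg] by eventually_elim simp
        qed (use d PP cesaro_L1[OF sum, of n] in \<open>auto simp: L1_def\<close>)
        also have "\<dots> \<le> norm1 M (\<lambda>s. A n f s - P f s) + norm1 M (\<lambda>s. A n g s - P g s)"
          by (rule norm1_triangle[OF d])
        finally show ?thesis .
      qed
      then show "\<forall>\<^sub>F n in sequentially. norm1 M (\<lambda>s. A n (\<lambda>t. f t + g t) s - (P f s + P g s)) \<le>
          norm1 M (\<lambda>s. A n f s - P f s) + norm1 M (\<lambda>s. A n g s - P g s)" by simp
    qed simp
  qed
  moreover have "norm1 M (\<lambda>s. P (\<lambda>t. c * f t) s - c * P f s) = 0" if f: "f \<in> L1 M" for c f
  proof (rule norm1_limit_unique[where u = "\<lambda>n. A n (\<lambda>t. c * f t)"])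
    have cf: "(\<lambda>t. c * f t) \<in> L1 M" using f by (simp add: L1_def)
    then show "A n (\<lambda>t. c * f t) \<in> L1 M" for n by (rule cesaro_L1)
    show "P (\<lambda>t. c * f t) \<in> L1 M" using P(1)[OF cf] .
    show PP: "(\<lambda>s. c * P f s) \<in> L1 M" using P(1)[OF f] by (simp add: L1_def)
    show "(\<lambda>n. norm1 M (\<lambda>s. A n (\<lambda>t. c * f t) s - P (\<lambda>t. c * f t) s)) \<longlonglongrightarrow> 0" using P(2)[OF cf] .
    have "norm1 M (\<lambda>s. A n (\<lambda>t. c * f t) s - c * P f s) = norm c * norm1 M (\<lambda>s. A n f s - P f s)" for n
    proof -
      have d: "(\<lambda>s. A n f s - P f s) \<in> L1 M"
        using cesaro_L1[OF f, of n] P(1)[OF f] by (auto simp: L1_def)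
      have "norm1 M (\<lambda>s. A n (\<lambda>t. c * f t) s - c * P f s) = norm1 M (\<lambda>s. c * (A n f s - P f s))"
      proof (rule norm1_cong_AE)
        show "AE s in M. A n (\<lambda>t. c * f t) s - c * P f s = c * (A n f s - P f s)"
          using cesaro_cmult_AE[OF f] by eventually_elim (simp add: right_diff_distrib)
      qed (use d PP cesaro_L1[OF cf, of n] in \<open>auto simp: L1_def\<close>)
      also have "\<dots> = norm c * norm1 M (\<lambda>s. A n f s - P f s)"
        by (simp add: norm1_def norm_mult)
      finally show ?thesis .
    qed
    then show "(\<lambda>n. norm1 M (\<lambda>s. A n (\<lambda>t. c * f t) s - c * P f s)) \<longlonglongrightarrow> 0"
      using tendsto_mult[OF tendsto_const P(2)[OF f], of "norm c"] by simp
  qed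
  moreover have "norm1 M (P f) \<le> 1 * norm1 M f" if f: "f \<in> L1 M" for f
  proof -
    have "norm1 M (P f) \<le> norm1 M (\<lambda>s. A n f s - P f s) + norm1 M f" for n
    proof -
      have "(\<lambda>s. 0) \<in> L1 M" by (simp add: L1_def)
      then show ?thesis
        using norm1_triangle_diff[OF P(1)[OF f] cesaro_L1[OF f, of n], of "\<lambda>s. 0"] cesaro_contraction[OF f, of n]
        by (simp add: norm1_minus_commute[of _ "P f"])
    qed
    moreover have "(\<lambda>n. norm1 M (\<lambda>s. A n f s - P f s) + norm1 M f) \<longlonglongrightarrow> 0 + norm1 M f"
      by (intro tendsto_add P(2)[OF f] tendsto_const)
    ultimately show ?thesis using LIMSEQ_le_const by fastforce
  qed
  ultimately have "bounded_operator_on (L1 M) (norm1 M) P"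
    unfolding bounded_operator_on_def using P(1) by blast
  then show ?thesis
    unfolding mean_ergodic_on_def using bounded P(2) by blast
qed

end

section \<open>Convolution as a contraction of L^1\<close>

context haar_probability
begin

lemma translate_integrable_iff:
  fixes f :: "'g \<Rightarrow> 'b::{banach, second_countable_topology}"
  assumes "f \<in> borel_measurable borel"
  shows "integrable \<mu> (\<lambda>x. f (- x + s)) \<longleftrightarrow> conv (\<lambda>y. ennreal (norm (f y))) s < \<infinity>"
  using measurable_translate_compose[OF assms, of s] by (simp add: integrable_iff_bounded conv_def)

lemma conv_norm_measurable [measurable]:
  fixes f :: "'g \<Rightarrow> 'b::real_normed_vector"
  assumes [measurable]: "f \<in> borel_measurable borel"
  shows "conv (\<lambda>y. ennreal (norm (f y))) \<in> borel_measurable borel"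
  by (intro conv_measurable) simp

text \<open>The library integral is 0 wherever the translate is not integrable. With this default
  spelled out, the integral is a Borel combination of \<open>conv\<close> of the positive part, of
  the negative part and of the norm.\<close>

lemma translate_integral_measurable:
  fixes r :: "'g \<Rightarrow> real"
  assumes r [measurable]: "r \<in> borel_measurable borel"
  shows "(\<lambda>s. LINT x|\<mu>. r (- x + s)) \<in> borel_measurable borel"
proof -
  have [measurable]: "conv (\<lambda>y. ennreal (r y)) \<in> borel_measurable borel"
    "conv (\<lambda>y. ennreal (- r y)) \<in> borel_measurable borel"
    by (intro conv_measurable; simp)+
  have "(LINT x|\<mu>. r (- x + s)) = (if conv (\<lambda>y. ennreal (norm (r y))) s < \<infinity>
      then enn2real (conv (\<lambda>y. ennreal (r y)) s) - enn2real (conv (\<lambda>y. ennreal (- r y)) s) else 0)" for s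
    using translate_integrable_iff[OF r, of s] real_lebesgue_integral_def[of \<mu> "\<lambda>x. r (- x + s)"]
    by (auto simp: not_integrable_integral_eq conv_def)
  then show ?thesis by simp
qed

lemma lambda1_measurable [measurable]:
  assumes f [measurable]: "f \<in> borel_measurable borel"
  shows "lambda1 \<mu> f \<in> borel_measurable borel"
proof -
  have [measurable]: "(\<lambda>s. LINT x|\<mu>. Re (f (- x + s))) \<in> borel_measurable borel"
    "(\<lambda>s. LINT x|\<mu>. Im (f (- x + s))) \<in> borel_measurable borel"
    using translate_integral_measurable[of "\<lambda>y. Re (f y)"] translate_integral_measurable[of "\<lambda>y. Im (f y)"]
    by simp_all
  \<comment> \<open>Where the translate of \<open>f\<close> is not integrable, its real part may
    still be, yet \<open>lambda1 \<mu> f s\<close> is 0; hence the case distinction.\<close>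
  have "lambda1 \<mu> f s = (if conv (\<lambda>y. ennreal (norm (f y))) s < \<infinity>
      then complex_of_real (LINT x|\<mu>. Re (f (- x + s))) + \<i> * complex_of_real (LINT x|\<mu>. Im (f (- x + s))) else 0)" for s
    using translate_integrable_iff[OF f, of s]
    by (auto simp: not_integrable_integral_eq lambda1_def complex_eq_iff)
  then have "lambda1 \<mu> f = (\<lambda>s. if conv (\<lambda>y. ennreal (norm (f y))) s < \<infinity>
      then complex_of_real (LINT x|\<mu>. Re (f (- x + s))) + \<i> * complex_of_real (LINT x|\<mu>. Im (f (- x + s))) else 0)"
    by auto
  then show ?thesis by simp
qed

lemma norm_lambda1_le:
  assumes "f \<in> borel_measurable borel"
  shows "ennreal (norm (lambda1 \<mu> f s)) \<le> conv (\<lambda>y. ennreal (norm (f y))) s"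
proof (cases "integrable \<mu> (\<lambda>x. f (- x + s))")
  case True
  then show ?thesis
    unfolding lambda1_def conv_def by (rule integral_norm_bound_ennreal)
qed (simp add: lambda1_def not_integrable_integral_eq)

lemma L1_measurable: "f \<in> L1 m \<Longrightarrow> f \<in> borel_measurable borel"
  using borel_measurable_integrable[of m f] by (simp add: L1_def cong: measurable_cong_sets)

lemma nn_integral_lambda1_le:
  assumes [measurable]: "f \<in> borel_measurable borel"
  shows "(\<integral>\<^sup>+s. ennreal (norm (lambda1 \<mu> f s)) \<partial>m) \<le> (\<integral>\<^sup>+s. ennreal (norm (f s)) \<partial>m)"
  by (rule order_trans[OF nn_integral_mono[OF norm_lambda1_le] nn_integral_conv_le]) simp_all

lemma lambda1_L1:
  assumes "f \<in> L1 m"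
  shows "lambda1 \<mu> f \<in> L1 m"
proof -
  note [measurable] = L1_measurable[OF assms]
  have "(\<integral>\<^sup>+s. ennreal (norm (f s)) \<partial>m) < \<infinity>"
    using assms by (simp add: L1_def integrable_iff_bounded)
  then show ?thesis
    using nn_integral_lambda1_le[of f] lambda1_measurable[of f]
    by (auto simp: L1_def integrable_iff_bounded intro: le_less_trans)
qed

lemma norm1_lambda1_le:
  assumes "f \<in> L1 m"
  shows "norm1 m (lambda1 \<mu> f) \<le> norm1 m f"
proof -
  have "ennreal (norm1 m (lambda1 \<mu> f)) \<le> ennreal (norm1 m f)"
    using nn_integral_lambda1_le[OF L1_measurable[OF assms]] assms lambda1_L1[OF assms]
    by (simp add: ennreal_norm1)
  then show ?thesis by simp
qed

lemma translate_integrable_AE: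
  assumes "f \<in> L1 m"
  shows "AE s in m. integrable \<mu> (\<lambda>x. f (- x + s))"
proof -
  note f [measurable] = L1_measurable[OF assms]
  have "(\<integral>\<^sup>+s. conv (\<lambda>y. ennreal (norm (f y))) s \<partial>m) \<noteq> \<infinity>"
    using nn_integral_conv_le[of "\<lambda>y. ennreal (norm (f y))"] assms
    by (auto simp: L1_def integrable_iff_bounded top_unique)
  then have "AE s in m. conv (\<lambda>y. ennreal (norm (f y))) s \<noteq> \<infinity>"
    by (intro nn_integral_noteq_infinite) simp_all
  then show ?thesis
    by eventually_elim (simp add: translate_integrable_iff[OF f] less_top)
qed

sublocale L1_contraction m "lambda1 \<mu>"
proof
  have "norm1 m (\<lambda>s. lambda1 \<mu> (\<lambda>t. f t + g t) s - (lambda1 \<mu> f s + lambda1 \<mu> g s)) = 0"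
    if fg: "f \<in> L1 m" "g \<in> L1 m" for f g
  proof (subst norm1_diff_eq_0_iff)
    show "AE s in m. lambda1 \<mu> (\<lambda>t. f t + g t) s = lambda1 \<mu> f s + lambda1 \<mu> g s"
      using translate_integrable_AE[OF fg(1)] translate_integrable_AE[OF fg(2)]
      by eventually_elim (simp add: lambda1_def)
    show "(\<lambda>s. lambda1 \<mu> f s + lambda1 \<mu> g s) \<in> L1 m"
      using lambda1_L1[OF fg(1)] lambda1_L1[OF fg(2)] by (simp add: L1_def)
    have "(\<lambda>t. f t + g t) \<in> L1 m" using fg by (simp add: L1_def)
    then show "lambda1 \<mu> (\<lambda>t. f t + g t) \<in> L1 m" by (rule lambda1_L1)
  qed
  \<comment> \<open>Unlike additivity, homogeneity holds at every point: for
    \<open>c \<noteq> 0\<close> either both integrals exist or both take the default value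
    0.\<close>
  moreover have "lambda1 \<mu> (\<lambda>t. c * f t) s - c * lambda1 \<mu> f s = 0" for c f s
    by (simp add: lambda1_def)
  then have "norm1 m (\<lambda>s. lambda1 \<mu> (\<lambda>t. c * f t) s - c * lambda1 \<mu> f s) = 0" for c f
    by (simp add: norm1_def)
  ultimately show "bounded_operator_on (L1 m) (norm1 m) (lambda1 \<mu>)"
    unfolding bounded_operator_on_def
    by (intro conjI ballI allI exI[of _ 1]) (simp_all add: lambda1_L1 norm1_lambda1_le)
qed (rule norm1_lambda1_le)

end

section \<open>Compact generated subgroups\<close>

text \<open>For a linear \<open>T\<close> this is the convex hull of the orbit of \<open>f\<close>.
  Given by rules, it supports the induction of \<open>cesaro_orbit_hull_close\<close>.\<close>

inductive_set orbit_hull ::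
  "(('a \<Rightarrow> complex) \<Rightarrow> 'a \<Rightarrow> complex) \<Rightarrow> ('a \<Rightarrow> complex) \<Rightarrow> ('a \<Rightarrow> complex) set"
  for T f where
  base: "f \<in> orbit_hull T f"
| step: "g \<in> orbit_hull T f \<Longrightarrow> T g \<in> orbit_hull T f"
| convex: "g \<in> orbit_hull T f \<Longrightarrow> h \<in> orbit_hull T f \<Longrightarrow> 0 \<le> t \<Longrightarrow> t \<le> 1 \<Longrightarrow>
    (\<lambda>s. of_real t * g s + of_real (1 - t) * h s) \<in> orbit_hull T f"

lemma orbit_hull_funpow: "g \<in> orbit_hull T f \<Longrightarrow> (T ^^ k) g \<in> orbit_hull T f"
  by (induction k) (auto intro: orbit_hull.step)

text \<open>Only convex combinations of two members are built into \<open>orbit_hull\<close> and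
  \<open>energy_convex\<close>; this recursion brings the averages into that form.\<close>

lemma cesaro_mean_Suc:
  assumes "n > 0"
  shows "cesaro_mean T (Suc n) f = (\<lambda>s. of_real (n / Suc n) * cesaro_mean T n f s +
    of_real (1 - n / Suc n) * (T ^^ Suc n) f s)"
proof
  fix s
  have "of_nat (Suc n) \<noteq> (0::complex)" "of_nat n \<noteq> (0::complex)"
    using assms by (simp_all del: of_nat_Suc)
  moreover have "1 - real n / real (Suc n) = 1 / real (Suc n)"
    by (simp add: field_simps)
  ultimately show "cesaro_mean T (Suc n) f s = of_real (n / Suc n) * cesaro_mean T n f s +
    of_real (1 - n / Suc n) * (T ^^ Suc n) f s"
    by (simp add: cesaro_mean_def field_simps del: of_nat_Suc funpow.simps)
      (simp add: algebra_simps del: funpow.simps)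
qed

lemma cesaro_mean_orbit_hull:
  assumes "g \<in> orbit_hull T f" "n > 0"
  shows "cesaro_mean T n g \<in> orbit_hull T f"
  using assms(2)
proof (induction n rule: nat_induct_non_zero)
  case 1
  have "cesaro_mean T 1 g = T g" by (simp add: cesaro_mean_def)
  then show ?case using assms by (simp add: orbit_hull.step)
next
  case (Suc n)
  show ?case
    unfolding cesaro_mean_Suc[OF Suc(1)]
    by (intro orbit_hull.convex orbit_hull_funpow Suc assms) (auto simp: field_simps)
qed

lemma square_convex:
  fixes x y t :: real
  assumes "0 \<le> t" "t \<le> 1"
  shows "(t * x + (1 - t) * y)\<^sup>2 \<le> t * x\<^sup>2 + (1 - t) * y\<^sup>2"
proof -
  have "t * x\<^sup>2 + (1 - t) * y\<^sup>2 - (t * x + (1 - t) * y)\<^sup>2 = t * (1 - t) * (x - y)\<^sup>2"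
    by (simp add: power2_eq_square algebra_simps)
  moreover have "0 \<le> t * (1 - t) * (x - y)\<^sup>2"
    using assms by simp
  ultimately show ?thesis by linarith
qed

lemma norm_square_convex:
  fixes a b :: complex
  assumes "0 \<le> t" "t \<le> 1"
  shows "(norm (of_real t * a + of_real (1 - t) * b))\<^sup>2 \<le> t * (norm a)\<^sup>2 + (1 - t) * (norm b)\<^sup>2"
proof -
  have "norm (of_real t * a + of_real (1 - t) * b) \<le> t * norm a + (1 - t) * norm b"
    using norm_triangle_ineq[of "of_real t * a" "of_real (1 - t) * b"] assms
    by (simp add: norm_mult del: of_real_diff)
  then have "(norm (of_real t * a + of_real (1 - t) * b))\<^sup>2 \<le> (t * norm a + (1 - t) * norm b)\<^sup>2"
    by (intro power_mono) auto
  also have "\<dots> \<le> t * (norm a)\<^sup>2 + (1 - t) * (norm b)\<^sup>2"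
    by (rule square_convex[OF assms])
  finally show ?thesis .
qed

text \<open>The midpoint keeps the shape of the rule \<open>orbit_hull.convex\<close> at
  \<open>t = 1/2\<close>, so that it is literally a member of the hull.\<close>

lemma norm_parallelogram:
  fixes a b :: complex
  shows "(norm (a - b))\<^sup>2 = 2 * (norm a)\<^sup>2 + 2 * (norm b)\<^sup>2 - 4 * (norm (of_real (1/2) * a + of_real (1 - 1/2) * b))\<^sup>2"
  by (simp only: cmod_power2) (simp add: power2_eq_square field_simps)

lemma closed_subgroup_generated:
  fixes S :: "'g::topological_group_add set"
  shows "closed (closed_subgroup_generated S)" "is_subgroup (closed_subgroup_generated S)"
    "S \<subseteq> closed_subgroup_generated S"
  unfolding closed_subgroup_generated_def is_subgroup_def by (auto intro: closed_Inter)

section \<open>The support, and functions on invariant compact sets\<close>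

context haar_probability
begin

text \<open>The complement is a union of possibly uncountably many open null sets. A compact subset
  is covered by finitely many of them and hence null, and inner regularity concludes.\<close>

lemma emeasure_compl_msupport: "emeasure \<mu> (- msupport \<mu>) = 0" and open_compl_msupport: "open (- msupport \<mu>)"
proof -
  have "\<exists>U. open U \<and> x \<in> U \<and> U \<subseteq> - msupport \<mu> \<and> emeasure \<mu> U = 0" if "x \<notin> msupport \<mu>" for x
  proof -
    obtain U where U: "open U" "x \<in> U" "emeasure \<mu> U = 0"
      using \<open>x \<notin> msupport \<mu>\<close> by (auto simp: msupport_def zero_less_iff_neq_zero)
    then have "U \<subseteq> - msupport \<mu>"
      by (auto simp: msupport_def zero_less_iff_neq_zero)
    then show ?thesis using U by blast
  qed
  then obtain N where N: "\<And>x. x \<notin> msupport \<mu> \<Longrightarrow> open (N x) \<and> x \<in> N x \<and> N x \<subseteq> - msupport \<mu> \<and> emeasure \<mu> (N x) = 0"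
    by metis
  show op: "open (- msupport \<mu>)"
    by (subst open_subopen) (use N in blast)
  show "emeasure \<mu> (- msupport \<mu>) = 0"
  proof (rule ccontr)
    assume "emeasure \<mu> (- msupport \<mu>) \<noteq> 0"
    then obtain K where K: "compact K" "K \<subseteq> - msupport \<mu>" "0 < emeasure \<mu> K"
      using prob_inner[of "- msupport \<mu>" 0] op by (auto simp: zero_less_iff_neq_zero)
    have op: "\<And>x. x \<in> K \<Longrightarrow> open (N x)" and cover: "K \<subseteq> (\<Union>x\<in>K. N x)"
      using N K(2) by blast+
    obtain F where F: "F \<subseteq> K" "finite F" "K \<subseteq> (\<Union>x\<in>F. N x)"
      by (rule compactE_image[OF K(1) op cover])
    have N0: "N x \<in> sets \<mu>" "emeasure \<mu> (N x) = 0" if "x \<in> F" for x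
      using N[of x] F(1) K(2) that by auto
    have "emeasure \<mu> K \<le> emeasure \<mu> (\<Union>x\<in>F. N x)"
      using F N0 by (intro emeasure_mono) auto
    also have "\<dots> \<le> (\<Sum>x\<in>F. emeasure \<mu> (N x))"
      using F N0 by (intro emeasure_subadditive_finite) auto
    also have "\<dots> = 0" using N0 by simp
    finally show False using K(3) by simp
  qed
qed

lemma AE_msupport: "AE x in \<mu>. x \<in> msupport \<mu>"
  by (rule AE_I[of _ _ "- msupport \<mu>"])
    (use emeasure_compl_msupport open_compl_msupport in auto)

lemma msupport_subset_H: "msupport \<mu> \<subseteq> H_of \<mu>"
  and is_subgroup_H: "is_subgroup (H_of \<mu>)"
  unfolding H_of_def by (fact closed_subgroup_generated)+

definition invariant :: "'g set \<Rightarrow> bool" where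
  "invariant K \<longleftrightarrow> compact K \<and> (\<forall>h\<in>H_of \<mu>. \<forall>k\<in>K. h + k \<in> K)"

text \<open>Both conditions are imposed at every point, not almost everywhere. Then every translate
  is \<open>\<mu>\<close>-integrable, and on invariant sets the operator and its averages are linear
  as maps of functions, without exceptional null sets.\<close>

definition bounded_on :: "'g set \<Rightarrow> ('g \<Rightarrow> complex) set" where
  "bounded_on K = {f. f \<in> borel_measurable borel \<and> (\<exists>B. \<forall>s. norm (f s) \<le> B) \<and> (\<forall>s. s \<notin> K \<longrightarrow> f s = 0)}"

lemma bounded_onD:
  assumes "f \<in> bounded_on K"
  shows "f \<in> borel_measurable borel" "\<exists>B. \<forall>s. norm (f s) \<le> B" "\<And>s. s \<notin> K \<Longrightarrow> f s = 0"
  using assms by (auto simp: bounded_on_def)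

lemma bounded_on_linear:
  assumes "f \<in> bounded_on K" "g \<in> bounded_on K"
  shows "(\<lambda>s. a * f s + b * g s) \<in> bounded_on K"
proof -
  obtain B C where "\<And>s. norm (f s) \<le> B" "\<And>s. norm (g s) \<le> C"
    using assms by (auto simp: bounded_on_def)
  then have "norm (a * f s + b * g s) \<le> norm a * B + norm b * C" for s
    by (intro norm_triangle_le add_mono) (auto simp: norm_mult intro: mult_left_mono)
  then show ?thesis
    using assms by (auto simp: bounded_on_def)
qed

lemma bounded_on_diff:
  assumes "f \<in> bounded_on K" "g \<in> bounded_on K"
  shows "(\<lambda>s. f s - g s) \<in> bounded_on K"
  using bounded_on_linear[OF assms, of 1 "-1"] by simp

lemma bounded_on_translate_integrable:
  assumes "f \<in> bounded_on K"
  shows "integrable \<mu> (\<lambda>x. f (- x + s))"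
proof -
  obtain B where "\<And>s. norm (f s) \<le> B" using bounded_onD[OF assms] by auto
  then show ?thesis
    by (intro integrable_const_bound[of _ B] measurable_translate_compose bounded_onD(1)[OF assms]) auto
qed

lemma norm_lambda1_bound:
  assumes f: "f \<in> borel_measurable borel" and B: "\<And>s. norm (f s) \<le> B"
  shows "norm (lambda1 \<mu> f s) \<le> B"
proof -
  have "0 \<le> B" using norm_ge_zero B order_trans by blast
  have "ennreal (norm (lambda1 \<mu> f s)) \<le> conv (\<lambda>y. ennreal (norm (f y))) s"
    by (rule norm_lambda1_le[OF f])
  also have "\<dots> \<le> conv (\<lambda>y. ennreal B) s"
    by (intro conv_mono ennreal_leI B)
  also have "\<dots> = ennreal B" by (simp add: conv_def)
  finally show ?thesis using \<open>0 \<le> B\<close> by simp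
qed

lemma lambda1_bounded_on:
  assumes K: "invariant K" and f: "f \<in> bounded_on K"
  shows "lambda1 \<mu> f \<in> bounded_on K"
  unfolding bounded_on_def
proof (intro CollectI conjI allI impI)
  show "lambda1 \<mu> f \<in> borel_measurable borel"
    using bounded_onD[OF f] by (intro lambda1_measurable) auto
  show "\<exists>B. \<forall>s. norm (lambda1 \<mu> f s) \<le> B"
    using bounded_onD[OF f] norm_lambda1_bound by blast
  fix s assume "s \<notin> K"
  \<comment> \<open>If \<open>- x + s\<close> lay in \<open>K\<close>, so would
    \<open>s = x + (- x + s)\<close>, because the support is contained in
    \<open>H_of \<mu>\<close>.\<close>
  have "f (- x + s) = 0" if "x \<in> msupport \<mu>" for x
  proof (rule bounded_onD(3)[OF f], rule notI)
    assume "- x + s \<in> K"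
    moreover have "x \<in> H_of \<mu>" using that msupport_subset_H by auto
    ultimately have "x + (- x + s) \<in> K"
      using K unfolding invariant_def by blast
    then show False using \<open>s \<notin> K\<close> by simp
  qed
  then have "AE x in \<mu>. f (- x + s) = 0"
    using AE_msupport by auto
  then show "lambda1 \<mu> f s = 0"
    unfolding lambda1_def by (rule integral_eq_zero_AE)
qed

lemma lambda1_linear:
  assumes "f \<in> bounded_on K" "g \<in> bounded_on K"
  shows "lambda1 \<mu> (\<lambda>s. a * f s + b * g s) = (\<lambda>s. a * lambda1 \<mu> f s + b * lambda1 \<mu> g s)"
  using assms[THEN bounded_on_translate_integrable] by (simp add: lambda1_def fun_eq_iff)

lemma funpow_bounded_on:
  "invariant K \<Longrightarrow> f \<in> bounded_on K \<Longrightarrow> (lambda1 \<mu> ^^ k) f \<in> bounded_on K"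
  by (induction k) (auto intro: lambda1_bounded_on)

lemma funpow_linear:
  assumes "invariant K" "f \<in> bounded_on K" "g \<in> bounded_on K"
  shows "(lambda1 \<mu> ^^ k) (\<lambda>s. a * f s + b * g s) = (\<lambda>s. a * (lambda1 \<mu> ^^ k) f s + b * (lambda1 \<mu> ^^ k) g s)"
  by (induction k) (simp_all add: lambda1_linear[OF funpow_bounded_on funpow_bounded_on, OF assms(1,2,1,3)])

lemma cesaro_linear:
  assumes "invariant K" "f \<in> bounded_on K" "g \<in> bounded_on K"
  shows "A n (\<lambda>s. a * f s + b * g s) = (\<lambda>s. a * A n f s + b * A n g s)"
  by (simp add: cesaro_mean_def funpow_linear[OF assms] sum.distrib sum_distrib_left algebra_simps add_divide_distrib)

lemma funpow_bound:
  assumes "f \<in> borel_measurable borel" "\<And>s. norm (f s) \<le> B"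
  shows "(lambda1 \<mu> ^^ k) f \<in> borel_measurable borel \<and> (\<forall>s. norm ((lambda1 \<mu> ^^ k) f s) \<le> B)"
  using assms by (induction k) (auto intro: norm_lambda1_bound lambda1_measurable)

lemma orbit_hull_bounded_on:
  assumes "g \<in> orbit_hull (lambda1 \<mu>) f" "invariant K" "f \<in> bounded_on K"
  shows "g \<in> bounded_on K"
  using assms by (induction rule: orbit_hull.induct) (auto intro: lambda1_bounded_on bounded_on_linear simp del: of_real_diff)

lemma cesaro_step_difference:
  "A n (lambda1 \<mu> g) s - A n g s = ((lambda1 \<mu> ^^ Suc n) g s - lambda1 \<mu> g s) / of_nat n"
proof -
  have "(\<Sum>k=1..n. (lambda1 \<mu> ^^ k) (lambda1 \<mu> g) s) - (\<Sum>k=1..n. (lambda1 \<mu> ^^ k) g s) =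
      (\<Sum>k=1..n. (lambda1 \<mu> ^^ Suc k) g s - (lambda1 \<mu> ^^ k) g s)"
    by (simp add: sum_subtractf funpow_swap1)
  also have "\<dots> = (lambda1 \<mu> ^^ Suc n) g s - (lambda1 \<mu> ^^ 1) g s"
    by (cases "n = 0") (simp, subst sum_Suc_diff, auto)
  finally show ?thesis
    by (simp add: cesaro_mean_def diff_divide_distrib[symmetric])
qed

text \<open>Averaging washes out one application of the operator: telescoping leaves two bounded
  terms divided by \<open>n\<close>. So all members of the hull have asymptotically the same
  averages as \<open>f\<close>, and an almost minimizer can stand in for \<open>f\<close>.\<close>

lemma cesaro_orbit_hull_close:
  assumes g: "g \<in> orbit_hull (lambda1 \<mu>) f" and K: "invariant K" "f \<in> bounded_on K"
  shows "\<exists>C\<ge>0. \<forall>n s. norm (A n g s - A n f s) \<le> C / n"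
  using g
proof induction
  case base
  then show ?case by (intro exI[of _ 0]) simp
next
  case (step g)
  then obtain C where C: "C \<ge> 0" "\<And>n s. norm (A n g s - A n f s) \<le> C / n" by auto
  note gK = orbit_hull_bounded_on[OF step(1) K]
  obtain B where B: "\<And>s. norm (g s) \<le> B" using bounded_onD[OF gK] by auto
  have "norm (A n (lambda1 \<mu> g) s - A n f s) \<le> (C + 2 * B) / n" for n s
  proof -
    have "norm ((lambda1 \<mu> ^^ Suc n) g s) \<le> B" "norm ((lambda1 \<mu> ^^ 1) g s) \<le> B"
      using funpow_bound[OF bounded_onD(1)[OF gK] B] by blast+
    then have "norm ((lambda1 \<mu> ^^ Suc n) g s - lambda1 \<mu> g s) \<le> 2 * B"
      using norm_triangle_ineq4[of "(lambda1 \<mu> ^^ Suc n) g s" "lambda1 \<mu> g s"] by simp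
    then have "norm (A n (lambda1 \<mu> g) s - A n g s) \<le> 2 * B / n"
      unfolding cesaro_step_difference by (simp add: norm_divide divide_right_mono del: funpow.simps)
    then have "norm (A n (lambda1 \<mu> g) s - A n f s) \<le> 2 * B / n + C / n"
      using C(2)[of n s] norm_triangle_ineq[of "A n (lambda1 \<mu> g) s - A n g s" "A n g s - A n f s"] by simp
    then show ?thesis by (simp add: add_divide_distrib)
  qed
  moreover have "0 \<le> B" using B norm_ge_zero order_trans by blast
  ultimately show ?case using C(1) by (intro exI[of _ "C + 2 * B"]) auto
next
  case (convex g h t)
  then obtain C D where C: "C \<ge> 0" "\<And>n s. norm (A n g s - A n f s) \<le> C / n"
    and D: "D \<ge> 0" "\<And>n s. norm (A n h s - A n f s) \<le> D / n" by auto
  note ghK = orbit_hull_bounded_on[OF convex.hyps(1) K] orbit_hull_bounded_on[OF convex.hyps(2) K]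
  have "norm (A n (\<lambda>s. of_real t * g s + of_real (1 - t) * h s) s - A n f s) \<le> (C + D) / n" for n s
  proof -
    have eq: "A n (\<lambda>s. of_real t * g s + of_real (1 - t) * h s) s - A n f s =
        of_real t * (A n g s - A n f s) + of_real (1 - t) * (A n h s - A n f s)"
      unfolding cesaro_linear[OF K(1) ghK] by (simp add: algebra_simps)
    have "norm (of_real t * (A n g s - A n f s)) = t * norm (A n g s - A n f s)"
      "norm (of_real (1 - t) * (A n h s - A n f s)) = (1 - t) * norm (A n h s - A n f s)"
      using convex.hyps(3,4) unfolding norm_mult norm_of_real by simp_all
    then have "norm (A n (\<lambda>s. of_real t * g s + of_real (1 - t) * h s) s - A n f s) \<le>
        t * norm (A n g s - A n f s) + (1 - t) * norm (A n h s - A n f s)"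
      unfolding eq by (metis norm_triangle_ineq)
    also have "\<dots> \<le> 1 * (C / n) + 1 * (D / n)"
      using convex.hyps(3,4) C D by (intro add_mono mult_mono) auto
    finally show ?thesis by (simp add: add_divide_distrib)
  qed
  then show ?case using C(1) D(1) by (intro exI[of _ "C + D"]) auto
qed

section \<open>Estimates in quadratic mean\<close>

definition energy :: "('g \<Rightarrow> complex) \<Rightarrow> real" where
  "energy f = (LINT s|m. (norm (f s))\<^sup>2)"

lemma bounded_on_integrable:
  fixes F :: "complex \<Rightarrow> 'b::{banach, second_countable_topology}"
  assumes K: "compact K" and f: "f \<in> bounded_on K" and F: "continuous_on UNIV F" "F 0 = 0"
  shows "integrable m (\<lambda>s. F (f s))"
proof -
  obtain B where B: "\<And>s. norm (f s) \<le> B" using bounded_onD[OF f] by auto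
  have "compact (F ` cball 0 B)"
    using F by (intro compact_continuous_image compact_cball) (auto intro: continuous_on_subset)
  then have "bounded (F ` cball 0 B)" by (rule compact_imp_bounded)
  then obtain C where "\<forall>y\<in>F ` cball 0 B. norm y \<le> C" unfolding bounded_iff ..
  then have C: "\<And>z. z \<in> cball 0 B \<Longrightarrow> norm (F z) \<le> C" by blast
  have [measurable]: "F \<in> borel_measurable borel" "f \<in> borel_measurable borel"
    using F f by (auto intro: borel_measurable_continuous_onI bounded_onD)
  show ?thesis
  proof (rule integrableI_bounded_set[where A = K and B = C])
    show "K \<in> sets m" using K by (simp add: borel_compact)
    show "AE x in m. x \<in> K \<longrightarrow> norm (F (f x)) \<le> C" using B C by auto
    show "AE x in m. x \<notin> K \<longrightarrow> F (f x) = 0" using F bounded_onD(3)[OF f] by auto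
  qed (use haar_compact_finite[OF K] in auto)
qed

lemma bounded_on_L1: "compact K \<Longrightarrow> f \<in> bounded_on K \<Longrightarrow> f \<in> L1 m"
  using bounded_on_integrable[of K f "\<lambda>z. z"] by (simp add: L1_def)

lemma energy_integrable: "compact K \<Longrightarrow> f \<in> bounded_on K \<Longrightarrow> integrable m (\<lambda>s. (norm (f s))\<^sup>2)"
  by (rule bounded_on_integrable) (auto intro!: continuous_intros)

lemma energy_nonneg: "0 \<le> energy f"
  by (simp add: energy_def)

text \<open>Jensen's inequality for the square, from expanding the nonnegative variance of
  \<open>norm (f (- x + s))\<close> under \<open>\<mu>\<close>.\<close>

lemma norm_lambda1_square_le:
  assumes f: "f \<in> bounded_on K"
  shows "ennreal ((norm (lambda1 \<mu> f s))\<^sup>2) \<le> conv (\<lambda>y. ennreal ((norm (f y))\<^sup>2)) s"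
proof -
  obtain B where B: "\<And>s. norm (f s) \<le> B" using bounded_onD[OF f] by auto
  have [measurable]: "(\<lambda>x. f (- x + s)) \<in> borel_measurable \<mu>"
    by (intro measurable_translate_compose bounded_onD(1)[OF f])
  define g where "g x = norm (f (- x + s))" for x
  have g [measurable]: "g \<in> borel_measurable \<mu>" unfolding g_def by simp
  have gi: "integrable \<mu> g"
    unfolding g_def by (intro integrable_norm bounded_on_translate_integrable[OF f])
  have "norm ((g x)\<^sup>2) \<le> B\<^sup>2" for x
    unfolding g_def using B by (simp add: power_mono)
  then have g2: "integrable \<mu> (\<lambda>x. (g x)\<^sup>2)"
    by (intro integrable_const_bound[of _ "B\<^sup>2"]) auto
  define c where "c = (LINT x|\<mu>. g x)"
  have one: "measure \<mu> UNIV = 1" by (simp add: measure_def)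
  have "0 \<le> (LINT x|\<mu>. (g x - c)\<^sup>2)" by simp
  also have "(\<lambda>x. (g x - c)\<^sup>2) = (\<lambda>x. (g x)\<^sup>2 - 2 * c * g x + c\<^sup>2)"
    by (simp add: power2_diff fun_eq_iff)
  also have "(LINT x|\<mu>. (g x)\<^sup>2 - 2 * c * g x + c\<^sup>2) = (LINT x|\<mu>. (g x)\<^sup>2) - 2 * c * c + c\<^sup>2"
    using gi g2 one by (simp add: c_def)
  finally have "c\<^sup>2 \<le> (LINT x|\<mu>. (g x)\<^sup>2)"
    by (simp add: power2_eq_square)
  moreover have "norm (lambda1 \<mu> f s) \<le> c"
    unfolding lambda1_def c_def g_def by (rule integral_norm_bound)
  then have "(norm (lambda1 \<mu> f s))\<^sup>2 \<le> c\<^sup>2" by (intro power_mono) auto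
  ultimately have "ennreal ((norm (lambda1 \<mu> f s))\<^sup>2) \<le> ennreal (LINT x|\<mu>. (g x)\<^sup>2)"
    by (intro ennreal_leI) linarith
  also have "\<dots> = (\<integral>\<^sup>+x. ennreal ((g x)\<^sup>2) \<partial>\<mu>)"
    by (rule nn_integral_eq_integral[symmetric]) (use g2 in auto)
  finally show ?thesis by (simp add: conv_def g_def)
qed

lemma energy_lambda1_le:
  assumes K: "invariant K" and f: "f \<in> bounded_on K"
  shows "energy (lambda1 \<mu> f) \<le> energy f"
proof -
  have c: "compact K" using K by (simp add: invariant_def)
  have eq: "ennreal (energy g) = (\<integral>\<^sup>+s. ennreal ((norm (g s))\<^sup>2) \<partial>m)" if "g \<in> bounded_on K" for g
    unfolding energy_def by (rule nn_integral_eq_integral[symmetric]) (use energy_integrable[OF c that] in auto)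
  have [measurable]: "f \<in> borel_measurable borel" by (rule bounded_onD(1)[OF f])
  have "ennreal (energy (lambda1 \<mu> f)) \<le> (\<integral>\<^sup>+s. conv (\<lambda>y. ennreal ((norm (f y))\<^sup>2)) s \<partial>m)"
    unfolding eq[OF lambda1_bounded_on[OF K f]] by (intro nn_integral_mono norm_lambda1_square_le[OF f])
  also have "\<dots> \<le> ennreal (energy f)"
    unfolding eq[OF f] by (rule nn_integral_conv_le) simp
  finally show ?thesis by (simp add: energy_nonneg)
qed

lemma energy_funpow_le:
  "invariant K \<Longrightarrow> f \<in> bounded_on K \<Longrightarrow> energy ((lambda1 \<mu> ^^ k) f) \<le> energy f"
  by (induction k) (auto intro: order_trans[OF energy_lambda1_le] funpow_bounded_on)

lemma energy_convex:
  assumes K: "compact K" and fg: "f \<in> bounded_on K" "g \<in> bounded_on K" and t: "0 \<le> t" "t \<le> 1"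
  shows "energy (\<lambda>s. of_real t * f s + of_real (1 - t) * g s) \<le> t * energy f + (1 - t) * energy g"
proof -
  note int = energy_integrable[OF K fg(1)] energy_integrable[OF K fg(2)]
  have "energy (\<lambda>s. of_real t * f s + of_real (1 - t) * g s) \<le>
      (LINT s|m. t * (norm (f s))\<^sup>2 + (1 - t) * (norm (g s))\<^sup>2)"
    unfolding energy_def
    by (intro integral_mono energy_integrable[OF K bounded_on_linear[OF fg]] norm_square_convex t)
      (use int in auto)
  also have "\<dots> = t * energy f + (1 - t) * energy g"
    using int by (simp add: energy_def)
  finally show ?thesis .
qed

lemma energy_cesaro_le:
  assumes K: "invariant K" and f: "f \<in> bounded_on K" and "n > 0"
  shows "energy (A n f) \<le> energy f"
  using assms(3)
proof (induction n rule: nat_induct_non_zero)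
  case 1
  have "A 1 f = lambda1 \<mu> f" by (simp add: cesaro_mean_def)
  then show ?case using energy_lambda1_le[OF K f] by simp
next
  case (Suc n)
  have c: "compact K" using K by (simp add: invariant_def)
  have Af: "A n f \<in> bounded_on K"
    using orbit_hull_bounded_on[OF cesaro_mean_orbit_hull[OF orbit_hull.base Suc(1)] K f] .
  have t: "0 \<le> real n / real (Suc n)" "real n / real (Suc n) \<le> 1" by (auto simp: field_simps)
  have "energy (A (Suc n) f) \<le> (n / Suc n) * energy (A n f) + (1 - n / Suc n) * energy ((lambda1 \<mu> ^^ Suc n) f)"
    unfolding cesaro_mean_Suc[OF Suc(1)] by (rule energy_convex[OF c Af funpow_bounded_on[OF K f] t])
  also have "\<dots> \<le> (n / Suc n) * energy f + (1 - n / Suc n) * energy f"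
    using t Suc energy_funpow_le[OF K f, of "Suc n"] by (intro add_mono mult_left_mono) auto
  also have "\<dots> = energy f" by (simp add: algebra_simps)
  finally show ?case .
qed

lemma energy_parallelogram:
  assumes K: "compact K" and fg: "f \<in> bounded_on K" "g \<in> bounded_on K"
  shows "energy (\<lambda>s. f s - g s) =
    2 * energy f + 2 * energy g - 4 * energy (\<lambda>s. of_real (1/2) * f s + of_real (1 - 1/2) * g s)"
  unfolding energy_def norm_parallelogram
  using energy_integrable[OF K fg(1)] energy_integrable[OF K fg(2)]
    energy_integrable[OF K bounded_on_linear[OF fg, of "of_real (1/2)" "of_real (1 - 1/2)"]]
  by simp

text \<open>Where \<open>norm (f s)\<close> exceeds \<open>\<delta>\<close> it is at most its square
  divided by \<open>\<delta>\<close>. The free parameter takes the place of the Cauchy-Schwarz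
  inequality.\<close>

lemma norm1_le_energy:
  assumes K: "compact K" and f: "f \<in> bounded_on K" and "\<delta> > 0"
  shows "norm1 m f \<le> \<delta> * measure m K + energy f / \<delta>"
proof -
  have fin: "emeasure m K < \<infinity>" "K \<in> sets m"
    using haar_compact_finite[OF K] K by (auto simp: borel_compact)
  have pw: "norm (f s) \<le> indicator K s * \<delta> + (norm (f s))\<^sup>2 / \<delta>" for s
  proof (cases "s \<in> K")
    case True
    show ?thesis
    proof (cases "norm (f s) \<le> \<delta>")
      case False
      then have "norm (f s) * \<delta> \<le> (norm (f s))\<^sup>2"
        unfolding power2_eq_square by (intro mult_left_mono) auto
      then have "norm (f s) \<le> (norm (f s))\<^sup>2 / \<delta>"
        using \<open>\<delta> > 0\<close> by (simp add: field_simps)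
      then show ?thesis using True \<open>\<delta> > 0\<close> by simp
    qed (use True \<open>\<delta> > 0\<close> in \<open>auto intro: add_increasing2\<close>)
  qed (use bounded_onD(3)[OF f] in simp)
  have i: "integrable m (\<lambda>s. indicator K s * \<delta>)" "integrable m (\<lambda>s. (norm (f s))\<^sup>2 / \<delta>)"
    using fin energy_integrable[OF K f] by (auto intro!: integrable_mult_left integrable_real_indicator)
  have "norm1 m f \<le> (LINT s|m. indicator K s * \<delta> + (norm (f s))\<^sup>2 / \<delta>)"
    unfolding norm1_def using bounded_on_L1[OF K f] i pw
    by (intro integral_mono Bochner_Integration.integrable_add) (auto simp: L1_def)
  also have "\<dots> = measure m K * \<delta> + energy f / \<delta>"
    unfolding Bochner_Integration.integral_add[OF i] using fin by (simp add: energy_def)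
  finally show ?thesis by (simp add: mult.commute)
qed

text \<open>
  F. Riesz' proof of the mean ergodic theorem in Hilbert space: an almost minimizer of the norm in the
  convex hull of the orbit has averages that are again almost minimizers, hence close to each other
  by the parallelogram law.
\<close>

lemma bounded_on_cesaro_cauchy:
  assumes K: "invariant K" and f: "f \<in> bounded_on K"
  shows "cesaro_cauchy f"
  unfolding cesaro_cauchy_def
proof (intro allI impI)
  fix e :: real assume e: "e > 0"
  have c: "compact K" using K by (simp add: invariant_def)
  define I where "I = orbit_hull (lambda1 \<mu>) f"
  define d where "d = (INF g\<in>I. energy g)"
  \<comment> \<open>The summand 1 keeps \<open>b\<close> positive when \<open>K\<close> is null. The
    constants are chosen backwards from \<open>norm1_le_energy\<close>:
    \<open>\<delta> * b = e / 4\<close> and \<open>4 * \<eta> / \<delta> = e / 4\<close>.\<close>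
  define b where "b = measure m K + 1"
  define \<delta> where "\<delta> = e / (4 * b)"
  define \<eta> where "\<eta> = \<delta> * e / 16"
  have b: "b > 0" "measure m K \<le> b" by (simp_all add: b_def add_pos_nonneg add_nonneg_pos)
  have pos: "\<delta> > 0" "\<eta> > 0" using e b by (simp_all add: \<delta>_def \<eta>_def)
  have I: "f \<in> I" by (simp add: I_def orbit_hull.base)
  have bdd: "bdd_below (energy ` I)" by (intro bdd_belowI[of _ 0]) (auto simp: energy_nonneg)
  have "d < d + \<eta>" using pos by simp
  then obtain g where g: "g \<in> I" "energy g < d + \<eta>"
    unfolding d_def using bdd I by (subst (asm) cINF_less_iff) auto
  have gK: "g \<in> bounded_on K" using g orbit_hull_bounded_on[OF _ K f] by (simp add: I_def)
  obtain C where C: "C \<ge> 0" "\<And>n s. norm (A n g s - A n f s) \<le> C / n"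
    using cesaro_orbit_hull_close[OF _ K f, of g] g(1) unfolding I_def by blast
  \<comment> \<open>Ensures \<open>b * (C / n) \<le> e / 8\<close> for \<open>n > N\<close>, the
    price of passing between \<open>f\<close> and \<open>g\<close>.\<close>
  obtain N :: nat where N: "8 * b * C / e < N" using reals_Archimedean2 by blast
  have AI: "A n h \<in> I" if "h \<in> I" "n > 0" for n h
    using that cesaro_mean_orbit_hull by (auto simp: I_def)
  have AK: "A n h \<in> bounded_on K" if "h \<in> I" "n > 0" for n h
    using AI[OF that] orbit_hull_bounded_on[OF _ K f] by (simp add: I_def)
  have close: "norm1 m (\<lambda>s. A n g s - A n f s) \<le> e / 8" if n: "n \<ge> Suc N" for n
  proof -
    have dK: "(\<lambda>s. A n g s - A n f s) \<in> bounded_on K"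
      using AK g I n by (intro bounded_on_diff) auto
    have "norm1 m (\<lambda>s. A n g s - A n f s) \<le> (LINT s|m. indicator K s * (C / n))"
      unfolding norm1_def
    proof (rule integral_mono)
      show "integrable m (\<lambda>s. norm (A n g s - A n f s))"
        using bounded_on_L1[OF c dK] by (simp add: L1_def)
      show "integrable m (\<lambda>s. indicator K s * (C / n))"
        using haar_compact_finite[OF c] c by (intro integrable_mult_left integrable_real_indicator) (auto simp: borel_compact)
      show "norm (A n g s - A n f s) \<le> indicator K s * (C / n)" for s
        using C(2)[of n s] bounded_onD(3)[OF dK, of s] by (cases "s \<in> K") auto
    qed
    also have "\<dots> = measure m K * (C / n)"
      using haar_compact_finite[OF c] c by (simp add: borel_compact)
    also have "\<dots> \<le> b * (C / n)" using b C by (intro mult_right_mono) auto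
    also have "\<dots> \<le> e / 8"
    proof -
      have "8 * b * C / e < n" using N n by linarith
      then have "8 * b * C < n * e" using e by (simp add: field_simps)
      then show ?thesis using n by (simp add: field_simps)
    qed
    finally show ?thesis .
  qed
  have mid: "norm1 m (\<lambda>s. A i g s - A j g s) \<le> e / 2" if ij: "i > 0" "j > 0" for i j
  proof -
    note Ag = AK[OF g(1) ij(1)] AK[OF g(1) ij(2)]
    have "(\<lambda>s. of_real (1/2) * A i g s + of_real (1 - 1/2) * A j g s) \<in> I"
      using AI[OF g(1)] ij unfolding I_def by (intro orbit_hull.convex) auto
    then have "d \<le> energy (\<lambda>s. of_real (1/2) * A i g s + of_real (1 - 1/2) * A j g s)"
      unfolding d_def by (rule cINF_lower[OF bdd])
    moreover have "energy (A i g) < d + \<eta>" "energy (A j g) < d + \<eta>"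
      using energy_cesaro_le[OF K gK] ij g(2) by (meson le_less_trans)+
    \<comment> \<open>The bound is
      \<open>2 * (d + \<eta>) + 2 * (d + \<eta>) - 4 * d\<close>.\<close>
    ultimately have "energy (\<lambda>s. A i g s - A j g s) \<le> 4 * \<eta>"
      unfolding energy_parallelogram[OF c Ag] by linarith
    then have "energy (\<lambda>s. A i g s - A j g s) / \<delta> \<le> 4 * \<eta> / \<delta>"
      using pos by (intro divide_right_mono) auto
    also have "4 * \<eta> / \<delta> = e / 4" using pos by (simp add: \<eta>_def)
    finally have "energy (\<lambda>s. A i g s - A j g s) / \<delta> \<le> e / 4" .
    moreover have "\<delta> * measure m K \<le> e / 4"
    proof -
      have "\<delta> * measure m K \<le> \<delta> * b" using b pos by (intro mult_left_mono) auto
      also have "\<dots> = e / 4" using b by (simp add: \<delta>_def)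
      finally show ?thesis .
    qed
    ultimately show ?thesis
      using norm1_le_energy[OF c bounded_on_diff[OF Ag] pos(1)] by linarith
  qed
  have "norm1 m (\<lambda>s. A i f s - A j f s) < e" if ij: "i \<ge> Suc N" "j \<ge> Suc N" for i j
  proof -
    have L: "A n h \<in> L1 m" if "h \<in> I" for n h
      using that orbit_hull_bounded_on[OF _ K f] bounded_on_L1[OF c] cesaro_L1 by (auto simp: I_def)
    have "norm1 m (\<lambda>s. A i f s - A j f s) \<le> norm1 m (\<lambda>s. A i f s - A i g s) + norm1 m (\<lambda>s. A i g s - A j f s)"
      "norm1 m (\<lambda>s. A i g s - A j f s) \<le> norm1 m (\<lambda>s. A i g s - A j g s) + norm1 m (\<lambda>s. A j g s - A j f s)"
      using I g(1) by (intro norm1_triangle_diff L; simp)+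
    moreover have "norm1 m (\<lambda>s. A i f s - A i g s) \<le> e / 8" "norm1 m (\<lambda>s. A j g s - A j f s) \<le> e / 8"
      using close ij by (auto simp: norm1_minus_commute[of _ "A i f"])
    moreover have "norm1 m (\<lambda>s. A i g s - A j g s) \<le> e / 2" using mid ij by auto
    ultimately show ?thesis using e by linarith
  qed
  then show "\<exists>N. \<forall>i\<ge>N. \<forall>j\<ge>N. norm1 m (\<lambda>s. A i f s - A j f s) < e" by blast
qed

section \<open>Density of bounded functions on invariant compact sets\<close>

lemma bounded_on_mono: "K \<subseteq> L \<Longrightarrow> bounded_on K \<subseteq> bounded_on L"
  by (auto simp: bounded_on_def)

lemma invariant_Un: "invariant K \<Longrightarrow> invariant L \<Longrightarrow> invariant (K \<union> L)"
  by (auto simp: invariant_def compact_Un)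

text \<open>This is where compactness of the subgroup enters: it makes \<open>H_of \<mu> + K\<close>
  compact, and left translation by the subgroup is absorbed into the first summand.\<close>

lemma compact_subset_invariant:
  assumes H: "compact (H_of \<mu>)" and K: "compact K"
  obtains L where "invariant L" "K \<subseteq> L"
proof (rule that[of "{h + k |h k. h \<in> H_of \<mu> \<and> k \<in> K}"])
  show "invariant {h + k |h k. h \<in> H_of \<mu> \<and> k \<in> K}"
    unfolding invariant_def
  proof (intro conjI ballI)
    show "compact {h + k |h k. h \<in> H_of \<mu> \<and> k \<in> K}"
      by (rule compact_sums_group[OF H K])
    fix h x assume h: "h \<in> H_of \<mu>" and "x \<in> {h + k |h k. h \<in> H_of \<mu> \<and> k \<in> K}"
    then obtain h' k where x: "x = h' + k" "h' \<in> H_of \<mu>" "k \<in> K" by blast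
    then have "h + x = (h + h') + k" "h + h' \<in> H_of \<mu>"
      using h is_subgroup_H by (auto simp: is_subgroup_def add.assoc)
    then show "h + x \<in> {h + k |h k. h \<in> H_of \<mu> \<and> k \<in> K}" using x by blast
  qed
  have "k = 0 + k" "0 \<in> H_of \<mu>" for k :: 'g
    using is_subgroup_H by (auto simp: is_subgroup_def)
  then show "K \<subseteq> {h + k |h k. h \<in> H_of \<mu> \<and> k \<in> K}" by blast
qed

text \<open>Inner regularity of \<open>m\<close> is given on open sets, so \<open>K\<close> is
  chosen inside an open \<open>U\<close> around \<open>S\<close>. It may stick out of
  \<open>S\<close>; only \<open>S - K\<close> has to be small.\<close>

lemma haar_compact_approximation:
  assumes S: "S \<in> sets borel" "emeasure m S < \<infinity>" and "0 < e"
  obtains K where "compact K" "emeasure m (S - K) < ennreal e"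
proof -
  obtain U where U: "open U" "S \<subseteq> U" "emeasure m U < emeasure m S + 1"
    by (rule finite_haar_outer[OF S, of 1]) simp
  have "emeasure m S + 1 < \<infinity>" using S(2) by simp
  then have "emeasure m U < \<infinity>" by (rule less_trans[OF U(3)])
  then obtain r where r: "emeasure m U = ennreal r" "0 \<le> r"
    by (cases "emeasure m U") auto
  \<comment> \<open>For \<open>r = 0\<close> the strict inequality
    \<open>ennreal (r - e) < emeasure m U\<close> fails, both sides being 0; the empty set serves
    instead.\<close>
  show ?thesis
  proof (cases "r = 0")
    case True
    have "emeasure m (S - {}) \<le> emeasure m U" using U by (intro emeasure_mono) auto
    then show ?thesis using that[of "{}"] True r \<open>0 < e\<close> by simp
  next
    case False
    have "ennreal (r - e) < emeasure m U"
      unfolding r(1) using r(2) False \<open>0 < e\<close> by (intro ennreal_lessI) auto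
    then obtain K where K: "compact K" "K \<subseteq> U" "ennreal (r - e) < emeasure m K"
      using haar_open_inner[OF U(1)] by (auto simp: less_SUP_iff)
    obtain k where k: "emeasure m K = ennreal k" "0 \<le> k"
      using haar_compact_finite[OF K(1)] by (cases "emeasure m K") auto
    have Kb: "K \<in> sets m" "emeasure m K \<noteq> \<infinity>"
      using K(1) k by (auto simp: borel_compact)
    have "r - e < k"
      using K(3) k by (metis ennreal_leI not_le)
    have "emeasure m (S - K) \<le> emeasure m (U - K)"
      using U Kb by (intro emeasure_mono) auto
    also have "\<dots> = emeasure m U - emeasure m K"
      using U Kb K(2) by (intro emeasure_Diff) auto
    also have "\<dots> = ennreal (r - k)"
      using r k by (simp add: ennreal_minus)
    also have "\<dots> < ennreal e"
      using \<open>r - e < k\<close> \<open>0 < e\<close> by (intro ennreal_lessI) auto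
    finally show ?thesis using that K(1) by blast
  qed
qed

lemma bounded_on_dense:
  assumes H: "compact (H_of \<mu>)" and f: "integrable m f" and "0 < e"
  shows "\<exists>K g. invariant K \<and> g \<in> bounded_on K \<and> norm1 m (\<lambda>s. f s - g s) < e"
  using f \<open>0 < e\<close>
proof (induction f arbitrary: e rule: integrable_induct)
  case (base S z)
  then have S: "S \<in> sets borel" "emeasure m S < \<infinity>" by auto
  \<comment> \<open>Adding 1 guards against \<open>z = 0\<close>.\<close>
  have pos: "0 < e / (norm z + 1)" using base by (simp add: add_nonneg_pos)
  obtain K where K: "compact K" "emeasure m (S - K) < ennreal (e / (norm z + 1))"
    using haar_compact_approximation[OF S pos] by blast
  obtain L where L: "invariant L" "K \<subseteq> L" using compact_subset_invariant[OF H K(1)] by blast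
  have Kb: "K \<in> sets borel" using K by (simp add: borel_compact)
  have fin: "emeasure m (S - K) < \<infinity>" using K(2) by (simp add: less_trans[OF _ ennreal_less_top])
  have "(\<lambda>s. indicator (S \<inter> K) s *\<^sub>R z) \<in> bounded_on L"
    unfolding bounded_on_def
  proof (intro CollectI conjI)
    show "(\<lambda>s. indicator (S \<inter> K) s *\<^sub>R z) \<in> borel_measurable borel" using S Kb by simp
    show "\<exists>B. \<forall>s. norm (indicator (S \<inter> K) s *\<^sub>R z) \<le> B"
      by (intro exI[of _ "norm z"]) (auto simp: indicator_def)
  qed (use L in \<open>auto simp: indicator_def\<close>)
  moreover have "norm1 m (\<lambda>s. indicator S s *\<^sub>R z - indicator (S \<inter> K) s *\<^sub>R z) < e"
  proof -
    have "norm1 m (\<lambda>s. indicator S s *\<^sub>R z - indicator (S \<inter> K) s *\<^sub>R z) = (LINT s|m. indicator (S - K) s * norm z)"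
      unfolding norm1_def by (intro Bochner_Integration.integral_cong) (auto simp: indicator_def)
    also have "\<dots> = measure m (S - K) * norm z" using S Kb fin by simp
    also have "\<dots> \<le> measure m (S - K) * (norm z + 1)" by (intro mult_left_mono) auto
    also have "\<dots> < e"
    proof -
      have "ennreal (measure m (S - K)) < ennreal (e / (norm z + 1))"
        using K(2) fin by (simp add: emeasure_eq_ennreal_measure)
      then have "measure m (S - K) < e / (norm z + 1)" by (simp add: ennreal_less_iff)
      then show ?thesis by (subst (asm) pos_less_divide_eq) (auto simp: add_nonneg_pos)
    qed
    finally show ?thesis .
  qed
  ultimately show ?case using L by blast
next
  case (add f1 f2)
  obtain K1 g1 where 1: "invariant K1" "g1 \<in> bounded_on K1" "norm1 m (\<lambda>s. f1 s - g1 s) < e / 2"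
    using add.IH(1)[of "e / 2"] add.prems by auto
  obtain K2 g2 where 2: "invariant K2" "g2 \<in> bounded_on K2" "norm1 m (\<lambda>s. f2 s - g2 s) < e / 2"
    using add.IH(2)[of "e / 2"] add.prems by auto
  have g: "g1 \<in> bounded_on (K1 \<union> K2)" "g2 \<in> bounded_on (K1 \<union> K2)"
    using 1 2 bounded_on_mono[of K1 "K1 \<union> K2"] bounded_on_mono[of K2 "K1 \<union> K2"] by auto
  have "g1 \<in> L1 m" "g2 \<in> L1 m"
    using 1 2 by (auto simp: invariant_def intro: bounded_on_L1)
  then have "(\<lambda>s. f1 s - g1 s) \<in> L1 m" "(\<lambda>s. f2 s - g2 s) \<in> L1 m"
    using add.hyps by (auto simp: L1_def)
  from norm1_triangle[OF this] have "norm1 m (\<lambda>s. (f1 s + f2 s) - (1 * g1 s + 1 * g2 s)) < e"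
    using 1(3) 2(3) by (simp add: algebra_simps)
  then show ?case
    using invariant_Un[OF 1(1) 2(1)] bounded_on_linear[OF g, of 1 1] by blast
next
  case (lim f u)
  have "(\<lambda>i. norm1 m (\<lambda>s. f s - u i s)) \<longlonglongrightarrow> (LINT s|m. 0)"
    unfolding norm1_def
  \<comment> \<open>The approximants satisfy \<open>norm (u i s) \<le> 2 * norm (f s)\<close>; the
    difference from \<open>f\<close> accounts for the third copy.\<close>
  proof (rule integral_dominated_convergence[where w = "\<lambda>s. 3 * norm (f s)"])
    show "AE s in m. (\<lambda>i. norm (f s - u i s)) \<longlonglongrightarrow> 0"
    proof (rule AE_I2)
      fix s assume "s \<in> space m"
      then have "(\<lambda>i. norm (f s - u i s)) \<longlonglongrightarrow> norm (f s - f s)"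
        by (intro tendsto_norm tendsto_diff tendsto_const lim.hyps)
      then show "(\<lambda>i. norm (f s - u i s)) \<longlonglongrightarrow> 0" by simp
    qed
    show "AE s in m. norm (norm (f s - u i s)) \<le> 3 * norm (f s)" for i
    proof (rule AE_I2)
      fix s assume "s \<in> space m"
      then show "norm (norm (f s - u i s)) \<le> 3 * norm (f s)"
        using lim.hyps(3)[of s i] norm_triangle_ineq4[of "f s" "u i s"] by simp
    qed
  qed (use lim.hyps(1,4) in auto)
  then have "(\<lambda>i. norm1 m (\<lambda>s. f s - u i s)) \<longlonglongrightarrow> 0" by simp
  then have "\<forall>\<^sub>F i in sequentially. norm1 m (\<lambda>s. f s - u i s) < e / 2"
    using lim.prems by (intro order_tendstoD) auto
  then obtain i where i: "norm1 m (\<lambda>s. f s - u i s) < e / 2"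
    using eventually_happens'[OF sequentially_bot] by blast
  obtain K g where g: "invariant K" "g \<in> bounded_on K" "norm1 m (\<lambda>s. u i s - g s) < e / 2"
    using lim.IH[of "e / 2" i] lim.prems by auto
  have "norm1 m (\<lambda>s. f s - g s) \<le> norm1 m (\<lambda>s. f s - u i s) + norm1 m (\<lambda>s. u i s - g s)"
    using lim.hyps(1)[of i] lim.hyps(4) g
    by (intro norm1_triangle_diff) (auto simp: L1_def invariant_def dest: bounded_on_L1[unfolded L1_def])
  then have "norm1 m (\<lambda>s. f s - g s) < e" using i g(3) by linarith
  then show ?case using g by blast
qed

lemma compact_imp_mean_ergodic:
  assumes H: "compact (H_of \<mu>)"
  shows "mean_ergodic_on (L1 m) (norm1 m) (lambda1 \<mu>)"
proof (rule mean_ergodicI)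
  fix f and e :: real assume "f \<in> L1 m" "e > 0"
  then obtain K g where g: "invariant K" "g \<in> bounded_on K" "norm1 m (\<lambda>s. f s - g s) < e"
    using bounded_on_dense[OF H, of f e] by (auto simp: L1_def)
  then have "g \<in> L1 m" by (auto simp: invariant_def intro: bounded_on_L1)
  then show "\<exists>g\<in>L1 m. norm1 m (\<lambda>s. f s - g s) < e \<and> cesaro_cauchy g"
    using g bounded_on_cesaro_cauchy[OF g(1,2)] by blast
qed

end

section \<open>Invariant compact sets\<close>

text \<open>
  Poincare recurrence: two of the iterates \<open>n a + y\<close> are close to each other, so some positive
  multiple of \<open>a\<close> is close to \<open>0\<close>.
\<close>

lemma compact_translate_backwards:
  fixes M :: "'g::{t2_space, topological_group_add} set"
  assumes M: "compact M" and a: "\<And>y. y \<in> M \<Longrightarrow> a + y \<in> M" and y: "y \<in> M"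
  shows "- a + y \<in> M"
proof (rule ccontr)
  assume "- a + y \<notin> M"
  define t where "t k = ((+) a ^^ k) 0" for k
  have iter: "((+) a ^^ k) z = t k + z" for k z
    by (induction k) (auto simp: t_def add.assoc)
  have "t k + a = t (Suc k)" for k
    using iter[of k a] by (simp add: t_def funpow_swap1)
  moreover have tM: "t k + y \<in> M" for k
    by (induction k) (use a y in \<open>auto simp: t_def add.assoc\<close>)
  \<comment> \<open>One summand \<open>a\<close> cancels, so every positive multiple of
    \<open>a\<close> carries \<open>- a + y\<close> into \<open>M\<close>. A positive multiple
    inside the neighbourhood \<open>V\<close> below would keep it outside.\<close>
  ultimately have shift: "t (Suc k) + (- a + y) \<in> M" for k
    by (metis add.assoc minus_add_cancel add_minus_cancel)
  have "open (- M)" using compact_imp_closed[OF M] by auto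
  then obtain V where V: "open V" "0 \<in> V" "\<And>v z. v \<in> V \<Longrightarrow> z \<in> {- a + y} \<Longrightarrow> v + z \<in> - M"
    by (rule compact_preimage_neighbourhood[OF compact_sing, of _ "\<lambda>v z. v + z" "- a + y" 0])
      (use \<open>- a + y \<notin> M\<close> in \<open>auto intro!: continuous_intros\<close>)
  have "open ((\<lambda>p. fst p - snd p) -` V :: ('g \<times> 'g) set)"
    using V(1) by (intro open_vimage) (auto intro!: continuous_intros)
  moreover have "(0, 0) \<in> ((\<lambda>p. fst p - snd p) -` V :: ('g \<times> 'g) set)" using V(2) by simp
  ultimately obtain W1 W2 where W': "open W1" "open W2" "(0, 0) \<in> W1 \<times> W2"
    "W1 \<times> W2 \<subseteq> ((\<lambda>p. fst p - snd p) -` V :: ('g \<times> 'g) set)"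
    by (rule open_prod_elim)
  define W where "W = W1 \<inter> W2"
  have W: "open W" "0 \<in> W" "\<And>w w'. w \<in> W \<Longrightarrow> w' \<in> W \<Longrightarrow> w - w' \<in> V"
    using W' by (auto simp: W_def)
  \<comment> \<open>With right translates \<open>W + z\<close> the centre cancels: for two points
    \<open>u\<close>, \<open>u'\<close> of one translate, \<open>(u - z) - (u' - z) = u - u'\<close>
    lies in \<open>V\<close>.\<close>
  have op: "\<And>z. open {u. u - z \<in> W}"
    using open_translate_vimage(2)[OF W(1), of "- z" for z] by simp
  obtain F where F: "F \<subseteq> M" "finite F" "M \<subseteq> (\<Union>z\<in>F. {u. u - z \<in> W})"
    by (rule compactE_image[OF M, of M "\<lambda>z. {u. u - z \<in> W}"]) (use op W(2) in auto)
  have "\<exists>z\<in>F. t n + y - z \<in> W" for n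
    using subsetD[OF F(3) tM[of n]] by auto
  then obtain c where c: "\<And>n. c n \<in> F" "\<And>n. t n + y - c n \<in> W" by metis
  have "finite (range c)" using c(1) F(2) by (meson finite_subset image_subsetI)
  then have "\<not> inj c" using finite_imageD by blast
  then obtain i j where "c i = c j" "i \<noteq> j" by (auto simp: inj_on_def)
  then obtain k l where kl: "c k = c l" "l < k" by (cases i j rule: linorder_cases) metis+
  obtain d where d: "k = Suc (d + l)" using kl(2) less_imp_Suc_add[of l k] by (auto simp: add.commute)
  have "t k = t (Suc d) + t l"
    using iter[of "Suc d" "t l"] by (simp add: d t_def funpow_add)
  then have "t k + y - c k = t (Suc d) + (t l + y - c l)"
    by (simp only: kl(1) diff_conv_add_uminus add.assoc)
  then have "(t k + y - c k) - (t l + y - c l) = t (Suc d)" by simp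
  then have "t (Suc d) \<in> V" using W(3)[OF c(2)[of k] c(2)[of l]] by simp
  then show False using V(3)[of "t (Suc d)" "- a + y"] shift[of d] by simp
qed

lemma compact_closed_subgroup_generated:
  fixes M :: "'g::{t2_space, topological_group_add} set"
  assumes M: "compact M" "M \<noteq> {}" and S: "\<And>x y. x \<in> S \<Longrightarrow> y \<in> M \<Longrightarrow> - x + y \<in> M"
  shows "compact (closed_subgroup_generated S)"
proof -
  let ?H = "closed_subgroup_generated S"
  \<comment> \<open>Demanding that both \<open>x\<close> and \<open>- x\<close> preserve
    \<open>M\<close> makes closure under inverses immediate. For \<open>x \<in> S\<close> the second
    half is assumed, and the first is \<open>compact_translate_backwards\<close> with
    \<open>a = - x\<close>.\<close>
  define Q where "Q = {x. \<forall>y\<in>M. x + y \<in> M \<and> - x + y \<in> M}"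
  have cM: "closed M" using M(1) by (rule compact_imp_closed)
  have "Q = (\<Inter>y\<in>M. {x. x + y \<in> M} \<inter> {x. - x + y \<in> M})" by (auto simp: Q_def)
  moreover have "closed {x. x + y \<in> M}" "closed {x. - x + y \<in> M}" for y
    using open_translate_vimage(2,3)[of "- M" y] cM by (auto simp: closed_def Collect_neg_eq)
  ultimately have "closed Q" by (auto intro!: closed_INT closed_Int)
  moreover have "is_subgroup Q"
    unfolding is_subgroup_def
  proof (intro conjI ballI)
    fix x y assume xy: "x \<in> Q" "y \<in> Q"
    have "(x + y) + z = x + (y + z)" "- (x + y) + z = - y + (- x + z)" for z
      by (simp_all only: minus_add add.assoc)
    then show "x + y \<in> Q" using xy by (simp add: Q_def)
  qed (auto simp: Q_def)
  moreover have "S \<subseteq> Q"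
  proof
    fix x assume x: "x \<in> S"
    have "x + y \<in> M" if "y \<in> M" for y
      using compact_translate_backwards[OF M(1) S[OF x] that] by simp
    then show "x \<in> Q" using S[OF x] by (auto simp: Q_def)
  qed
  ultimately have HQ: "?H \<subseteq> Q" unfolding closed_subgroup_generated_def by auto
  obtain y where y: "y \<in> M" using M(2) by auto
  have "?H \<subseteq> (\<lambda>z. z - y) ` M"
  proof
    fix x assume "x \<in> ?H"
    then have "x + y \<in> M" using HQ y by (auto simp: Q_def)
    then have "(x + y) - y \<in> (\<lambda>z. z - y) ` M" by (rule imageI)
    then show "x \<in> (\<lambda>z. z - y) ` M" by simp
  qed
  moreover have "compact ((\<lambda>z. z - y) ` M)"
    by (intro compact_continuous_image M continuous_intros)
  ultimately have "?H = (\<lambda>z. z - y) ` M \<inter> ?H" by auto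
  then show ?thesis
    using compact_Int_closed[OF \<open>compact ((\<lambda>z. z - y) ` M)\<close> closed_subgroup_generated(1)] by metis
qed

section \<open>Averages of a continuous function of compact support\<close>

text \<open>Right translations are used because the operator translates on the left:
  \<open>- x + (s + v) = (- x + s) + v\<close>. Averaging therefore preserves the very pair
  \<open>V\<close>, \<open>e\<close>, not merely continuity.\<close>

definition modulus :: "'g::plus set \<Rightarrow> real \<Rightarrow> ('g \<Rightarrow> real) \<Rightarrow> bool" where
  "modulus V e r \<longleftrightarrow> (\<forall>s. \<forall>v\<in>V. \<bar>r (s + v) - r s\<bar> \<le> e)"

definition vanishes_at_infinity :: "('g::topological_space \<Rightarrow> real) \<Rightarrow> bool" where
  "vanishes_at_infinity r \<longleftrightarrow> (\<forall>e>0. \<exists>K. compact K \<and> (\<forall>s. s \<notin> K \<longrightarrow> \<bar>r s\<bar> \<le> e))"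

lemma modulus_continuous:
  fixes r :: "'g::topological_group_add \<Rightarrow> real"
  assumes "\<And>e. e > 0 \<Longrightarrow> \<exists>V. open V \<and> 0 \<in> V \<and> modulus V e r"
  shows "continuous_on UNIV r"
  unfolding continuous_on_def
proof (intro ballI tendstoI)
  fix s and e :: real assume "e > 0"
  then obtain V where V: "open V" "0 \<in> V" "modulus V (e / 2) r" using assms[of "e / 2"] by auto
  have "dist (r y) (r s) < e" if "- s + y \<in> V" for y
  proof -
    have "\<bar>r (s + (- s + y)) - r s\<bar> \<le> e / 2" using V(3) that unfolding modulus_def by blast
    then show ?thesis using \<open>e > 0\<close> by (simp add: dist_real_def)
  qed
  then show "\<forall>\<^sub>F y in at s within UNIV. dist (r y) (r s) < e"
    unfolding eventually_at_topological
    by (intro exI[of _ "{y. - s + y \<in> V}"]) (use V open_translate_vimage(1)[OF V(1), of "- s"] in auto)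
qed

text \<open>Compactness of \<open>K\<close> gives the estimate at base points in \<open>K\<close>.
  If only \<open>s + v\<close> lies in \<open>K\<close>, the estimate is read from there in the
  direction \<open>- v\<close>; hence a symmetric \<open>V\<close>.\<close>

lemma compact_support_modulus:
  fixes f :: "'g::topological_group_add \<Rightarrow> real"
  assumes f: "continuous_on UNIV f" and K: "compact K" "\<And>s. s \<notin> K \<Longrightarrow> f s = 0" and "e > 0"
  obtains V where "open V" "0 \<in> V" "modulus V e f"
proof -
  have cont: "continuous_on UNIV (\<lambda>p::'g \<times> 'g. f (snd p + fst p) - f (snd p))"
    by (intro continuous_intros continuous_on_compose2[OF f]) auto
  obtain V' where V': "open V'" "0 \<in> V'" "\<And>v s. v \<in> V' \<Longrightarrow> s \<in> K \<Longrightarrow> f (s + v) - f s \<in> ball 0 e"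
    by (rule compact_preimage_neighbourhood[OF K(1) open_ball cont, of 0 0 e]) (use \<open>e > 0\<close> in auto)
  obtain V where V: "open V" "0 \<in> V" "V \<subseteq> V'" "\<And>v. v \<in> V \<Longrightarrow> - v \<in> V"
    using symmetric_neighbourhood[OF V'(1,2)] by blast
  have "\<bar>f (s + v) - f s\<bar> \<le> e" if v: "v \<in> V" for s v
  proof -
    have v': "v \<in> V'" "- v \<in> V'" using v V by auto
    consider "s \<in> K" | "s + v \<in> K" | "s \<notin> K" "s + v \<notin> K" by blast
    then show ?thesis
    proof cases
      case 1
      then show ?thesis using V'(3)[OF v'(1), of s] by simp
    next
      case 2
      then show ?thesis using V'(3)[OF v'(2), of "s + v"] by (simp add: add.assoc)
    next
      case 3
      then show ?thesis using K(2) \<open>e > 0\<close> by simp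
    qed
  qed
  then show ?thesis using that V by (auto simp: modulus_def)
qed

lemma vanishes_at_infinity_sum:
  assumes "finite I" "\<And>i. i \<in> I \<Longrightarrow> vanishes_at_infinity (r i)"
  shows "vanishes_at_infinity (\<lambda>s. c * (\<Sum>i\<in>I. r i s))"
  unfolding vanishes_at_infinity_def
proof (intro allI impI)
  fix e :: real assume "e > 0"
  \<comment> \<open>The increments by 1 keep \<open>D\<close> positive when \<open>c = 0\<close> or
    \<open>I\<close> is empty.\<close>
  define D where "D = (\<bar>c\<bar> + 1) * (card I + 1)"
  define d where "d = e / D"
  have pos: "D > 0" unfolding D_def by (intro mult_pos_pos) auto
  have "d > 0" using pos \<open>e > 0\<close> by (simp add: d_def)
  then have "\<forall>i\<in>I. \<exists>K. compact K \<and> (\<forall>s. s \<notin> K \<longrightarrow> \<bar>r i s\<bar> \<le> d)"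
    using assms(2) by (auto simp: vanishes_at_infinity_def)
  then obtain K where K: "\<And>i. i \<in> I \<Longrightarrow> compact (K i) \<and> (\<forall>s. s \<notin> K i \<longrightarrow> \<bar>r i s\<bar> \<le> d)" by metis
  have "\<bar>c * (\<Sum>i\<in>I. r i s)\<bar> \<le> e" if s: "s \<notin> (\<Union>i\<in>I. K i)" for s
  proof -
    have "\<bar>\<Sum>i\<in>I. r i s\<bar> \<le> (\<Sum>i\<in>I. \<bar>r i s\<bar>)" by (rule sum_abs)
    also have "\<dots> \<le> card I * d" using sum_bounded_above[of I "\<lambda>i. \<bar>r i s\<bar>" d] K s by auto
    also have "\<dots> \<le> (card I + 1) * d" using \<open>d > 0\<close> by (simp add: algebra_simps)
    finally have "\<bar>c\<bar> * \<bar>\<Sum>i\<in>I. r i s\<bar> \<le> (\<bar>c\<bar> + 1) * ((card I + 1) * d)"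
      using \<open>d > 0\<close> by (intro mult_mono) auto
    also have "\<dots> = D * d" by (simp add: D_def mult.assoc)
    also have "\<dots> = e" using pos by (simp add: d_def)
    finally show ?thesis by (simp add: abs_mult)
  qed
  then show "\<exists>K. compact K \<and> (\<forall>s. s \<notin> K \<longrightarrow> \<bar>c * (\<Sum>i\<in>I. r i s)\<bar> \<le> e)"
    using K assms(1) by (intro exI[of _ "\<Union>i\<in>I. K i"]) (auto intro!: compact_UN)
qed

section \<open>Haar measure of open sets, and averages of continuous functions\<close>

context haar_probability
begin

text \<open>Otherwise finitely many null translates of \<open>V\<close> would cover any given
  compact set, and inner regularity on \<open>UNIV\<close> would make \<open>m\<close> zero.\<close>

lemma haar_open_pos:
  assumes V: "open V" "0 \<in> V"
  shows "0 < emeasure m V"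
proof (rule ccontr)
  assume "\<not> 0 < emeasure m V"
  then have V0: "emeasure m V = 0" by (simp add: zero_less_iff_neq_zero)
  have "0 < emeasure m UNIV"
    using haar unfolding left_haar_measure_def zero_less_iff_neq_zero by blast
  then obtain K where K: "compact K" "0 < emeasure m K"
    using haar_open_inner[OF open_UNIV] by (auto simp: less_SUP_iff)
  have op: "\<And>x. open {s. - x + s \<in> V}" by (rule open_translate_vimage[OF V(1)])
  obtain F where F: "F \<subseteq> K" "finite F" "K \<subseteq> (\<Union>x\<in>F. {s. - x + s \<in> V})"
    by (rule compactE_image[OF K(1), of K "\<lambda>x. {s. - x + s \<in> V}"]) (use op V in auto)
  have "emeasure m K \<le> emeasure m (\<Union>x\<in>F. {s. - x + s \<in> V})"
    using F op by (intro emeasure_mono) auto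
  also have "\<dots> \<le> (\<Sum>x\<in>F. emeasure m {s. - x + s \<in> V})"
    using F op by (intro emeasure_subadditive_finite) auto
  also have "\<dots> = 0" using V V0 by (simp add: emeasure_haar_translate)
  finally show False using K(2) by simp
qed

lemma bump_function:
  obtains f :: "'g \<Rightarrow> real" and K where "continuous_on UNIV f" "\<And>s. 0 \<le> f s \<and> f s \<le> 1" "f 0 = 1"
    "compact K" "\<And>s. s \<notin> K \<Longrightarrow> f s = 0"
proof -
  obtain W C where W: "open W" "compact C" "{0 :: 'g} \<subseteq> W" "W \<subseteq> C"
    using locally_compact_between[OF locally_compact compact_sing open_UNIV] by auto
  have "compactin euclidean {0 :: 'g}" "closedin euclidean (- W)" "disjnt {0} (- W)"
    using W by (auto simp: disjnt_def)
  then obtain f :: "'g \<Rightarrow> real" where f: "continuous_map euclidean (top_of_set {0..1}) f"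
    "f ` (- W) \<subseteq> {0}" "f ` {0} \<subseteq> {1}"
    using Urysohn_completely_regular_compact_closed[OF zero_le_one
      completely_regular_locally_compact[OF locally_compact]] by blast
  have "continuous_on UNIV f" "\<And>s. f s \<in> {0..1}"
    using f(1) by (auto simp: continuous_map_in_subtopology image_subset_iff)
  moreover have "f s = 0" if "s \<notin> C" for s using f(2) W that by auto
  ultimately show ?thesis using that[of f C] f(3) W(2) by auto
qed

definition avg :: "('g \<Rightarrow> real) \<Rightarrow> 'g \<Rightarrow> real" where
  "avg r s = (LINT x|\<mu>. r (- x + s))"

lemma prob_measure_UNIV: "measure \<mu> UNIV = 1"
  by (simp add: measure_def)

lemma avg_integrable:
  fixes r :: "'g \<Rightarrow> real"
  assumes "continuous_on UNIV r" "\<And>s. 0 \<le> r s \<and> r s \<le> 1"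
  shows "integrable \<mu> (\<lambda>x. r (- x + s))"
proof (rule integrable_const_bound[of _ 1])
  show "(\<lambda>x. r (- x + s)) \<in> borel_measurable \<mu>"
    using assms(1) by (intro measurable_translate_compose borel_measurable_continuous_onI)
qed (use assms(2) in auto)

lemma avg_range:
  assumes r: "continuous_on UNIV r" "\<And>s. 0 \<le> r s \<and> r s \<le> 1"
  shows "0 \<le> avg r s \<and> avg r s \<le> 1"
proof
  show "0 \<le> avg r s" unfolding avg_def using r(2) by (intro Bochner_Integration.integral_nonneg) auto
  have "avg r s \<le> (LINT x|\<mu>. 1)"
    unfolding avg_def using r(2) by (intro integral_mono avg_integrable[OF r]) auto
  then show "avg r s \<le> 1" by (simp add: prob_measure_UNIV)
qed

lemma avg_modulus:
  assumes r: "continuous_on UNIV r" "\<And>s. 0 \<le> r s \<and> r s \<le> 1" and V: "modulus V e r"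
  shows "modulus V e (avg r)"
  unfolding modulus_def
proof (intro allI ballI)
  fix s v assume v: "v \<in> V"
  have "avg r (s + v) - avg r s = (LINT x|\<mu>. r (- x + (s + v)) - r (- x + s))"
    unfolding avg_def by (intro Bochner_Integration.integral_diff[symmetric] avg_integrable[OF r])
  also have "\<bar>\<dots>\<bar> \<le> (LINT x|\<mu>. \<bar>r (- x + (s + v)) - r (- x + s)\<bar>)" by (rule integral_abs_bound)
  also have "\<dots> \<le> (LINT x|\<mu>. e)"
  proof (intro integral_mono)
    show "integrable \<mu> (\<lambda>x. \<bar>r (- x + (s + v)) - r (- x + s)\<bar>)"
      by (intro integrable_abs Bochner_Integration.integrable_diff avg_integrable[OF r])
    show "\<bar>r (- x + (s + v)) - r (- x + s)\<bar> \<le> e" for x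
      using V v unfolding modulus_def by (simp add: add.assoc[symmetric])
  qed simp
  finally show "\<bar>avg r (s + v) - avg r s\<bar> \<le> e" by (simp add: prob_measure_UNIV)
qed

text \<open>A compact \<open>C\<close> carries all but \<open>e / 2\<close> of the mass of
  \<open>\<mu>\<close>. If \<open>s\<close> lies off the compact set \<open>C + K\<close>, then
  \<open>- x + s\<close> avoids \<open>K\<close> for all \<open>x \<in> C\<close>, and the remaining
  mass meets values of at most 1.\<close>

lemma avg_vanishes:
  assumes r: "continuous_on UNIV r" "\<And>s. 0 \<le> r s \<and> r s \<le> 1" and v: "vanishes_at_infinity r"
  shows "vanishes_at_infinity (avg r)"
  unfolding vanishes_at_infinity_def
proof (intro allI impI)
  fix e :: real assume "e > 0"
  obtain K where K: "compact K" "\<And>s. s \<notin> K \<Longrightarrow> \<bar>r s\<bar> \<le> e / 2"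
    using v \<open>e > 0\<close> unfolding vanishes_at_infinity_def by (meson half_gt_zero)
  have "ennreal (1 - e / 2) < emeasure \<mu> UNIV"
    using \<open>e > 0\<close> ennreal_lessI[of 1 "1 - e / 2"] by simp
  then obtain C where C: "compact C" "ennreal (1 - e / 2) < emeasure \<mu> C"
    using prob_inner[of UNIV "ennreal (1 - e / 2)"] by auto
  have Cb: "C \<in> sets \<mu>" using C by (simp add: borel_compact)
  have "1 - e / 2 \<le> measure \<mu> C"
    using C(2) emeasure_eq_measure[of C] by (metis ennreal_leI leI less_le_not_le measure_nonneg nle_le)
  moreover have "measure \<mu> (UNIV - C) = 1 - measure \<mu> C"
    using finite_measure_compl[OF Cb] by (simp add: prob_measure_UNIV)
  ultimately have Ce: "measure \<mu> (UNIV - C) \<le> e / 2" by simp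
  have "\<bar>avg r s\<bar> \<le> e" if s: "s \<notin> {c + k |c k. c \<in> C \<and> k \<in> K}" for s
  proof -
    have ind: "integrable \<mu> (\<lambda>x. indicator (UNIV - C) x :: real)"
      using Cb by (intro integrable_real_indicator) (auto simp: less_top[symmetric])
    have "avg r s \<le> (LINT x|\<mu>. e / 2 + indicator (UNIV - C) x)"
      unfolding avg_def
    proof (intro integral_mono avg_integrable[OF r])
      show "r (- x + s) \<le> e / 2 + indicator (UNIV - C) x" for x
      proof (cases "x \<in> C")
        case True
        have "- x + s \<notin> K"
        proof
          assume "- x + s \<in> K"
          moreover have "s = x + (- x + s)" by simp
          ultimately show False using s True by blast
        qed
        then show ?thesis using K(2) True by fastforce
      qed (use r(2)[of "- x + s"] \<open>e > 0\<close> in simp)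
    qed (use ind in simp)
    also have "\<dots> = e / 2 + measure \<mu> (UNIV - C)"
      using ind by (simp add: prob_measure_UNIV)
    finally show ?thesis using Ce avg_range[OF r, of s] by simp
  qed
  then show "\<exists>K. compact K \<and> (\<forall>s. s \<notin> K \<longrightarrow> \<bar>avg r s\<bar> \<le> e)"
    using compact_sums_group[OF C(1) K(1)] by blast
qed

lemma lambda1_of_real: "lambda1 \<mu> (\<lambda>s. complex_of_real (r s)) = (\<lambda>s. complex_of_real (avg r s))"
  by (simp add: lambda1_def avg_def fun_eq_iff)

lemma funpow_lambda1_of_real:
  "(lambda1 \<mu> ^^ k) (\<lambda>s. complex_of_real (r s)) = (\<lambda>s. complex_of_real ((avg ^^ k) r s))"
  by (induction k) (simp_all add: lambda1_of_real)

definition mean :: "('g \<Rightarrow> real) \<Rightarrow> nat \<Rightarrow> 'g \<Rightarrow> real" where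
  "mean r n s = (1 / n) * (\<Sum>k=1..n. (avg ^^ k) r s)"

lemma cesaro_of_real: "A n (\<lambda>s. complex_of_real (r s)) = (\<lambda>s. complex_of_real (mean r n s))"
  by (simp add: cesaro_mean_def mean_def funpow_lambda1_of_real fun_eq_iff)

text \<open>Conservation of mass, the purpose of the equality in
  \<open>conv_measurable_integral\<close>: it later rules out that the averages tend to 0 in
  L^1.\<close>

lemma nn_integral_avg:
  assumes r: "continuous_on UNIV r" "\<And>s. 0 \<le> r s \<and> r s \<le> 1" and fin: "(\<integral>\<^sup>+s. ennreal (r s) \<partial>m) < \<infinity>"
  shows "(\<integral>\<^sup>+s. ennreal (avg r s) \<partial>m) = (\<integral>\<^sup>+s. ennreal (r s) \<partial>m)"
proof -
  have "ennreal (avg r s) = conv (\<lambda>s. ennreal (r s)) s" for s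
    unfolding avg_def conv_def
    by (rule nn_integral_eq_integral[symmetric, OF avg_integrable[OF r]]) (use r in auto)
  moreover have "(\<lambda>s. ennreal (r s)) \<in> borel_measurable borel"
    using borel_measurable_continuous_onI[OF r(1)] by simp
  ultimately show ?thesis using nn_integral_conv_eq fin by simp
qed

text \<open>
  The fixed vector produced by mean ergodicity is represented by a continuous function \<open>h\<close> vanishing
  at infinity: the averages of a bump function share its modulus of continuity, so that convergence
  in mean makes them converge uniformly.
\<close>

lemma mean_ergodic_imp_harmonic:
  assumes erg: "mean_ergodic_on (L1 m) (norm1 m) (lambda1 \<mu>)"
  obtains h :: "'g \<Rightarrow> real" and s where "continuous_on UNIV h" "\<And>s. 0 \<le> h s \<and> h s \<le> 1"
    "vanishes_at_infinity h" "avg h = h" "0 < h s"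
proof -
  obtain f :: "'g \<Rightarrow> real" and K where f: "continuous_on UNIV f" "\<And>s. 0 \<le> f s \<and> f s \<le> 1" "f 0 = 1"
    and K: "compact K" "\<And>s. s \<notin> K \<Longrightarrow> f s = 0"
    by (rule bump_function) blast
  have f_mod: "\<exists>V. open V \<and> 0 \<in> V \<and> modulus V e f" if "e > 0" for e
    using compact_support_modulus[OF f(1) K that] by metis
  \<comment> \<open>Every modulus of \<open>f\<close> is to be one of \<open>r\<close> with the same
    \<open>V\<close> and \<open>e\<close>; for the family of all averages this amounts to
    equicontinuity, uniformly over the group.\<close>
  define good where "good r \<longleftrightarrow> (\<forall>s. 0 \<le> r s \<and> r s \<le> 1) \<and> (\<forall>V e. modulus V e f \<longrightarrow> modulus V e r) \<and>
      vanishes_at_infinity r" for r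
  have good_cont: "continuous_on UNIV r" if "good r" for r
  proof (rule modulus_continuous)
    fix e :: real assume "e > 0"
    then obtain V where "open V" "0 \<in> V" "modulus V e f" using f_mod by blast
    then show "\<exists>V. open V \<and> 0 \<in> V \<and> modulus V e r" using that unfolding good_def by blast
  qed
  have "vanishes_at_infinity f"
    unfolding vanishes_at_infinity_def using K by (metis abs_zero less_imp_le)
  then have "good f" using f by (simp add: good_def)
  moreover have "good (avg r)" if "good r" for r
  proof -
    have r: "\<And>s. 0 \<le> r s \<and> r s \<le> 1" "\<And>V e. modulus V e f \<Longrightarrow> modulus V e r" "vanishes_at_infinity r"
      using that unfolding good_def by blast+
    note c = good_cont[OF that]
    show ?thesis
      unfolding good_def
      using avg_range[OF c r(1)] avg_modulus[OF c r(1) r(2)] avg_vanishes[OF c r(1) r(3)] by blast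
  qed
  ultimately have good_pow: "good ((avg ^^ k) f)" for k
    by (induction k) auto
  have pow_range: "0 \<le> (avg ^^ k) f s" "(avg ^^ k) f s \<le> 1" for k s
    using good_pow[of k] by (simp_all add: good_def)
  have good_mean: "good (mean f n)" for n
    unfolding good_def
  proof (intro conjI allI impI)
    show "0 \<le> mean f n s" for s
      unfolding mean_def using pow_range by (intro mult_nonneg_nonneg sum_nonneg) auto
    have avg_le: "1 / real n * x \<le> b" if "x \<le> n * b" "0 \<le> b" for x b :: real
      using that by (cases "n = 0") (auto simp: field_simps)
    have "(\<Sum>k=1..n. (avg ^^ k) f s) \<le> n * 1" for s
      using sum_bounded_above[of "{1..n}" "\<lambda>k. (avg ^^ k) f s" 1] pow_range by simp
    then show "mean f n s \<le> 1" for s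
      unfolding mean_def by (intro avg_le) auto
    show "modulus V e (mean f n)" if V: "modulus V e f" for V e
      unfolding modulus_def
    proof (intro allI ballI)
      fix s v assume v: "v \<in> V"
      have k: "\<bar>(avg ^^ k) f (s + v) - (avg ^^ k) f s\<bar> \<le> e" for k
        using good_pow[of k] V v unfolding good_def modulus_def by blast
      have "0 \<le> e" using k[of 0] by linarith
      have "mean f n (s + v) - mean f n s = 1 / n * (\<Sum>k=1..n. (avg ^^ k) f (s + v) - (avg ^^ k) f s)"
        by (simp add: mean_def sum_subtractf diff_divide_distrib)
      then have "\<bar>mean f n (s + v) - mean f n s\<bar> = 1 / n * \<bar>\<Sum>k=1..n. (avg ^^ k) f (s + v) - (avg ^^ k) f s\<bar>"
        by (simp add: abs_mult)
      also have "\<dots> \<le> e"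
      proof (rule avg_le[OF _ \<open>0 \<le> e\<close>])
        have "\<bar>\<Sum>k=1..n. (avg ^^ k) f (s + v) - (avg ^^ k) f s\<bar> \<le> (\<Sum>k=1..n. \<bar>(avg ^^ k) f (s + v) - (avg ^^ k) f s\<bar>)"
          by (rule sum_abs)
        also have "\<dots> \<le> n * e"
          using sum_bounded_above[of "{1..n}" "\<lambda>k. \<bar>(avg ^^ k) f (s + v) - (avg ^^ k) f s\<bar>" e] k by simp
        finally show "\<bar>\<Sum>k=1..n. (avg ^^ k) f (s + v) - (avg ^^ k) f s\<bar> \<le> n * e" .
      qed
      finally show "\<bar>mean f n (s + v) - mean f n s\<bar> \<le> e" .
    qed
    show "vanishes_at_infinity (mean f n)"
      unfolding mean_def by (rule vanishes_at_infinity_sum) (use good_pow in \<open>auto simp: good_def\<close>)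
  qed
  have cont_pow [measurable]: "(avg ^^ k) f \<in> borel_measurable borel" for k
    by (intro borel_measurable_continuous_onI good_cont good_pow)
  have cont_mean [measurable]: "mean f n \<in> borel_measurable borel" for n
    by (intro borel_measurable_continuous_onI good_cont good_mean)

  define J where "J = (\<integral>\<^sup>+s. ennreal (f s) \<partial>m)"
  have J: "0 < J" "J < \<infinity>"
  proof -
    obtain c :: real where c: "0 < c" "c < 1" using dense[of 0 "1 :: real"] by auto
    have op: "open (f -` {c<..})" using f(1) by (simp add: open_vimage)
    then have "0 < ennreal c * emeasure m (f -` {c<..})"
      using haar_open_pos[of "f -` {c<..}"] f(3) c by (simp add: ennreal_zero_less_mult_iff)
    also have "\<dots> = (\<integral>\<^sup>+s. ennreal c * indicator (f -` {c<..}) s \<partial>m)"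
      using op by (intro nn_integral_cmult_indicator[symmetric]) simp
    also have "\<dots> \<le> J"
      unfolding J_def by (intro nn_integral_mono) (auto simp: indicator_def intro!: ennreal_leI)
    finally show "0 < J" .
    have "J \<le> (\<integral>\<^sup>+s. indicator K s \<partial>m)"
      unfolding J_def using f(2) K(2) by (intro nn_integral_mono) (auto simp: indicator_def)
    also have "\<dots> = emeasure m K" using K(1) by (simp add: borel_compact)
    finally show "J < \<infinity>" using haar_compact_finite[OF K(1)] by (rule le_less_trans)
  qed
  have J_pow: "(\<integral>\<^sup>+s. ennreal ((avg ^^ k) f s) \<partial>m) = J" for k
  proof (induction k)
    case (Suc k)
    then show ?case
      using nn_integral_avg[OF good_cont[OF good_pow[of k]]] good_pow[of k] J(2) by (simp add: good_def)
  qed (simp add: J_def)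
  have J_mean: "(\<integral>\<^sup>+s. ennreal (mean f n s) \<partial>m) = J" if "n > 0" for n
  proof -
    have "(\<integral>\<^sup>+s. ennreal (mean f n s) \<partial>m) = (\<integral>\<^sup>+s. ennreal (1 / n) * (\<Sum>k=1..n. ennreal ((avg ^^ k) f s)) \<partial>m)"
    proof (rule nn_integral_cong)
      fix s
      have sum: "(\<Sum>k=1..n. ennreal ((avg ^^ k) f s)) = ennreal (\<Sum>k=1..n. (avg ^^ k) f s)"
        by (rule sum_ennreal) (rule pow_range)
      show "ennreal (mean f n s) = ennreal (1 / n) * (\<Sum>k=1..n. ennreal ((avg ^^ k) f s))"
        unfolding mean_def sum by (rule ennreal_mult') simp
    qed
    also have "\<dots> = ennreal (1 / n) * (\<Sum>k=1..n. J)"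
      by (subst nn_integral_cmult) (auto simp: nn_integral_sum J_pow)
    also have "\<dots> = J"
    proof -
      have "ennreal (1 / n) * of_nat n = 1"
        using that by (simp add: ennreal_of_nat_eq_real_of_nat flip: ennreal_mult')
      then show ?thesis by (simp add: mult.assoc[symmetric])
    qed
    finally show ?thesis .
  qed

  define F where "F s = complex_of_real (f s)" for s
  have "(\<lambda>s. complex_of_real (f s)) \<in> borel_measurable borel" using cont_pow[of 0] by simp
  then have FL: "F \<in> L1 m"
    using J(2) f(2) by (simp add: F_def[abs_def] L1_def integrable_iff_bounded J_def)
  obtain P where P: "bounded_operator_on (L1 m) (norm1 m) P"
    "(\<lambda>n. norm1 m (\<lambda>s. A n F s - P F s)) \<longlonglongrightarrow> 0"
    using erg FL unfolding mean_ergodic_on_def by blast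
  have PL: "P F \<in> L1 m" using P(1) FL by (simp add: bounded_operator_on_def)
  have AF: "A n F s = complex_of_real (mean f n s)" for n s
    using cesaro_of_real[of n f] by (simp add: F_def[abs_def])
  have norm1_diff: "ennreal (norm1 m (\<lambda>s. A i F s - A j F s)) = (\<integral>\<^sup>+s. ennreal \<bar>mean f i s - mean f j s\<bar> \<partial>m)" for i j
  proof -
    have "(\<lambda>s. A i F s - A j F s) \<in> L1 m"
      using cesaro_L1[OF FL, of i] cesaro_L1[OF FL, of j] by (simp add: L1_def)
    from ennreal_norm1[OF this] show ?thesis
      unfolding AF by (simp add: of_real_diff[symmetric] norm_of_real del: of_real_diff)
  qed

  have "uniformly_Cauchy_on UNIV (mean f)"
    unfolding uniformly_Cauchy_on_def
  proof (intro allI impI)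
    fix e :: real assume "e > 0"
    \<comment> \<open>A gap of \<open>4 * d\<close> at \<open>s\<close> loses at most
      \<open>2 * d\<close> on \<open>s + V\<close>, since either average moves by at most
      \<open>d\<close> there. By left invariance it contributes at least \<open>d * w\<close> to the
      L^1 seminorm, wherever \<open>s\<close> lies; so the resulting bound is uniform.\<close>
    define d where "d = e / 4"
    have "d > 0" using \<open>e > 0\<close> by (simp add: d_def)
    obtain V0 where V0: "open V0" "0 \<in> V0" "modulus V0 d f" using f_mod[OF \<open>d > 0\<close>] by blast
    obtain W C where W: "open W" "compact C" "{0 :: 'g} \<subseteq> W" "W \<subseteq> C"
      using locally_compact_between[OF locally_compact compact_sing open_UNIV] by auto
    \<comment> \<open>Intersecting with a subset of a compact set makes the measure \<open>w\<close>
      of \<open>V\<close> finite.\<close>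
    define V where "V = V0 \<inter> W"
    have V: "open V" "0 \<in> V" using V0 W by (auto simp: V_def)
    have "emeasure m V \<le> emeasure m C" using W by (intro emeasure_mono) (auto simp: V_def borel_compact)
    then have "emeasure m V < \<infinity>" using haar_compact_finite[OF W(2)] by (rule le_less_trans)
    then obtain w where w: "emeasure m V = ennreal w" "0 < w"
      using haar_open_pos[OF V] by (cases "emeasure m V") auto
    have "\<forall>\<^sub>F n in sequentially. norm1 m (\<lambda>s. A n F s - P F s) < d * w / 2"
      using P(2) \<open>d > 0\<close> w(2) by (intro order_tendstoD) auto
    then obtain N where N: "\<And>n. n \<ge> N \<Longrightarrow> norm1 m (\<lambda>s. A n F s - P F s) < d * w / 2"
      by (auto simp: eventually_sequentially)
    have "\<bar>mean f i s - mean f j s\<bar> < e" if ij: "i \<ge> N" "j \<ge> N" for i j s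
    proof (rule ccontr)
      assume "\<not> \<bar>mean f i s - mean f j s\<bar> < e"
      then have big: "4 * d \<le> \<bar>mean f i s - mean f j s\<bar>" by (simp add: d_def)
      have "modulus V0 d (mean f i)" "modulus V0 d (mean f j)"
        using good_mean V0(3) unfolding good_def by blast+
      then have near: "d \<le> \<bar>mean f i y - mean f j y\<bar>" if "- s + y \<in> V" for y
      proof -
        have "- s + y \<in> V0" using that by (simp add: V_def)
        then have "\<bar>mean f i (s + (- s + y)) - mean f i s\<bar> \<le> d" "\<bar>mean f j (s + (- s + y)) - mean f j s\<bar> \<le> d"
          using \<open>modulus V0 d (mean f i)\<close> \<open>modulus V0 d (mean f j)\<close> unfolding modulus_def by blast+
        then show ?thesis using big \<open>d > 0\<close> by simp
      qed
      have Vs: "{y. - s + y \<in> V} \<in> sets m" using open_translate_vimage(1)[OF V(1), of "- s"] by simp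
      have "ennreal (d * w) = ennreal d * emeasure m {y. - s + y \<in> V}"
        using V(1) w \<open>d > 0\<close> by (simp add: emeasure_haar_translate ennreal_mult')
      also have "\<dots> = (\<integral>\<^sup>+y. ennreal d * indicator {y. - s + y \<in> V} y \<partial>m)"
        using Vs by (intro nn_integral_cmult_indicator[symmetric])
      also have "\<dots> \<le> (\<integral>\<^sup>+y. ennreal \<bar>mean f i y - mean f j y\<bar> \<partial>m)"
        using near by (intro nn_integral_mono) (auto simp: indicator_def intro!: ennreal_leI)
      also have "\<dots> = ennreal (norm1 m (\<lambda>s. A i F s - A j F s))" by (rule norm1_diff[symmetric])
      finally have "d * w \<le> norm1 m (\<lambda>s. A i F s - A j F s)" by simp
      also have "\<dots> \<le> norm1 m (\<lambda>s. A i F s - P F s) + norm1 m (\<lambda>s. P F s - A j F s)"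
        by (intro norm1_triangle_diff cesaro_L1 FL PL)
      also have "\<dots> < d * w / 2 + d * w / 2"
        using N[OF ij(1)] N[OF ij(2)] by (intro add_strict_mono) (simp_all add: norm1_minus_commute[of _ "P F"])
      finally show False by simp
    qed
    then show "\<exists>M. \<forall>x\<in>UNIV. \<forall>i\<ge>M. \<forall>j\<ge>M. dist (mean f i x) (mean f j x) < e"
      by (auto simp: dist_real_def)
  qed
  then obtain h where unif: "uniform_limit UNIV (mean f) h sequentially"
    using Cauchy_uniformly_convergent uniformly_convergent_on_def by blast
  have lim: "(\<lambda>n. mean f n s) \<longlonglongrightarrow> h s" for s
    using tendsto_uniform_limitI[OF unif] by simp
  have h_range: "0 \<le> h s \<and> h s \<le> 1" for s
  proof
    show "0 \<le> h s" by (rule LIMSEQ_le_const[OF lim]) (use good_mean in \<open>auto simp: good_def\<close>)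
    show "h s \<le> 1" by (rule LIMSEQ_le_const2[OF lim]) (use good_mean in \<open>auto simp: good_def\<close>)
  qed
  have h_mod: "modulus V e h" if "modulus V e f" for V e
    unfolding modulus_def
  proof (intro allI ballI)
    fix s v assume "v \<in> V"
    have "(\<lambda>n. \<bar>mean f n (s + v) - mean f n s\<bar>) \<longlonglongrightarrow> \<bar>h (s + v) - h s\<bar>"
      by (intro tendsto_intros lim)
    moreover have "\<bar>mean f n (s + v) - mean f n s\<bar> \<le> e" for n
      using good_mean[of n] that \<open>v \<in> V\<close> unfolding good_def modulus_def by blast
    ultimately show "\<bar>h (s + v) - h s\<bar> \<le> e" by (intro LIMSEQ_le_const2) auto
  qed
  have h_cont: "continuous_on UNIV h"
  proof (rule modulus_continuous)
    fix e :: real assume "e > 0"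
    then obtain V where "open V" "0 \<in> V" "modulus V e f" using f_mod by blast
    then show "\<exists>V. open V \<and> 0 \<in> V \<and> modulus V e h" using h_mod by blast
  qed
  have h_van: "vanishes_at_infinity h"
    unfolding vanishes_at_infinity_def
  proof (intro allI impI)
    fix e :: real assume "e > 0"
    have "\<exists>N. \<forall>n\<ge>N. \<forall>s\<in>UNIV. dist (mean f n s) (h s) < e / 2"
      using unif[unfolded uniform_limit_sequentially_iff, rule_format, of "e / 2"] \<open>e > 0\<close> by simp
    then obtain n where n: "\<And>s. dist (mean f n s) (h s) < e / 2" by blast
    have "vanishes_at_infinity (mean f n)" using good_mean[of n] unfolding good_def by blast
    then obtain K where "compact K \<and> (\<forall>s. s \<notin> K \<longrightarrow> \<bar>mean f n s\<bar> \<le> e / 2)"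
      using half_gt_zero[OF \<open>e > 0\<close>] unfolding vanishes_at_infinity_def by blast
    then have K: "compact K" "\<And>s. s \<notin> K \<Longrightarrow> \<bar>mean f n s\<bar> \<le> e / 2" by blast+
    have "\<bar>h s\<bar> \<le> e" if "s \<notin> K" for s
      using n[of s] K(2)[OF that] unfolding dist_real_def by linarith
    then show "\<exists>K. compact K \<and> (\<forall>s. s \<notin> K \<longrightarrow> \<bar>h s\<bar> \<le> e)" using K by blast
  qed
  \<comment> \<open>Applying \<open>avg\<close> to an average changes it by a telescoped term of
    size at most \<open>1 / n\<close>, so the limits of \<open>mean f n\<close> and
    \<open>avg (mean f n)\<close> agree.\<close>
  have "avg h s = h s" for s
  proof -
    have 1: "(\<lambda>n. avg (mean f n) s) \<longlonglongrightarrow> avg h s"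
      unfolding avg_def
    proof (rule integral_dominated_convergence[where w = "\<lambda>_. 1"])
      show "(\<lambda>x. h (- x + s)) \<in> borel_measurable \<mu>"
        by (intro measurable_translate_compose borel_measurable_continuous_onI h_cont)
      show "(\<lambda>x. mean f i (- x + s)) \<in> borel_measurable \<mu>" for i
        by (intro measurable_translate_compose cont_mean)
      show "AE x in \<mu>. norm (mean f i (- x + s)) \<le> 1" for i
        using good_mean[of i] by (auto simp: good_def)
    qed (use lim in auto)
    have "avg (mean f n) s - mean f n s = 1 / n * ((avg ^^ Suc n) f s - avg f s)" for n
    proof -
      have int: "integrable \<mu> (\<lambda>x. (avg ^^ k) f (- x + s))" for k
        using avg_integrable[OF good_cont[OF good_pow[of k]]] pow_range by blast
      have "avg (mean f n) s = 1 / n * (LINT x|\<mu>. (\<Sum>k=1..n. (avg ^^ k) f (- x + s)))"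
        unfolding avg_def[of "mean f n"] mean_def by (rule integral_mult_right_zero)
      also have "(LINT x|\<mu>. (\<Sum>k=1..n. (avg ^^ k) f (- x + s))) = (\<Sum>k=1..n. LINT x|\<mu>. (avg ^^ k) f (- x + s))"
        by (intro Bochner_Integration.integral_sum int)
      also have "\<dots> = (\<Sum>k=1..n. (avg ^^ Suc k) f s)"
        by (simp add: avg_def[symmetric])
      finally have "avg (mean f n) s = 1 / n * (\<Sum>k=1..n. (avg ^^ Suc k) f s)" .
      then have "avg (mean f n) s - mean f n s = 1 / n * (\<Sum>k=1..n. (avg ^^ Suc k) f s - (avg ^^ k) f s)"
        by (simp add: mean_def sum_subtractf diff_divide_distrib del: funpow.simps)
      also have "(\<Sum>k=1..n. (avg ^^ Suc k) f s - (avg ^^ k) f s) = (avg ^^ Suc n) f s - (avg ^^ 1) f s"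
        by (cases "n = 0") (simp, subst sum_Suc_diff, auto)
      finally show ?thesis by simp
    qed
    moreover have "(\<lambda>n. 1 / n * ((avg ^^ Suc n) f s - avg f s)) \<longlonglongrightarrow> 0"
    proof (rule Lim_null_comparison)
      show "\<forall>\<^sub>F n in sequentially. norm (1 / n * ((avg ^^ Suc n) f s - avg f s)) \<le> 1 / n * 1"
      proof (rule always_eventually, intro allI)
        fix n
        have "\<bar>(avg ^^ Suc n) f s - (avg ^^ 1) f s\<bar> \<le> 1"
          using good_pow[of "Suc n"] good_pow[of 1] unfolding good_def by (smt (verit))
        then show "norm (1 / n * ((avg ^^ Suc n) f s - avg f s)) \<le> 1 / n * 1"
          unfolding real_norm_def abs_mult by (intro mult_mono) auto
      qed
      show "(\<lambda>n. 1 / real n * 1) \<longlonglongrightarrow> 0" using lim_1_over_n by simp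
    qed
    ultimately have "(\<lambda>n. (avg (mean f n) s - mean f n s) + mean f n s) \<longlonglongrightarrow> 0 + h s"
      using lim by (intro tendsto_add) auto
    then show "avg h s = h s" using LIMSEQ_unique[OF 1] by simp
  qed
  then have "avg h = h" by auto
  \<comment> \<open>If \<open>h\<close> vanished, an almost everywhere convergent subsequence would
    identify \<open>P F\<close> with 0, and the averages would tend to 0 in L^1, contrary to their
    constant mass \<open>J > 0\<close>.\<close>
  moreover have "\<exists>s. 0 < h s"
  proof (rule ccontr)
    assume "\<not> (\<exists>s. 0 < h s)"
    then have h0: "h s = 0" for s using h_range[of s] by (metis order_antisym not_le)
    have "\<And>n. integrable m (\<lambda>s. A n F s - P F s)"
      using cesaro_L1[OF FL] PL by (simp add: L1_def)
    then obtain r where r: "strict_mono r" "AE s in m. (\<lambda>n. A (r n) F s - P F s) \<longlonglongrightarrow> 0"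
      using tendsto_L1_AE_subseq[of m "\<lambda>n s. A n F s - P F s"] P(2) unfolding norm1_def by blast
    have "AE s in m. P F s = 0"
      using r(2)
    proof eventually_elim
      fix s assume "(\<lambda>n. A (r n) F s - P F s) \<longlonglongrightarrow> 0"
      moreover have "(\<lambda>n. A (r n) F s) \<longlonglongrightarrow> of_real 0"
        unfolding AF using LIMSEQ_subseq_LIMSEQ[OF lim r(1), of s] h0[of s]
        by (intro tendsto_of_real) (simp add: o_def)
      ultimately have "(\<lambda>n. A (r n) F s - (A (r n) F s - P F s)) \<longlonglongrightarrow> of_real 0 - 0"
        by (intro tendsto_diff)
      then show "P F s = 0" by (simp add: LIMSEQ_const_iff)
    qed
    then have "norm1 m (\<lambda>s. A n F s - P F s) = norm1 m (A n F)" for n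
      using cesaro_L1[OF FL, of n] PL by (intro norm1_cong_AE) (auto simp: L1_def)
    then have to0: "(\<lambda>n. norm1 m (A n F)) \<longlonglongrightarrow> 0" using P(2) by simp
    have "ennreal (norm1 m (A n F)) = J" if "n > 0" for n
      unfolding ennreal_norm1[OF cesaro_L1[OF FL]] AF
      using good_mean[of n] J_mean[OF that] by (simp add: good_def)
    then have "\<forall>\<^sub>F n in sequentially. ennreal (norm1 m (A n F)) = J"
      by (intro eventually_sequentiallyI[of 1]) auto
    then have "(\<lambda>n. ennreal (norm1 m (A n F))) \<longlonglongrightarrow> J"
      by (rule tendsto_eventually)
    moreover have "(\<lambda>n. ennreal (norm1 m (A n F))) \<longlonglongrightarrow> ennreal 0"
      by (intro tendsto_ennrealI to0)
    ultimately show False using LIMSEQ_unique J(1) by fastforce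
  qed
  ultimately show ?thesis using that h_cont h_range h_van by blast
qed

section \<open>The maximum principle for harmonic functions\<close>

lemma mean_ergodic_imp_compact:
  assumes erg: "mean_ergodic_on (L1 m) (norm1 m) (lambda1 \<mu>)"
  shows "compact (H_of \<mu>)"
proof -
  obtain h :: "'g \<Rightarrow> real" and s0 where h: "continuous_on UNIV h" "\<And>s. 0 \<le> h s \<and> h s \<le> 1"
    "vanishes_at_infinity h" "avg h = h" "0 < h s0"
    by (rule mean_ergodic_imp_harmonic[OF erg]) blast
  \<comment> \<open>Off \<open>K\<close> the function stays below half of its positive value at
    \<open>s0\<close>. Hence the maximum over \<open>K\<close> is the maximum over the group, and it
    is attained nowhere else.\<close>
  obtain K where K: "compact K" "\<And>s. s \<notin> K \<Longrightarrow> \<bar>h s\<bar> \<le> h s0 / 2"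
    using h(3,5) unfolding vanishes_at_infinity_def by (meson half_gt_zero)
  have s0K: "s0 \<in> K"
  proof (rule ccontr)
    assume "s0 \<notin> K"
    then have "\<bar>h s0\<bar> \<le> h s0 / 2" by (rule K(2))
    then show False using h(5) by simp
  qed
  then obtain s1 where s1: "s1 \<in> K" "\<And>s. s \<in> K \<Longrightarrow> h s \<le> h s1"
    using continuous_attains_sup[OF K(1), of h] continuous_on_subset[OF h(1)] by blast
  define c where "c = h s1"
  have c0: "h s0 \<le> c" using s1(2)[OF s0K] by (simp add: c_def)
  have off: "h s < c" if "s \<notin> K" for s using K(2)[OF that] h(5) c0 by linarith
  have max: "h s \<le> c" for s
    using s1(2)[of s] off[of s] by (cases "s \<in> K") (auto simp: c_def)
  define M where "M = {s. h s = c}"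
  have "M = K \<inter> h -` {c}" using off by (auto simp: M_def)
  moreover have "closed (h -` {c})"
    using h(1) by (intro closed_vimage) auto
  ultimately have "compact M" using compact_Int_closed[OF K(1)] by simp
  moreover have "M \<noteq> {}" by (auto simp: M_def c_def)
  moreover have "- x + y \<in> M" if x: "x \<in> msupport \<mu>" and y: "y \<in> M" for x y
  proof (rule ccontr)
    assume "- x + y \<notin> M"
    then have "h (- x + y) < c" using max[of "- x + y"] by (auto simp: M_def)
    note hi = avg_integrable[OF h(1,2), of y]
    \<comment> \<open>Harmonicity at the maximum point \<open>y\<close> gives the nonnegative
      function \<open>c - h (- x + y)\<close> integral 0. The set where it is positive is open and
      thus, if it meets the support, of positive measure.\<close>
    have "(LINT x|\<mu>. c - h (- x + y)) = c - avg h y"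
      using hi by (simp add: avg_def prob_measure_UNIV)
    then have "(LINT x|\<mu>. c - h (- x + y)) = 0" using y h(4) by (simp add: M_def)
    then have "AE x in \<mu>. c - h (- x + y) = 0"
      using hi max by (subst (asm) integral_nonneg_eq_0_iff_AE) auto
    then have "AE x in \<mu>. \<not> h (- x + y) < c" by eventually_elim simp
    moreover have op: "open {x. h (- x + y) < c}"
      by (intro open_Collect_less continuous_on_compose2[OF h(1)] continuous_intros) auto
    ultimately have "emeasure \<mu> {x. h (- x + y) < c} = 0"
      by (subst (asm) AE_iff_measurable[OF _ refl]) auto
    moreover have "0 < emeasure \<mu> {x. h (- x + y) < c}"
      using x op \<open>h (- x + y) < c\<close> unfolding msupport_def by blast
    ultimately show False by simp
  qed
  ultimately show ?thesis
    unfolding H_of_def by (rule compact_closed_subgroup_generated)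
qed

end

theorem theorem5p4:
  fixes m \<mu> :: "'g::{t2_space, topological_group_add} measure"
  assumes "locally compact (UNIV :: 'g set)"
    and "left_haar_measure m"
    and "regular_probability \<mu>"
  shows "mean_ergodic_on (L1 m) (norm1 m) (lambda1 \<mu>) \<longleftrightarrow> compact (H_of \<mu>)"
proof -
  interpret haar_probability m \<mu>
    using assms by unfold_locales
  show ?thesis
    using mean_ergodic_imp_compact compact_imp_mean_ergodic by blast
qed

end
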